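(* Let $m=2$. If $\mathcal{B}$ has no pair of linearly dependent rows lying in the interiors of opposite quadrants of $\mathbb{Z}^2$, then $\mathrm{rank}(H_{\mathcal{B}}(c))=d_1\cdot d_2$ for all $c\in\mathbb{C}^n$.
   Context: $\mathcal{B}=(b_{ji})\in\mathbb{Z}^{n\times2}$ ($n>2$) of rank 2 with rows $b_j$ summing to zero and columns $b^{(1)},b^{(2)}$; $A=(a_{kj})\in\mathbb{Z}^{(n-2)\times n}$ of rank $n-2$, first row all ones, $A\mathcal{B}=0$. $I=\langle\partial^{b^{(1)}_+}-\partial^{b^{(1)}_-},\partial^{b^{(2)}_+}-\partial^{b^{(2)}_-}\rangle$ (with $u=u_+-u_-$, $u_\pm\ge0$ of disjoint supports), and $H_{\mathcal{B}}(c)=D_nI+D_n\langle\sum_ja_{kj}x_j\partial_j-(Ac)_k:k=1,\dots,n-2\rangle$. $d_i=\sum_{j:b_{ji}>0}b_{ji}$ is the degree of the $i$-th generator of $I$. Rank = dimension of the space of holomorphic solutions near a generic point. *)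

theory Defs
  imports "HOL-Analysis.Analysis"
begin

text \<open>Points of C^n are vectors complex^'n; the index type 'n is finite with CARD('n) = n.
  A linear order on 'n is only used to fix an order in which partial derivatives are applied
  (irrelevant for holomorphic functions, whose partials commute).\<close>

definition upd :: "complex^'n \<Rightarrow> 'n \<Rightarrow> complex \<Rightarrow> complex^'n" where
  "upd x j z = (\<chi> i. if i = j then z else x $ i)"

definition pd :: "'n \<Rightarrow> (complex^'n \<Rightarrow> complex) \<Rightarrow> complex^'n \<Rightarrow> complex" where
  "pd j f x = deriv (\<lambda>z. f (upd x j z)) (x $ j)"

text \<open>Holomorphic on an open set (Osgood: continuous and holomorphic in each variable separately).\<close>
definition hol_on :: "(complex^'n) set \<Rightarrow> (complex^'n \<Rightarrow> complex) \<Rightarrow> bool" where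
  "hol_on U f \<longleftrightarrow> open U \<and> continuous_on U f \<and>
     (\<forall>x\<in>U. \<forall>j. (\<lambda>z. f (upd x j z)) field_differentiable (at (x $ j)))"

definition dpow :: "('n::{finite,linorder} \<Rightarrow> nat) \<Rightarrow> (complex^('n::{finite,linorder}) \<Rightarrow> complex) \<Rightarrow> complex^('n::{finite,linorder}) \<Rightarrow> complex" where
  "dpow u f = foldr (\<lambda>j g. (pd j ^^ u j) g) (sorted_list_of_set UNIV) f"

definition pospart :: "('n \<Rightarrow> int) \<Rightarrow> 'n \<Rightarrow> nat" where
  "pospart u j = nat (u j)"
definition negpart :: "('n \<Rightarrow> int) \<Rightarrow> 'n \<Rightarrow> nat" where
  "negpart u j = nat (- u j)"

text \<open>Holomorphic solutions on U of H_B(c): the columns b1, b2 of B, the matrix A given by rows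
  A k (k < CARD('n) - 2).  Solutions of the left ideal are the solutions of its generators.\<close>
definition hsol :: "(('n::{finite,linorder}) \<Rightarrow> int) \<Rightarrow> (('n::{finite,linorder}) \<Rightarrow> int) \<Rightarrow> (nat \<Rightarrow> ('n::{finite,linorder}) \<Rightarrow> int)
     \<Rightarrow> complex^('n::{finite,linorder}) \<Rightarrow> (complex^('n::{finite,linorder})) set \<Rightarrow> (complex^('n::{finite,linorder}) \<Rightarrow> complex) set" where
  "hsol b1 b2 A c U = {f. hol_on U f \<and>
     (\<forall>x\<in>U. dpow (pospart b1) f x = dpow (negpart b1) f x) \<and>
     (\<forall>x\<in>U. dpow (pospart b2) f x = dpow (negpart b2) f x) \<and>
     (\<forall>k < CARD('n) - 2. \<forall>x\<in>U.
        (\<Sum>j\<in>UNIV. of_int (A k j) * x $ j * pd j f x)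
          - (\<Sum>j\<in>UNIV. of_int (A k j) * c $ j) * f x = 0)}"

definition sol_dim_on :: "(complex^'n) set \<Rightarrow> (complex^'n \<Rightarrow> complex) set \<Rightarrow> nat \<Rightarrow> bool" where
  "sol_dim_on U S N \<longleftrightarrow> (\<exists>F :: nat \<Rightarrow> complex^'n \<Rightarrow> complex.
     (\<forall>i<N. F i \<in> S) \<and>
     (\<forall>a :: nat \<Rightarrow> complex. (\<forall>x\<in>U. (\<Sum>i<N. a i * F i x) = 0) \<longrightarrow> (\<forall>i<N. a i = 0)) \<and>
     (\<forall>f\<in>S. \<exists>a :: nat \<Rightarrow> complex. \<forall>x\<in>U. f x = (\<Sum>i<N. a i * F i x)))"

text \<open>Holonomic rank N: near every point of a dense open set of C^n (complement of the singular
  locus), the space of holomorphic solutions on all sufficiently small balls has dimension N.\<close>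
definition has_rank :: "(('n::{finite,linorder}) \<Rightarrow> int) \<Rightarrow> (('n::{finite,linorder}) \<Rightarrow> int) \<Rightarrow> (nat \<Rightarrow> ('n::{finite,linorder}) \<Rightarrow> int)
     \<Rightarrow> complex^('n::{finite,linorder}) \<Rightarrow> nat \<Rightarrow> bool" where
  "has_rank b1 b2 A c N \<longleftrightarrow> (\<exists>G. open G \<and> closure G = UNIV \<and>
     (\<forall>p\<in>G. \<exists>\<epsilon>>0. \<forall>r. 0 < r \<and> r < \<epsilon> \<longrightarrow> sol_dim_on (ball p r) (hsol b1 b2 A c (ball p r)) N))"

definition gdeg :: "('n::finite \<Rightarrow> int) \<Rightarrow> int" where
  "gdeg b = (\<Sum>j\<in>{j. b j > 0}. b j)"

end

theory Submission
  imports Defs "HOL-Complex_Analysis.Complex_Analysis"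
    "HOL-Computational_Algebra.Computational_Algebra" "HOL-Computational_Algebra.Field_as_Ring"
begin

text \<open>On a solution f of the Euler equations, x_j d/dx_j acts as L_j = c_j + b1_j D1 + b2_j D2 with two
  commuting operators D1, D2. So near p the function f is determined by the linear functional
  l(w) = (w(D1, D2) f)(p) on C[X, Y], and the two binomial equations say exactly that l vanishes on the
  images of the operators T_i w = P_i w - p^(b_i) Q_i w(. + e_i), where P_i and Q_i are products of
  falling factorials of the L_j.

  The leading forms of T_1, T_2 are binary forms of degrees d1, d2. By the hypothesis on the rows of B
  they are coprime for generic p. Since the two binomials commute, the Koszul syzygy of the leading
  forms lifts to a relation T_1 T_2' = T_2 T_1', so im T_1 + im T_2 has no unexpected leading forms and
  has the same codimension d1 d2 as the ideal of the two leading forms.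

  Conversely, writing the forms of degree d1 + d2 - 1 in terms of the two leading forms yields a
  bound K (a + b)! R^(a + b) for l(X^a Y^b) whenever l vanishes on both images. Hence
  x^c times the sum of l(X^a Y^b) t1^a t2^b / (a! b!), with t_i = log((x/p)^(b_i)), converges near p,
  and up to a constant factor it is a solution with functional l.\<close>

text \<open>With x^(b_i) frozen at its value at p, the operator T_i contains a shift, because
  differentiating x^(b_i) adds b_ij to the symbol L_j. So im T_1 + im T_2 is a subspace of C[X, Y]
  but in general not an ideal, and commutative algebra yields neither its codimension nor
  convergence. Both rest on one fact: a shift leaves the leading form alone and disturbs only lower
  degrees. For convergence this disturbance is (X + 1)^a - X^a, whose binomial coefficients are
  large; the factorial in the growth bound is there to absorb them. The parameter c is the constant
  term of L_j and never reaches a leading form, so no value of c is exceptional. The row hypothesis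
  is what generic p cannot supply: two dependent rows in opposite open quadrants give a z at which
  all four products of linear forms vanish, and the two leading forms then share a zero for every
  p.\<close>

no_notation fps_nth (infixl "$" 75)

section \<open>Polynomials in two variables graded by total degree\<close>

lemma poly_map_poly_hom:
  fixes f :: "'a::comm_ring_1 \<Rightarrow> 'b::comm_ring_1"
  assumes "f 0 = 0" "f 1 = 1" "\<And>a b. f (a + b) = f a + f b" "\<And>a b. f (a * b) = f a * f b"
  shows "poly (map_poly f (pCons a p)) x = f a + x * poly (map_poly f p) x"
    and "poly (map_poly f (p + q)) x = poly (map_poly f p) x + poly (map_poly f q) x"
    and "poly (map_poly f (p * q)) x = poly (map_poly f p) x * poly (map_poly f q) x"
proof -
  show pC: "poly (map_poly f (pCons a p)) x = f a + x * poly (map_poly f p) x" for a p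
    by (cases "a = 0 \<and> p = 0") (auto simp: map_poly_pCons assms(1))
  have add: "map_poly f (p + q) = map_poly f p + map_poly f q" for p q
    by (intro poly_eqI) (simp add: coeff_map_poly assms)
  show "poly (map_poly f (p + q)) x = poly (map_poly f p) x + poly (map_poly f q) x"
    by (simp add: add)
  have sm: "map_poly f (smult a q) = smult (f a) (map_poly f q)" for a q
    by (intro poly_eqI) (simp add: coeff_map_poly assms)
  show "poly (map_poly f (p * q)) x = poly (map_poly f p) x * poly (map_poly f q) x"
  proof (induction p)
    case (pCons a p)
    have "poly (map_poly f (pCons a p * q)) x = f a * poly (map_poly f q) x + poly (map_poly f (pCons 0 (p * q))) x"
      by (simp add: mult_pCons_left add sm)
    then show ?case using pCons by (simp add: pC algebra_simps assms(1))
  qed simp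
qed

definition cst :: "complex \<Rightarrow> complex poly poly" where "cst c = [:[:c:]:]"
definition XX :: "complex poly poly" where "XX = [:0, 1:]"
definition YY :: "complex poly poly" where "YY = [:[:0, 1:]:]"

text \<open>The outer variable of \<open>complex poly poly\<close> is X and the inner one is Y;
  \<open>ev a b\<close> is the endomorphism over the constants with X to a and Y to b.\<close>

definition ev :: "complex poly poly \<Rightarrow> complex poly poly \<Rightarrow> complex poly poly \<Rightarrow> complex poly poly" where
  "ev a b w = poly (map_poly (\<lambda>q. poly (map_poly cst q) b) w) a"

lemma cst_simps [simp]: "cst 0 = 0" "cst 1 = 1" "cst (a + b) = cst a + cst b" "cst (a * b) = cst a * cst b"
  "cst (- a) = - cst a" "cst (a - b) = cst a - cst b" "cst a = 0 \<longleftrightarrow> a = 0"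
  by (auto simp: cst_def one_pCons)

lemma cst_sum: "cst (sum f I) = (\<Sum>i\<in>I. cst (f i))"
  by (induction I rule: infinite_finite_induct) auto

lemmas ev_inner = poly_map_poly_hom[of cst, OF cst_simps(1-4)]

lemma ev_inner_1 [simp]: "poly (map_poly cst 1) b = 1"
  by (simp add: one_pCons map_poly_pCons)

lemma ev_add [simp]: "ev a b (u + v) = ev a b u + ev a b v"
  and ev_mult [simp]: "ev a b (u * v) = ev a b u * ev a b v"
  and ev_pCons: "ev a b (pCons q w) = poly (map_poly cst q) b + a * ev a b w"
  unfolding ev_def by (subst poly_map_poly_hom; simp add: ev_inner)+

lemma ev_0 [simp]: "ev a b 0 = 0" by (simp add: ev_def)
lemma ev_cst [simp]: "ev a b (cst c) = cst c"
  by (simp add: cst_def[of c] ev_pCons ev_inner)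
lemma ev_XX [simp]: "ev a b XX = a" by (simp add: XX_def ev_pCons)
lemma ev_YY [simp]: "ev a b YY = b" by (simp add: YY_def ev_pCons ev_inner)
lemma ev_1 [simp]: "ev a b 1 = 1" using ev_cst[of a b 1] by simp
lemma ev_minus [simp]: "ev a b (- u) = - ev a b u"
  using ev_add[of a b u "-u"] by (simp add: eq_neg_iff_add_eq_0 add.commute)
lemma ev_diff [simp]: "ev a b (u - v) = ev a b u - ev a b v"
  using ev_add[of a b u "- v"] by simp
lemma ev_power [simp]: "ev a b (u ^ n) = ev a b u ^ n" by (induction n) auto
lemma ev_prod: "ev a b (prod f I) = (\<Prod>i\<in>I. ev a b (f i))"
  by (induction I rule: infinite_finite_induct) auto
lemma ev_sum: "ev a b (sum f I) = (\<Sum>i\<in>I. ev a b (f i))"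
  by (induction I rule: infinite_finite_induct) auto

lemma pCons_conv_XX: "pCons q w = [:q:] + XX * w" by (simp add: XX_def)
lemma const_pCons_conv_YY: "[:pCons a q:] = cst a + YY * [:q:]" by (simp add: YY_def cst_def)

text \<open>The monomials span over the constants. A factor X^i Y^j is carried through the proof
  because peeling off one coefficient raises an exponent.\<close>

lemma bipoly_induct [case_names add scale monom]:
  assumes "\<And>u v. P u \<Longrightarrow> P v \<Longrightarrow> P (u + v)" "\<And>a u. P u \<Longrightarrow> P (cst a * u)"
    "\<And>i j. P (XX ^ i * YY ^ j)"
  shows "P w"
proof -
  have "P (XX ^ i * YY ^ j * [:q:])" for i j q
  proof (induction q arbitrary: j)
    case 0
    show ?case using assms(2)[OF assms(3)[of i j], of 0] by simp
  next
    case (pCons a q)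
    have "XX ^ i * YY ^ j * [:pCons a q:] = cst a * (XX ^ i * YY ^ j) + XX ^ i * YY ^ Suc j * [:q:]"
      unfolding const_pCons_conv_YY by (simp add: algebra_simps)
    then show ?case using pCons.IH[of "Suc j"] assms by metis
  qed
  note mon = this
  have c: "P (XX ^ i * [:q:])" for i q using mon[of i 0 q] by simp
  have "P (XX ^ i * w)" for i
  proof (induction w arbitrary: i)
    case 0
    show ?case using c[of i 0] by simp
  next
    case (pCons q w)
    have "XX ^ i * pCons q w = XX ^ i * [:q:] + XX ^ Suc i * w"
      unfolding pCons_conv_XX[of q w] by (simp add: algebra_simps)
    then show ?case using pCons.IH[of "Suc i"] c[of i q] assms(1) by metis
  qed
  from this[of 0] show ?thesis by simp
qed

text \<open>The substitution X = x t, Y = t, where t is the outer variable: the total degree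
  becomes the degree in t, and the form of degree k becomes its dehomogenisation in x.\<close>
definition grad :: "complex poly poly \<Rightarrow> complex poly poly" where
  "grad = ev (monom [:0, 1:] 1) (monom 1 1)"

abbreviation form :: "nat \<Rightarrow> complex poly poly \<Rightarrow> complex poly" where
  "form k w \<equiv> coeff (grad w) k"

lemma grad_simps [simp]: "grad (u + v) = grad u + grad v" "grad (u * v) = grad u * grad v"
  "grad (u - v) = grad u - grad v" "grad (- u) = - grad u" "grad 0 = 0" "grad 1 = 1" "grad (cst a) = cst a"
  "grad (u ^ n) = grad u ^ n"
  by (simp_all add: grad_def)

lemma grad_monom: "grad (XX ^ i * YY ^ j) = monom (monom 1 i) (i + j)"
  by (simp add: grad_def monom_power mult_monom) (simp add: monom_altdef)

text \<open>The strict bound makes \<open>deg_lt 0\<close> the zero space, so the zero polynomial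
  needs no convention and bounds such as \<open>deg_lt e2\<close> remain meaningful for e2 =
  0.\<close>

definition deg_lt :: "nat \<Rightarrow> complex poly poly set" where
  "deg_lt m = {w. \<forall>k\<ge>m. form k w = 0}"

lemma form_cst: "form k (cst a) = (if k = 0 then [:a:] else 0)"
  unfolding grad_simps by (simp add: cst_def coeff_pCons split: nat.splits)

lemma form_cmult: "form k (cst a * u) = smult a (form k u)"
  unfolding grad_simps by (simp add: cst_def)

lemma coeff_form: "coeff (form k w) i = (if i \<le> k then coeff (coeff w i) (k - i) else 0)"
proof -
  have A: "form k [:q:] = [:coeff q k:]" for k q
  proof (induction q arbitrary: k)
    case (pCons a q)
    have "grad (cst a + YY * [:q:]) = cst a + monom 1 1 * grad [:q:]"
      unfolding grad_def ev_add ev_mult ev_cst ev_YY ..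
    then have "form k (cst a + YY * [:q:]) = (if k = 0 then [:a:] else 0) + coeff (monom 1 1 * grad [:q:]) k"
      by (simp add: cst_def coeff_pCons split: nat.splits)
    then show ?case unfolding const_pCons_conv_YY using pCons
      by (cases k) (auto simp: coeff_monom_mult)
  qed simp
  show ?thesis
  proof (induction w arbitrary: k i)
    case (pCons q w)
    have "grad XX = monom [:0, 1:] 1" by (simp add: grad_def)
    then have "form k (pCons q w) = [:coeff q k:] + (if k = 0 then 0 else [:0,1:] * form (k - 1) w)"
      unfolding pCons_conv_XX[of q w] by (simp add: A coeff_monom_mult)
    then show ?case using pCons.IH
      by (cases i; cases k) auto
  qed simp
qed

lemma degree_form: "degree (form k w) \<le> k"
  by (rule degree_le) (simp add: coeff_form)

lemma deg_lt_iff: "w \<in> deg_lt m \<longleftrightarrow> (\<forall>i j. m \<le> i + j \<longrightarrow> coeff (coeff w i) j = 0)"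
proof
  assume "w \<in> deg_lt m"
  then show "\<forall>i j. m \<le> i + j \<longrightarrow> coeff (coeff w i) j = 0"
    by (auto simp: deg_lt_def) (metis coeff_0 coeff_form diff_add_inverse le_add1)
next
  assume "\<forall>i j. m \<le> i + j \<longrightarrow> coeff (coeff w i) j = 0"
  then show "w \<in> deg_lt m"
    by (auto simp: deg_lt_def poly_eq_iff coeff_form)
qed

lemma deg_lt_0 [simp]: "w \<in> deg_lt 0 \<longleftrightarrow> w = 0"
  by (auto simp: deg_lt_iff poly_eq_iff)

lemma zero_in_deg_lt [simp]: "0 \<in> deg_lt m"
  and deg_lt_add: "u \<in> deg_lt m \<Longrightarrow> v \<in> deg_lt m \<Longrightarrow> u + v \<in> deg_lt m"
  and deg_lt_diff: "u \<in> deg_lt m \<Longrightarrow> v \<in> deg_lt m \<Longrightarrow> u - v \<in> deg_lt m"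
  and deg_lt_mono: "u \<in> deg_lt m \<Longrightarrow> m \<le> n \<Longrightarrow> u \<in> deg_lt n"
  by (auto simp: deg_lt_def)

lemma deg_lt_Suc_iff: "w \<in> deg_lt m \<longleftrightarrow> w \<in> deg_lt (Suc m) \<and> form m w = 0"
  by (auto simp: deg_lt_def le_Suc_eq Suc_le_eq dest: le_neq_implies_less)

lemma degree_grad: "w \<in> deg_lt (Suc m) \<longleftrightarrow> degree (grad w) \<le> m"
  by (auto simp: deg_lt_def intro: degree_le) (meson coeff_eq_0 le_trans not_less_eq_eq order.strict_trans2 not_le)

lemma deg_lt_mult: "u \<in> deg_lt (Suc m) \<Longrightarrow> v \<in> deg_lt (Suc n) \<Longrightarrow> u * v \<in> deg_lt (Suc (m + n))"
  using degree_mult_le[of "grad u" "grad v"] by (simp add: degree_grad)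

lemma coeff_mult_degree_le:
  fixes p q :: "'a::comm_semiring_0 poly"
  assumes "degree p \<le> m" "degree q \<le> n"
  shows "coeff (p * q) (m + n) = coeff p m * coeff q n"
proof -
  have "coeff (p * q) (m + n) = (\<Sum>i\<le>m + n. coeff p i * coeff q (m + n - i))"
    by (simp add: coeff_mult)
  also have "\<dots> = (\<Sum>i\<le>m + n. if i = m then coeff p m * coeff q n else 0)"
  proof (intro sum.cong refl)
    fix i assume "i \<in> {..m + n}"
    moreover have "coeff p i = 0" if "i > m" using assms that by (intro coeff_eq_0) auto
    moreover have "coeff q (m + n - i) = 0" if "i < m" using assms that by (intro coeff_eq_0) auto
    ultimately show "coeff p i * coeff q (m + n - i) = (if i = m then coeff p m * coeff q n else 0)"
      by (cases i m rule: linorder_cases) auto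
  qed
  also have "\<dots> = coeff p m * coeff q n" by simp
  finally show ?thesis .
qed

text \<open>The numbers m and n are only upper bounds for the degrees, so either factor on the right
  may be zero.\<close>

lemma form_mult:
  assumes "u \<in> deg_lt (Suc m)" "v \<in> deg_lt (Suc n)"
  shows "form (m + n) (u * v) = form m u * form n v"
  using assms by (simp add: degree_grad coeff_mult_degree_le)

lemma monom_in_deg_lt: "XX ^ i * YY ^ j \<in> deg_lt m \<longleftrightarrow> i + j < m"
  unfolding deg_lt_def grad_monom mem_Collect_eq coeff_monom
  by (metis leD leI monom_eq_0_iff zero_neq_one)

lemma cst_in_deg_lt: "cst a \<in> deg_lt (Suc 0)"
  by (auto simp: deg_lt_def) (auto simp: cst_def coeff_pCons split: nat.splits)

lemma deg_lt_cmult: "u \<in> deg_lt m \<Longrightarrow> cst a * u \<in> deg_lt m"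
  by (auto simp: deg_lt_def) (auto simp: cst_def)

lemma deg_lt_sum: "(\<And>i. i \<in> I \<Longrightarrow> f i \<in> deg_lt m) \<Longrightarrow> sum f I \<in> deg_lt m"
  by (induction I rule: infinite_finite_induct) (auto intro: deg_lt_add)

lemma in_some_deg_lt: "\<exists>m. w \<in> deg_lt m"
proof -
  have "w \<in> deg_lt (Suc (degree (grad w)))" by (simp add: degree_grad)
  then show ?thesis by blast
qed

lemma coeff_scaled_monom: "coeff (coeff (cst a * (XX ^ i * YY ^ j)) k) l = (if i = k \<and> j = l then a else 0)"
proof -
  have "XX ^ i * YY ^ j = monom (monom 1 j) i"
  proof -
    have "XX ^ i = monom 1 i" by (simp add: XX_def monom_altdef)
    moreover have "YY ^ j = [:monom 1 j:]" unfolding YY_def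
      by (simp add: poly_const_pow monom_altdef)
    ultimately show ?thesis by (simp add: smult_monom)
  qed
  then show ?thesis by (simp add: cst_def smult_monom)
qed

lemma bipoly_expand:
  assumes "w \<in> deg_lt m"
  shows "w = (\<Sum>(i, j)\<in>{(i, j). i + j < m}. cst (coeff (coeff w i) j) * (XX ^ i * YY ^ j))"
proof -
  have fin: "finite {(i, j). i + j < m}"
    by (rule finite_subset[of _ "{..m} \<times> {..m}"]) auto
  show ?thesis
  proof (intro poly_eqI)
    fix k l
    have "coeff (coeff (\<Sum>(i, j)\<in>{(i, j). i + j < m}. cst (coeff (coeff w i) j) * (XX ^ i * YY ^ j)) k) l
      = (\<Sum>p\<in>{(i, j). i + j < m}. if p = (k, l) then coeff (coeff w k) l else 0)"
      unfolding coeff_sum by (intro sum.cong refl) (auto simp: coeff_scaled_monom split: if_splits)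
    also have "\<dots> = (if k + l < m then coeff (coeff w k) l else 0)"
      using fin by (simp add: sum.delta)
    also have "\<dots> = coeff (coeff w k) l"
      using assms by (auto simp: deg_lt_iff not_less)
    finally show "coeff (coeff w k) l = coeff (coeff (\<Sum>(i, j)\<in>{(i, j). i + j < m}. cst (coeff (coeff w i) j) * (XX ^ i * YY ^ j)) k) l" by simp
  qed
qed

lemma deg_lt_induct [consumes 1, case_names zero add scale monom]:
  assumes "w \<in> deg_lt m" "P 0" "\<And>u v. P u \<Longrightarrow> P v \<Longrightarrow> P (u + v)" "\<And>a u. P u \<Longrightarrow> P (cst a * u)"
    "\<And>i j. i + j < m \<Longrightarrow> P (XX ^ i * YY ^ j)"
  shows "P w"
proof -
  have "P (\<Sum>p\<in>I. cst (coeff (coeff w (fst p)) (snd p)) * (XX ^ fst p * YY ^ snd p))" if "I \<subseteq> {(i, j). i + j < m}" for I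
    using that by (induction I rule: infinite_finite_induct) (auto intro!: assms)
  from this[OF subset_refl] bipoly_expand[OF assms(1)] show ?thesis
    by (simp add: case_prod_unfold)
qed

definition shift :: "nat \<Rightarrow> nat \<Rightarrow> complex poly poly \<Rightarrow> complex poly poly" where
  "shift r s = ev (XX + of_nat r) (YY + of_nat s)"

section \<open>Two operators with coprime leading forms\<close>

lemma form_power:
  assumes "u \<in> deg_lt (Suc m)"
  shows "u ^ i \<in> deg_lt (Suc (m * i)) \<and> form (m * i) (u ^ i) = form m u ^ i"
proof (induction i)
  case 0
  show ?case using cst_in_deg_lt[of 1] by simp
next
  case (Suc i)
  then show ?case using deg_lt_mult[OF assms, of "u ^ i" "m * i"] form_mult[OF assms, of "u ^ i" "m * i"] by simp
qed

lemma form_prod: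
  assumes "finite I" "\<And>i. i \<in> I \<Longrightarrow> f i \<in> deg_lt (Suc (m i))"
  shows "prod f I \<in> deg_lt (Suc (sum m I)) \<and> form (sum m I) (prod f I) = (\<Prod>i\<in>I. form (m i) (f i))"
  using assms
proof (induction I rule: finite_induct)
  case empty
  show ?case using cst_in_deg_lt[of 1] by simp
next
  case (insert i I)
  then show ?case using deg_lt_mult[of "f i" "m i" "prod f I" "sum m I"] form_mult[of "f i" "m i" "prod f I" "sum m I"] by simp
qed

lemma of_nat_conv_cst: "of_nat r = cst (of_nat r)"
  by (simp add: cst_def of_nat_poly)

lemma linear_deg: "XX + cst c \<in> deg_lt 2" "form 1 (XX + cst c) = [:0, 1:]"
  "YY + cst c \<in> deg_lt 2" "form 1 (YY + cst c) = 1"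
proof -
  have "XX \<in> deg_lt 2" "YY \<in> deg_lt 2" "cst c \<in> deg_lt 2"
    using monom_in_deg_lt[of 1 0 2] monom_in_deg_lt[of 0 1 2] deg_lt_mono[OF cst_in_deg_lt[of c], of 2] by auto
  then show "XX + cst c \<in> deg_lt 2" "YY + cst c \<in> deg_lt 2" by (auto intro: deg_lt_add)
  show "form 1 (XX + cst c) = [:0, 1:]" "form 1 (YY + cst c) = 1"
    using grad_monom[of 1 0] grad_monom[of 0 1] form_cst[where k=1 and a=c] by (auto simp: monom_altdef)
qed

text \<open>On a monomial, (X + r)^i (Y + s)^j has the same leading form as X^i Y^j, so the
  difference loses a degree; linearity does the rest.\<close>

lemma shift_minus_self: "w \<in> deg_lt (Suc m) \<Longrightarrow> shift r s w - w \<in> deg_lt m"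
proof (induction w rule: deg_lt_induct)
  case (add u v)
  then show ?case using deg_lt_add[of "shift r s u - u" m "shift r s v - v"] by (simp add: shift_def algebra_simps)
next
  case (scale a u)
  then show ?case using deg_lt_cmult[of "shift r s u - u" m a] by (simp add: shift_def algebra_simps)
next
  case (monom i j)
  let ?u = "(XX + of_nat r) ^ i" let ?v = "(YY + of_nat s) ^ j"
  have u: "?u \<in> deg_lt (Suc i)" "form i ?u = [:0, 1:] ^ i"
    using form_power[of "XX + cst (of_nat r)" 1 i] linear_deg(1,2)[of "of_nat r"] by (simp_all add: of_nat_conv_cst numeral_2_eq_2)
  have v: "?v \<in> deg_lt (Suc j)" "form j ?v = 1"
    using form_power[of "YY + cst (of_nat s)" 1 j] linear_deg(3,4)[of "of_nat s"] by (simp_all add: of_nat_conv_cst numeral_2_eq_2)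
  have "shift r s (XX ^ i * YY ^ j) = ?u * ?v" by (simp add: shift_def)
  moreover have "?u * ?v \<in> deg_lt (Suc (i + j))" "form (i + j) (?u * ?v) = [:0, 1:] ^ i"
    using deg_lt_mult[OF u(1) v(1)] form_mult[OF u(1) v(1)] u v by auto
  moreover have "XX ^ i * YY ^ j \<in> deg_lt (Suc (i + j))" by (simp add: monom_in_deg_lt)
  moreover have "form (i + j) (XX ^ i * YY ^ j) = [:0, 1:] ^ i"
    unfolding grad_monom by simp (simp add: monom_altdef)
  ultimately have "shift r s (XX ^ i * YY ^ j) - XX ^ i * YY ^ j \<in> deg_lt (Suc (i + j))"
    "form (i + j) (shift r s (XX ^ i * YY ^ j) - XX ^ i * YY ^ j) = 0"
    by (simp_all only: deg_lt_diff grad_simps(3) coeff_diff diff_self)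
  then have "shift r s (XX ^ i * YY ^ j) - XX ^ i * YY ^ j \<in> deg_lt (i + j)"
    by (simp only: deg_lt_Suc_iff[of _ "i + j"])
  then show ?case by (rule deg_lt_mono) (use monom in simp)
qed (simp add: shift_def)

lemma shift_deg:
  assumes "w \<in> deg_lt (Suc m)"
  shows "shift r s w \<in> deg_lt (Suc m)" "form m (shift r s w) = form m w"
proof -
  have d: "shift r s w - w \<in> deg_lt m" by (rule shift_minus_self[OF assms])
  show "shift r s w \<in> deg_lt (Suc m)" using deg_lt_add[OF deg_lt_mono[OF d, of "Suc m"] assms] by simp
  show "form m (shift r s w) = form m w" using d by (auto simp: deg_lt_def)
qed

lemma shift_simps [simp]: "shift r s (u + v) = shift r s u + shift r s v" "shift r s (u * v) = shift r s u * shift r s v"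
  "shift r s (u - v) = shift r s u - shift r s v" "shift r s (cst a) = cst a" "shift r s 1 = 1"  "shift r s 0 = 0"
  "shift r s (u ^ n) = shift r s u ^ n" "shift r s XX = XX + of_nat r" "shift r s YY = YY + of_nat s"
  by (simp_all add: shift_def)

lemma shift_commute: "shift 1 0 (shift 0 1 w) = shift 0 1 (shift 1 0 w)"
  by (induction w rule: bipoly_induct) simp_all

text \<open>The homogeneous polynomial of degree k that dehomogenises to h: a section of
  \<open>form k\<close>.\<close>

definition lift_form :: "nat \<Rightarrow> complex poly \<Rightarrow> complex poly poly" where
  "lift_form k h = (\<Sum>i\<le>k. cst (coeff h i) * (XX ^ i * YY ^ (k - i)))"

lemma lift_form:
  assumes "degree h \<le> k"
  shows "lift_form k h \<in> deg_lt (Suc k)" "form k (lift_form k h) = h"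
proof -
  show "lift_form k h \<in> deg_lt (Suc k)"
    unfolding lift_form_def by (intro deg_lt_sum deg_lt_cmult) (simp add: monom_in_deg_lt)
  have "grad (lift_form k h) = (\<Sum>i\<le>k. monom (monom (coeff h i) i) k)"
    unfolding lift_form_def grad_def ev_sum unfolding grad_def[symmetric]
  proof (intro sum.cong refl)
    fix i assume "i \<in> {..k}"
    then show "grad (cst (coeff h i) * (XX ^ i * YY ^ (k - i))) = monom (monom (coeff h i) i) k"
      unfolding grad_simps(2)[of "cst _"] grad_monom grad_simps(7) by (simp add: cst_def smult_monom)
  qed
  then have "form k (lift_form k h) = (\<Sum>i\<le>k. monom (coeff h i) i)"
    by (simp add: coeff_sum)
  also have "\<dots> = h" using assms by (rule poly_as_sum_of_monoms')
  finally show "form k (lift_form k h) = h" .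
qed

text \<open>Plain linearity over the complex numbers; the prefix refers to the two variables X and
  Y, not to two arguments.\<close>

definition bilin :: "(complex poly poly \<Rightarrow> complex) \<Rightarrow> bool" where
  "bilin l \<longleftrightarrow> (\<forall>u v. l (u + v) = l u + l v) \<and> (\<forall>a u. l (cst a * u) = a * l u)"

lemma bilinD: "bilin l \<Longrightarrow> l (u + v) = l u + l v" "bilin l \<Longrightarrow> l (cst a * u) = a * l u"
  "bilin l \<Longrightarrow> l 0 = 0" "bilin l \<Longrightarrow> l (u - v) = l u - l v"
proof -
  assume l: "bilin l"
  show A: "l (u + v) = l u + l v" for u v using l by (simp add: bilin_def)
  show B: "l (cst a * u) = a * l u" for a u using l by (simp add: bilin_def)
  show "l 0 = 0" using A[of 0 0] by simp
  show "l (u - v) = l u - l v" using A[of "u - v" v] by simp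
qed

lemma bilin_sum: "bilin l \<Longrightarrow> l (sum f I) = (\<Sum>i\<in>I. l (f i))"
  by (induction I rule: infinite_finite_induct) (auto simp: bilinD)

text \<open>The operators T1, T2 below have orders d1 = e1 + 1, d2 = e2 + 1 and leading forms \<open>\<sigma>1\<close>, \<open>\<sigma>2\<close>
  (dehomogenised). They need not commute; the primed operators, with the same leading forms, are those
  that appear when one is moved past the other. Requiring \<open>\<sigma>1\<close> to have exact degree d1 excludes a
  common zero at infinity.\<close>
locale syzygy_pair =
  fixes P1 Q1 P2 Q2 P1' Q1' P2' Q2' :: "complex poly poly" and y1 y2 :: complex
    and e1 e2 :: nat and \<sigma>1 \<sigma>2 :: "complex poly"
  assumes deg: "P1 \<in> deg_lt (Suc (Suc e1))" "Q1 \<in> deg_lt (Suc (Suc e1))" "P1' \<in> deg_lt (Suc (Suc e1))" "Q1' \<in> deg_lt (Suc (Suc e1))"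
      "P2 \<in> deg_lt (Suc (Suc e2))" "Q2 \<in> deg_lt (Suc (Suc e2))" "P2' \<in> deg_lt (Suc (Suc e2))" "Q2' \<in> deg_lt (Suc (Suc e2))"
    and sym: "form (Suc e1) P1 - smult y1 (form (Suc e1) Q1) = \<sigma>1" "form (Suc e1) P1' - smult y1 (form (Suc e1) Q1') = \<sigma>1"
      "form (Suc e2) P2 - smult y2 (form (Suc e2) Q2) = \<sigma>2" "form (Suc e2) P2' - smult y2 (form (Suc e2) Q2') = \<sigma>2"
    and syz: "P1 * P2' = P2 * P1'" "P1 * Q2' = Q2 * shift 0 1 P1'" "Q1 * shift 1 0 P2' = P2 * Q1'"
      "Q1 * shift 1 0 Q2' = Q2 * shift 0 1 Q1'"
    and cop: "coprime \<sigma>1 \<sigma>2" and deg_\<sigma>1: "degree \<sigma>1 = Suc e1"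
begin

section \<open>The two shift operators and their syzygies\<close>

definition T1 where "T1 w = P1 * w - cst y1 * Q1 * shift 1 0 w"
definition T1' where "T1' w = P1' * w - cst y1 * Q1' * shift 1 0 w"
definition T2 where "T2 w = P2 * w - cst y2 * Q2 * shift 0 1 w"
definition T2' where "T2' w = P2' * w - cst y2 * Q2' * shift 0 1 w"

text \<open>The four identities \<open>syz\<close> match, in turn, the terms with no shift, with one
  of the two shifts, and with both; the shifts commute.\<close>

lemma T_syzygy: "T1 (T2' h) = T2 (T1' h)"
proof -
  have "T1 (T2' h) = (P1 * P2') * h - cst y2 * (P1 * Q2') * shift 0 1 h - cst y1 * (Q1 * shift 1 0 P2') * shift 1 0 h
     + cst y1 * cst y2 * (Q1 * shift 1 0 Q2') * shift 1 0 (shift 0 1 h)"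
    by (simp add: T1_def T2'_def algebra_simps)
  also have "\<dots> = T2 (T1' h)" unfolding syz shift_commute by (simp add: T2_def T1'_def algebra_simps)
  finally show ?thesis .
qed

lemma T_linear: "T1 (u + v) = T1 u + T1 v" "T1 (u - v) = T1 u - T1 v" "T1 (cst a * u) = cst a * T1 u" "T1 0 = 0"
  "T2 (u + v) = T2 u + T2 v" "T2 (u - v) = T2 u - T2 v" "T2 (cst a * u) = cst a * T2 u" "T2 0 = 0"
  by (simp_all add: T1_def T2_def algebra_simps)

text \<open>The shift does not change the top form of w, so P and Q act on it together as the single
  multiplier \<sigma>.\<close>

lemma operator_deg:
  assumes "P \<in> deg_lt (Suc d)" "Q \<in> deg_lt (Suc d)" "form d P - smult y (form d Q) = \<sigma>" "w \<in> deg_lt (Suc m)"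
  shows "P * w - cst y * Q * shift r s w \<in> deg_lt (Suc (d + m))"
    "form (d + m) (P * w - cst y * Q * shift r s w) = \<sigma> * form m w"
proof -
  note sh = shift_deg[OF assms(4), of r s]
  have *: "cst y * Q * shift r s w = cst y * (Q * shift r s w)" by (simp add: mult.assoc)
  show "P * w - cst y * Q * shift r s w \<in> deg_lt (Suc (d + m))"
    unfolding * by (intro deg_lt_diff deg_lt_cmult deg_lt_mult assms sh)
  have "form (d + m) (cst y * (Q * shift r s w)) = smult y (form (d + m) (Q * shift r s w))"
    by (rule form_cmult)
  then show "form (d + m) (P * w - cst y * Q * shift r s w) = \<sigma> * form m w"
    unfolding * grad_simps coeff_diff using form_mult[OF assms(2) sh(1)] form_mult[OF assms(1,4)] sh(2)
    by (simp add: assms(3)[symmetric] algebra_simps)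
qed

lemmas T1_deg = operator_deg[OF deg(1,2) sym(1), of _ _ 1 0, folded T1_def]
  and T1'_deg = operator_deg[OF deg(3,4) sym(2), of _ _ 1 0, folded T1'_def]
  and T2_deg = operator_deg[OF deg(5,6) sym(3), of _ _ 0 1, folded T2_def]
  and T2'_deg = operator_deg[OF deg(7,8) sym(4), of _ _ 0 1, folded T2'_def]

lemma \<sigma>1_nz: "\<sigma>1 \<noteq> 0" using deg_\<sigma>1 by auto
lemma \<sigma>2_nz: "\<sigma>2 \<noteq> 0"
proof
  assume "\<sigma>2 = 0"
  then have "is_unit \<sigma>1" using cop by simp
  then show False using deg_\<sigma>1 by (auto simp: is_unit_iff_degree[OF \<sigma>1_nz])
qed

text \<open>Coprimality leaves only multiples of the Koszul syzygy.\<close>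

lemma \<sigma>_relation:
  assumes "\<sigma>1 * a + \<sigma>2 * b = 0"
  obtains h where "b = \<sigma>1 * h" "a = - (\<sigma>2 * h)"
proof -
  have "\<sigma>2 * b = \<sigma>1 * (- a)" using assms by (simp add: eq_neg_iff_add_eq_0 add.commute)
  then have "\<sigma>1 dvd \<sigma>2 * b" by (metis dvd_triv_left)
  then have "\<sigma>1 dvd b" using cop by (simp add: coprime_dvd_mult_right_iff)
  then obtain h where h: "b = \<sigma>1 * h" by (auto elim: dvdE)
  with assms have "\<sigma>1 * (a + \<sigma>2 * h) = 0" by (simp add: algebra_simps)
  then have "a = - (\<sigma>2 * h)" using \<sigma>1_nz by (simp add: eq_neg_iff_add_eq_0)
  with h show ?thesis using that by blast
qed

text \<open>A cancellation of leading forms is a multiple of the Koszul syzygy of \<open>\<sigma>1\<close>, \<open>\<sigma>2\<close>, which lifts to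
  the operators; subtracting it lowers the degrees of u and v.\<close>
lemma reduce_relation:
  assumes "u \<in> deg_lt (e2 + n)" "v \<in> deg_lt (e1 + n)" "T1 u + T2 v \<in> deg_lt (Suc (e1 + e2))"
  shows "\<exists>u'\<in>deg_lt e2. \<exists>v'\<in>deg_lt e1. T1 u + T2 v = T1 u' + T2 v'"
  using assms
proof (induction n arbitrary: u v)
  case 0
  then show ?case by auto
next
  case (Suc n)
  define a b where "a = form (e2 + n) u" and "b = form (e1 + n) v"
  have u: "u \<in> deg_lt (Suc (e2 + n))" and v: "v \<in> deg_lt (Suc (e1 + n))" using Suc.prems by auto
  have "form (Suc (e1 + e2 + n)) (T1 u + T2 v) = 0" using Suc.prems(3) by (auto simp: deg_lt_def)
  then have "\<sigma>1 * a + \<sigma>2 * b = 0"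
    using T1_deg(2)[OF u] T2_deg(2)[OF v] by (simp add: a_def b_def add_ac)
  then obtain h where h: "b = \<sigma>1 * h" "a = - (\<sigma>2 * h)" by (rule \<sigma>_relation)
  have "\<exists>u1\<in>deg_lt (e2 + n). \<exists>v1\<in>deg_lt (e1 + n). T1 u + T2 v = T1 u1 + T2 v1"
  proof (cases "h = 0")
    case True
    then have "u \<in> deg_lt (e2 + n)" "v \<in> deg_lt (e1 + n)"
      using u v h by (auto simp: a_def b_def deg_lt_Suc_iff[of _ "e2 + n"] deg_lt_Suc_iff[of _ "e1 + n"])
    then show ?thesis by blast
  next
    case False
    have "degree b \<le> e1 + n" using degree_form by (simp add: b_def)
    \<comment> \<open>The exact degree of \<sigma>1 bounds the degree of h by n - 1, the degree in
      which it has to be lifted; for n = 0 a nonzero h is impossible.\<close>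
    then have "Suc e1 + degree h \<le> e1 + n" using False \<sigma>1_nz deg_\<sigma>1 h by (simp add: degree_mult_eq)
    then obtain m where m: "n = Suc m" "degree h \<le> m" by (cases n) auto
    note H = lift_form[OF m(2)]
    let ?H = "lift_form m h"
    have "form (e2 + n) (u + T2' ?H) = 0" "u + T2' ?H \<in> deg_lt (Suc (e2 + n))"
      using T2'_deg[OF H(1)] H(2) h u by (auto simp: m a_def intro!: deg_lt_add)
    then have 1: "u + T2' ?H \<in> deg_lt (e2 + n)" by (subst deg_lt_Suc_iff) auto
    have "form (e1 + n) (v - T1' ?H) = 0" "v - T1' ?H \<in> deg_lt (Suc (e1 + n))"
      using T1'_deg[OF H(1)] H(2) h v by (auto simp: m b_def intro!: deg_lt_diff)
    then have 2: "v - T1' ?H \<in> deg_lt (e1 + n)" by (subst deg_lt_Suc_iff) auto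
    have "T1 u + T2 v = T1 (u + T2' ?H) + T2 (v - T1' ?H)" by (simp add: T_linear T_syzygy)
    with 1 2 show ?thesis by blast
  qed
  then obtain u1 v1 where uv: "u1 \<in> deg_lt (e2 + n)" "v1 \<in> deg_lt (e1 + n)" "T1 u + T2 v = T1 u1 + T2 v1" by blast
  from Suc.IH[OF uv(1,2)] uv(3) Suc.prems(3) show ?case by simp
qed

text \<open>A relation between the top forms is a multiple of the Koszul syzygy, so the top form of
  v is divisible by \<sigma>1; its degree is below e1, so it is zero, and with it that of u. Hence
  both degree bounds drop together. Once one bound has reached zero only one operator is left, and
  its nonzero multiplier cancels.\<close>

lemma no_small_relation:
  assumes "u \<in> deg_lt e2" "v \<in> deg_lt e1" "T1 u + T2 v = 0"
  shows "u = 0" "v = 0"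
proof -
  have "u \<in> deg_lt (e2 - k) \<and> v \<in> deg_lt (e1 - k)" for k
  proof (induction k)
    case (Suc k)
    have step: "u \<in> deg_lt (e - Suc k)"
      if u: "u \<in> deg_lt (e - k)" and "\<sigma> \<noteq> 0" and top: "\<And>m. u \<in> deg_lt (Suc m) \<Longrightarrow> \<sigma> * form m u = 0" for u e and \<sigma> :: "complex poly"
    proof (cases "e - k")
      case 0
      then show ?thesis using u by (auto simp: diff_Suc)
    next
      case (Suc p)
      then have u: "u \<in> deg_lt (Suc p)" using u by simp
      then have "u \<in> deg_lt p" using top[OF u] \<open>\<sigma> \<noteq> 0\<close> by (subst deg_lt_Suc_iff) auto
      then show ?thesis using Suc by (simp add: diff_Suc)
    qed
    have 1: "u \<in> deg_lt (e2 - Suc k)" if "v = 0"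
      using Suc.IH \<sigma>1_nz T1_deg(2)[of u] assms(3) that by (intro step) (auto simp: T_linear)
    have 2: "v \<in> deg_lt (e1 - Suc k)" if "u = 0"
      using Suc.IH \<sigma>2_nz T2_deg(2)[of v] assms(3) that by (intro step) (auto simp: T_linear)
    show ?case
    proof (cases "e2 - k = 0 \<or> e1 - k = 0")
      case True
      then have "u = 0 \<or> v = 0" using Suc.IH by auto
      then show ?thesis using 1 2 by auto
    next
      case False
      then obtain p q where pq: "e2 - k = Suc p" "e1 - k = Suc q" by (metis not0_implies_Suc)
      then have uv: "u \<in> deg_lt (Suc p)" "v \<in> deg_lt (Suc q)" using Suc.IH by auto
      \<comment> \<open>The bounds e2 and e1 are lowered by the same k, so both images have their
        top form in the same degree.\<close>
      have e: "Suc e1 + p = Suc e2 + q" using pq by linarith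
      have "form (Suc e1 + p) (T1 u + T2 v) = 0" using assms(3) by simp
      then have r: "\<sigma>1 * form p u + \<sigma>2 * form q v = 0"
        using T1_deg(2)[OF uv(1)] T2_deg(2)[OF uv(2)] e by simp
      then obtain h where h: "form q v = \<sigma>1 * h" "form p u = - (\<sigma>2 * h)" by (rule \<sigma>_relation)
      have "h = 0"
      proof (rule ccontr)
        assume "h \<noteq> 0"
        then have "Suc e1 \<le> degree (form q v)" unfolding h using \<sigma>1_nz deg_\<sigma>1 by (simp add: degree_mult_eq)
        then show False using degree_form[of v q] pq by linarith
      qed
      then have "form p u = 0" "form q v = 0" using h by auto
      then have "u \<in> deg_lt p" "v \<in> deg_lt q" using uv by (auto simp: deg_lt_Suc_iff[of _ p] deg_lt_Suc_iff[of _ q])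
      then show ?thesis using pq by (simp add: diff_Suc)
    qed
  qed (use assms in auto)
  from this[of "e1 + e2"] show "u = 0" "v = 0" by auto
qed

text \<open>From degree d1 + d2 - 1 on, every binary form lies in the ideal of the two leading
  forms. Bezout in one variable gives some pair of cofactors; reducing b modulo \<sigma>1 bounds its
  degree, and the exact degree of \<sigma>1 then bounds that of a.\<close>

lemma bezout_forms:
  assumes "degree g \<le> Suc (e1 + e2) + n"
  obtains a b where "g = \<sigma>1 * a + \<sigma>2 * b" "degree a \<le> e2 + n" "degree b \<le> e1 + n"
proof -
  obtain u v where uv: "u * \<sigma>1 + v * \<sigma>2 = 1"
    using bezout_coefficients_fst_snd[of \<sigma>1 \<sigma>2] cop by (metis coprime_imp_gcd_eq_1)
  define b where "b = (v * g) mod \<sigma>1"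
  define a where "a = u * g + \<sigma>2 * ((v * g) div \<sigma>1)"
  have "g = (u * \<sigma>1 + v * \<sigma>2) * g" using uv by simp
  also have "\<dots> = \<sigma>1 * (u * g) + \<sigma>2 * (v * g div \<sigma>1 * \<sigma>1 + v * g mod \<sigma>1)" by (simp add: algebra_simps)
  also have "\<dots> = \<sigma>1 * a + \<sigma>2 * b" unfolding a_def b_def by (simp only: distrib_left mult_ac add_ac)
  finally have g: "g = \<sigma>1 * a + \<sigma>2 * b" .
  have b: "degree b \<le> e1" using degree_mod_less'[of \<sigma>1 "v * g"] \<sigma>1_nz deg_\<sigma>1
    by (cases "b = 0") (auto simp: b_def)
  have d2: "degree \<sigma>2 \<le> Suc e2" unfolding sym(3)[symmetric]
    by (intro degree_diff_le degree_form order.trans[OF degree_smult_le])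
  have "degree (\<sigma>1 * a) \<le> Suc (e1 + e2) + n"
  proof -
    have "\<sigma>1 * a = g - \<sigma>2 * b" using g by simp
    moreover have "degree (\<sigma>2 * b) \<le> Suc (e1 + e2) + n" using degree_mult_le[of \<sigma>2 b] b d2 by linarith
    ultimately show ?thesis using assms by (simp add: degree_diff_le)
  qed
  then have "degree a \<le> e2 + n" by (cases "a = 0") (use \<sigma>1_nz deg_\<sigma>1 in \<open>auto simp: degree_mult_eq\<close>)
  with g b show ?thesis using that[of a b] by linarith
qed

lemma reduce_step:
  assumes "w \<in> deg_lt (Suc (Suc (e1 + e2) + n))"
  obtains u v where "u \<in> deg_lt (Suc (e2 + n))" "v \<in> deg_lt (Suc (e1 + n))" "w - T1 u - T2 v \<in> deg_lt (Suc (e1 + e2) + n)"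
proof -
  let ?k = "Suc (e1 + e2) + n"
  obtain a b where ab: "form ?k w = \<sigma>1 * a + \<sigma>2 * b" "degree a \<le> e2 + n" "degree b \<le> e1 + n"
    using bezout_forms[OF degree_form] by blast
  note A = lift_form[OF ab(2)] and B = lift_form[OF ab(3)]
  let ?a = "lift_form (e2 + n) a" and ?b = "lift_form (e1 + n) b"
  have e: "Suc e1 + (e2 + n) = ?k" "Suc e2 + (e1 + n) = ?k" by auto
  have t1: "T1 ?a \<in> deg_lt (Suc ?k)" "form ?k (T1 ?a) = \<sigma>1 * a"
    using T1_deg[OF A(1)] A(2) unfolding e by auto
  have t2: "T2 ?b \<in> deg_lt (Suc ?k)" "form ?k (T2 ?b) = \<sigma>2 * b"
    using T2_deg[OF B(1)] B(2) unfolding e by auto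
  have "form ?k (w - T1 ?a - T2 ?b) = 0" unfolding grad_simps coeff_diff t1 t2 ab by simp
  then have "w - T1 ?a - T2 ?b \<in> deg_lt ?k"
    unfolding deg_lt_Suc_iff[of _ ?k] by (intro conjI deg_lt_diff assms t1 t2)
  with A(1) B(1) show ?thesis using that by blast
qed

lemma reduce_to_low_degree: "\<exists>u v. w - T1 u - T2 v \<in> deg_lt (Suc (e1 + e2))"
proof -
  have "\<exists>u v. w - T1 u - T2 v \<in> deg_lt (Suc (e1 + e2))" if "w \<in> deg_lt (Suc (e1 + e2) + n)" for n w
    using that
  proof (induction n arbitrary: w)
    case 0
    then show ?case by (intro exI[of _ 0]) (simp add: T_linear)
  next
    case (Suc n)
    then have "w \<in> deg_lt (Suc (Suc (e1 + e2) + n))" by simp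
    then obtain a b where "w - T1 a - T2 b \<in> deg_lt (Suc (e1 + e2) + n)"
      by (rule reduce_step)
    from Suc.IH[OF this] obtain u v where "w - T1 a - T2 b - T1 u - T2 v \<in> deg_lt (Suc (e1 + e2))" by blast
    then show ?case by (intro exI[of _ "a + u"] exI[of _ "b + v"]) (simp add: T_linear algebra_simps)
  qed
  moreover obtain m where "w \<in> deg_lt m" using in_some_deg_lt by blast
  then have "w \<in> deg_lt (Suc (e1 + e2) + m)" by (rule deg_lt_mono) simp
  ultimately show ?thesis by blast
qed

end

section \<open>Growth of the annihilating functionals\<close>

text \<open>The constant is the sum of the absolute values of the coefficients of q. It is chosen
  before l, a, b and B, so that one constant serves all functionals and all exponents.\<close>

lemma bilin_monomial_multiple_bound:
  assumes "q \<in> deg_lt m"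
  shows "\<exists>C\<ge>0. \<forall>l a b B. bilin l \<longrightarrow> (\<forall>i j. i + j < m \<longrightarrow> norm (l (XX ^ (a + i) * YY ^ (b + j))) \<le> B)
    \<longrightarrow> norm (l (XX ^ a * YY ^ b * q)) \<le> C * B"
proof -
  let ?I = "{(i, j). i + j < m}"
  define C where "C = (\<Sum>p\<in>?I. norm (coeff (coeff q (fst p)) (snd p)))"
  have "norm (l (XX ^ a * YY ^ b * q)) \<le> C * B"
    if l: "bilin l" and B: "\<And>i j. i + j < m \<Longrightarrow> norm (l (XX ^ (a + i) * YY ^ (b + j))) \<le> B" for l a b B
  proof -
    have "XX ^ a * YY ^ b * q = (\<Sum>p\<in>?I. cst (coeff (coeff q (fst p)) (snd p)) * (XX ^ (a + fst p) * YY ^ (b + snd p)))"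
      by (subst bipoly_expand[OF assms]) (auto simp: sum_distrib_left power_add mult_ac case_prod_unfold)
    then have "l (XX ^ a * YY ^ b * q) = (\<Sum>p\<in>?I. coeff (coeff q (fst p)) (snd p) * l (XX ^ (a + fst p) * YY ^ (b + snd p)))"
      by (simp add: bilin_sum[OF l] bilinD[OF l])
    also have "norm \<dots> \<le> (\<Sum>p\<in>?I. norm (coeff (coeff q (fst p)) (snd p)) * B)"
      by (intro sum_norm_le) (auto simp: norm_mult intro!: mult_left_mono B)
    also have "\<dots> = C * B" by (simp add: C_def sum_distrib_right)
    finally show ?thesis .
  qed
  moreover have "C \<ge> 0" unfolding C_def by (intro sum_nonneg) auto
  ultimately show ?thesis by blast
qed

text \<open>A binomial coefficient that comes with a drop of s in degree is absorbed by the
  factorial.\<close>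

lemma choose_fact_le: "s \<le> a \<Longrightarrow> a \<le> k \<Longrightarrow> real (a choose s) * fact (k - s) \<le> fact k"
proof -
  assume s: "s \<le> a" "a \<le> k"
  have "(a choose s) * fact (k - s) \<le> (k choose s) * fact (k - s)"
    using s by (intro mult_right_mono binomial_right_mono) auto
  also have "\<dots> \<le> fact s * fact (k - s) * (k choose s)"
    using fact_ge_1[of s, where 'a = nat] by simp
  also have "\<dots> = fact k" using s by (intro binomial_fact_lemma) auto
  finally have "real ((a choose s) * fact (k - s)) \<le> real (fact k)" by (rule of_nat_mono)
  then show ?thesis by simp
qed

lemma power_Suc_minus_power:
  fixes x :: "'a::comm_ring_1"
  shows "(x + 1) ^ n - x ^ n = (\<Sum>i<n. of_nat (n choose i) * x ^ i)"
proof -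
  have "(x + 1) ^ n = (\<Sum>i\<le>n. of_nat (n choose i) * x ^ i)" by (simp add: binomial_ring)
  also have "\<dots> = (\<Sum>i<n. of_nat (n choose i) * x ^ i) + x ^ n"
    by (simp flip: lessThan_Suc_atMost)
  finally show ?thesis by simp
qed

text \<open>By \<open>choose_fact_le\<close> the sum is dominated by a geometric one in R, and R - 1
  is at least R / 2. The gain 2 / R can be made as small as desired.\<close>

lemma binomial_tail_bound:
  fixes R K :: real
  assumes "R \<ge> 2" "K \<ge> 0" "a \<le> k"
  shows "(\<Sum>i<a. real (a choose i) * (K * fact (k - (a - i)) * R ^ (k - (a - i)))) \<le> 2 / R * (K * fact k * R ^ k)"
proof -
  have "(\<Sum>i<a. real (a choose i) * (K * fact (k - (a - i)) * R ^ (k - (a - i)))) \<le> (\<Sum>i<a. K * fact k * (R ^ (k - a) * R ^ i))"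
  proof (intro sum_mono)
    fix i assume i: "i \<in> {..<a}"
    have e: "k - (a - i) = (k - a) + i" using i assms(3) by auto
    have "real (a choose i) * fact (k - (a - i)) \<le> fact k"
      using choose_fact_le[of "a - i" a k] i assms(3) by (simp add: binomial_symmetric[of i a])
    then have "K * R ^ (k - (a - i)) * (real (a choose i) * fact (k - (a - i))) \<le> K * R ^ (k - (a - i)) * fact k"
      using assms by (intro mult_left_mono) auto
    then show "real (a choose i) * (K * fact (k - (a - i)) * R ^ (k - (a - i))) \<le> K * fact k * (R ^ (k - a) * R ^ i)"
      unfolding power_add[symmetric] e[symmetric] by (simp add: mult_ac)
  qed
  also have "\<dots> = K * fact k * R ^ (k - a) * (\<Sum>i<a. R ^ i)"
    by (simp add: sum_distrib_left mult.assoc)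
  also have "\<dots> = K * fact k * R ^ (k - a) * ((R ^ a - 1) / (R - 1))"
    using geometric_sum[of R a] assms by simp
  also have "\<dots> \<le> K * fact k * R ^ (k - a) * (R ^ a * (2 / R))"
  proof (intro mult_left_mono)
    have "(R ^ a - 1) / (R - 1) \<le> R ^ a / (R - 1)" using assms by (intro divide_right_mono) auto
    also have "\<dots> \<le> R ^ a / (R / 2)" using assms by (intro divide_left_mono) auto
    finally show "(R ^ a - 1) / (R - 1) \<le> R ^ a * (2 / R)" by simp
  qed (use assms in auto)
  also have "\<dots> = 2 / R * (K * fact k * (R ^ (k - a) * R ^ a))" by simp
  also have "R ^ (k - a) * R ^ a = R ^ k" using assms(3) by (simp flip: power_add)
  finally show ?thesis .
qed

context syzygy_pair begin

definition annihilator :: "(complex poly poly \<Rightarrow> complex) set" where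
  "annihilator = {l. bilin l \<and> (\<forall>w. l (T1 w) = 0) \<and> (\<forall>w. l (T2 w) = 0)}"

text \<open>R depends on the operators alone, because a whole basis of solutions must converge on
  one ball; K may depend on l. The monomials of degree D = d1 + d2 - 1 reduce to lower degree modulo
  the images. Multiplying such a reduction by X^a' Y^b' fails to commute with the operators only
  through (X + 1)^a' - X^a' and (Y + 1)^b' - Y^b', which have lower degree, so induction on a + b
  closes.\<close>

lemma annihilator_growth:
  obtains R where "R \<ge> (1::real)"
    "\<And>l. l \<in> annihilator \<Longrightarrow> \<exists>K. \<forall>a b. norm (l (XX ^ a * YY ^ b)) \<le> K * fact (a + b) * R ^ (a + b)"
proof -
  let ?D = "Suc (e1 + e2)"
  have "\<exists>u v. u \<in> deg_lt (Suc e2) \<and> v \<in> deg_lt (Suc e1) \<and> XX ^ i * YY ^ (?D - i) - T1 u - T2 v \<in> deg_lt ?D" if "i \<le> ?D" for i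
  proof -
    have "XX ^ i * YY ^ (?D - i) \<in> deg_lt (Suc (?D + 0))" using that by (simp add: monom_in_deg_lt)
    then obtain u v where "u \<in> deg_lt (Suc (e2 + 0))" "v \<in> deg_lt (Suc (e1 + 0))"
      "XX ^ i * YY ^ (?D - i) - T1 u - T2 v \<in> deg_lt (?D + 0)" by (rule reduce_step)
    then show ?thesis by (intro exI[of _ u] exI[of _ v]) simp
  qed
  then obtain u v where uv: "\<And>i. i \<le> ?D \<Longrightarrow> u i \<in> deg_lt (Suc e2)" "\<And>i. i \<le> ?D \<Longrightarrow> v i \<in> deg_lt (Suc e1)"
    "\<And>i. i \<le> ?D \<Longrightarrow> XX ^ i * YY ^ (?D - i) - T1 (u i) - T2 (v i) \<in> deg_lt ?D" by metis
  define r where "r i = XX ^ i * YY ^ (?D - i) - T1 (u i) - T2 (v i)" for i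
  define q1 where "q1 i = cst y1 * (Q1 * shift 1 0 (u i))" for i
  define q2 where "q2 i = cst y2 * (Q2 * shift 0 1 (v i))" for i
  have q1: "q1 i \<in> deg_lt (Suc ?D)" if "i \<le> ?D" for i
    using deg_lt_mult[OF deg(2) shift_deg(1)[OF uv(1)[OF that]], of 1 0] unfolding q1_def by (auto intro: deg_lt_cmult)
  have q2: "q2 i \<in> deg_lt (Suc ?D)" if "i \<le> ?D" for i
    using deg_lt_mult[OF deg(6) shift_deg(1)[OF uv(2)[OF that]], of 0 1] unfolding q2_def by (auto intro: deg_lt_cmult simp: add_ac)
  have r: "r i \<in> deg_lt ?D" if "i \<le> ?D" for i using uv(3)[OF that] by (simp add: r_def)
  define bd where "bd C m q \<longleftrightarrow> (\<forall>l a b B. bilin l \<longrightarrow> (\<forall>i j. i + j < m \<longrightarrow> norm (l (XX ^ (a + i) * YY ^ (b + j))) \<le> B)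
    \<longrightarrow> norm (l (XX ^ a * YY ^ b * q)) \<le> C * B)" for C :: real and m q
  have bdD: "norm (l (XX ^ a * YY ^ b * q)) \<le> C * B"
    if "0 \<le> C \<and> bd C m q" "bilin l" "\<And>i j. i + j < m \<Longrightarrow> norm (l (XX ^ (a + i) * YY ^ (b + j))) \<le> B" for C m q l a b B
    using that unfolding bd_def by blast
  have "\<exists>C\<ge>0. bd C ?D (r i)" "\<exists>C\<ge>0. bd C (Suc ?D) (q1 i)" "\<exists>C\<ge>0. bd C (Suc ?D) (q2 i)" if "i \<le> ?D" for i
    unfolding bd_def by (rule bilin_monomial_multiple_bound, rule r q1 q2, rule that)+
  then obtain c0 c1 c2 where c: "\<And>i. i \<le> ?D \<Longrightarrow> c0 i \<ge> 0 \<and> bd (c0 i) ?D (r i)" "\<And>i. i \<le> ?D \<Longrightarrow> c1 i \<ge> 0 \<and> bd (c1 i) (Suc ?D) (q1 i)"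
    "\<And>i. i \<le> ?D \<Longrightarrow> c2 i \<ge> 0 \<and> bd (c2 i) (Suc ?D) (q2 i)" by metis
  define C where "C = (\<Sum>i\<le>?D. c0 i + c1 i + c2 i)"
  have C0: "C \<ge> 0" unfolding C_def using c by (intro sum_nonneg) (auto intro!: add_nonneg_nonneg)
  have Ci: "c0 i \<le> C" "c1 i \<le> C" "c2 i \<le> C" if "i \<le> ?D" for i
  proof -
    have "c0 i + c1 i + c2 i \<le> C" unfolding C_def
      using c that by (intro member_le_sum[of i "{..?D}" "\<lambda>i. c0 i + c1 i + c2 i"]) (auto intro!: add_nonneg_nonneg)
    then show "c0 i \<le> C" "c1 i \<le> C" "c2 i \<le> C" using c[OF that] by linarith+
  qed
  \<comment> \<open>The three error terms below contribute C / R, 2 C / R and 2 C / R times the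
    desired bound; the factor 5 makes their sum at most 1, and the summand 2 serves the geometric
    sum.\<close>
  define R where "R = 5 * C + 2"
  have R: "R \<ge> 2" "5 * C / R \<le> 1" using C0 by (auto simp: R_def divide_le_eq)
  have "\<exists>K. \<forall>a b. norm (l (XX ^ a * YY ^ b)) \<le> K * fact (a + b) * R ^ (a + b)" if l: "l \<in> annihilator" for l
  proof -
    have bl: "bilin l" and T: "l (T1 w) = 0" "l (T2 w) = 0" for w using l by (auto simp: annihilator_def)
    \<comment> \<open>Dominates all monomials of degree below D, where the induction starts.\<close>
    define K where "K = (\<Sum>p\<in>{..?D} \<times> {..?D}. norm (l (XX ^ fst p * YY ^ snd p)))"
    have K0: "K \<ge> 0" unfolding K_def by (intro sum_nonneg) auto
    define B where "B k = K * fact k * R ^ k" for k :: nat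
    have B0: "B k \<ge> 0" for k using K0 R by (simp add: B_def)
    have Bmono: "B k \<le> B k'" if "k \<le> k'" for k k'
      unfolding B_def using that K0 R by (intro mult_mono fact_mono power_increasing) auto
    have "norm (l (XX ^ a * YY ^ b)) \<le> B (a + b)" for a b
    proof (induction "a + b" arbitrary: a b rule: less_induct)
      case less
      show ?case
      proof (cases "a + b < ?D")
        case True
        then have "norm (l (XX ^ a * YY ^ b)) \<le> K" unfolding K_def
          using member_le_sum[of "(a, b)" "{..?D} \<times> {..?D}" "\<lambda>p. norm (l (XX ^ fst p * YY ^ snd p))"] by auto
        also have "K \<le> B (a + b)"
          using Bmono[of 0 "a + b"] by (simp add: B_def)
        finally show ?thesis .
      next
        case False
        \<comment> \<open>Splits off a divisor X^i Y^(D - i) of X^a Y^b of degree exactly D, with as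
          many factors X as possible.\<close>
        define i where "i = min a ?D"
        define a' where "a' = a - i"
        define b' where "b' = b - (?D - i)"
        define k where "k = a + b"
        have i: "i \<le> ?D" "a = a' + i" "b = b' + (?D - i)" using False by (auto simp: i_def a'_def b'_def)
        have k: "k = a' + b' + ?D" using i by (simp add: k_def)
        let ?m = "XX ^ a' * YY ^ b'"
        have IH: "norm (l (XX ^ s * YY ^ t)) \<le> B n" if "s + t \<le> n" "n < k" for s t n
          using less[of s t] Bmono[OF that(1)] that by (force simp: k_def)
        \<comment> \<open>Since \<open>q1 i\<close> and \<open>q2 i\<close> have degree at most D,
          lowering one exponent from n to s leaves only monomials of degree at most k - (n - s),
          which the induction hypothesis covers.\<close>
        have tail: "norm (\<Sum>s<n. of_nat (n choose s) * g s) \<le> C * (2 / R * B k)"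
          if n: "n \<le> k" and g: "\<And>s. s < n \<Longrightarrow> norm (g s) \<le> C' * B (k - (n - s))" and C': "C' \<le> C" for n C' and g :: "nat \<Rightarrow> complex"
        proof -
          have "norm (\<Sum>s<n. of_nat (n choose s) * g s) \<le> (\<Sum>s<n. real (n choose s) * (C * B (k - (n - s))))"
          proof (intro sum_norm_le)
            fix s assume s: "s \<in> {..<n}"
            have "norm (g s) \<le> C' * B (k - (n - s))" using g s by simp
            also have "\<dots> \<le> C * B (k - (n - s))" using C' B0 by (intro mult_right_mono) auto
            finally show "norm (of_nat (n choose s) * g s) \<le> real (n choose s) * (C * B (k - (n - s)))"
              by (simp add: norm_mult mult_left_mono)
          qed
          also have "\<dots> = C * (\<Sum>s<n. real (n choose s) * B (k - (n - s)))" by (simp add: sum_distrib_left mult_ac)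
          also have "\<dots> \<le> C * (2 / R * B k)"
            unfolding B_def using R K0 C0 n by (intro mult_left_mono binomial_tail_bound) auto
          finally show ?thesis .
        qed
        have m: "XX ^ a * YY ^ b = ?m * (XX ^ i * YY ^ (?D - i))" unfolding i by (simp add: power_add mult_ac)
        have "?m * (XX ^ i * YY ^ (?D - i)) - T1 (?m * u i) - T2 (?m * v i)
          = ?m * r i + cst y1 * Q1 * (shift 1 0 (?m * u i) - ?m * shift 1 0 (u i)) + cst y2 * Q2 * (shift 0 1 (?m * v i) - ?m * shift 0 1 (v i))"
          unfolding r_def T1_def T2_def by (simp add: algebra_simps)
        also have "\<dots> = ?m * r i + ((XX + 1) ^ a' - XX ^ a') * YY ^ b' * q1 i + XX ^ a' * ((YY + 1) ^ b' - YY ^ b') * q2 i"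
          unfolding q1_def q2_def by (simp add: algebra_simps)
        also have "\<dots> = ?m * r i + (\<Sum>s<a'. cst (of_nat (a' choose s)) * (XX ^ s * YY ^ b' * q1 i)) + (\<Sum>s<b'. cst (of_nat (b' choose s)) * (XX ^ a' * YY ^ s * q2 i))"
          unfolding power_Suc_minus_power of_nat_conv_cst by (simp add: sum_distrib_left sum_distrib_right mult_ac)
        finally have "XX ^ a * YY ^ b = T1 (?m * u i) + T2 (?m * v i) + (?m * r i + (\<Sum>s<a'. cst (of_nat (a' choose s)) * (XX ^ s * YY ^ b' * q1 i)) + (\<Sum>s<b'. cst (of_nat (b' choose s)) * (XX ^ a' * YY ^ s * q2 i)))"
          unfolding m by (simp add: algebra_simps)
        then have "l (XX ^ a * YY ^ b) = l (?m * r i) + (\<Sum>s<a'. of_nat (a' choose s) * l (XX ^ s * YY ^ b' * q1 i)) + (\<Sum>s<b'. of_nat (b' choose s) * l (XX ^ a' * YY ^ s * q2 i))"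
          by (simp add: bilinD[OF bl] bilin_sum[OF bl] T)
        moreover have "norm (l (?m * r i)) \<le> C * B (k - 1)"
        proof -
          have "norm (l (?m * r i)) \<le> c0 i * B (k - 1)"
            by (rule bdD[OF c(1)[OF i(1)] bl]) (auto simp: k intro!: IH)
          also have "\<dots> \<le> C * B (k - 1)" using Ci(1)[OF i(1)] B0 by (intro mult_right_mono) auto
          finally show ?thesis .
        qed
        moreover have "norm (\<Sum>s<a'. of_nat (a' choose s) * l (XX ^ s * YY ^ b' * q1 i)) \<le> C * (2 / R * B k)"
          by (rule tail[OF _ bdD[OF c(2)[OF i(1)] bl] Ci(2)[OF i(1)]]) (auto simp: k intro!: IH)
        moreover have "norm (\<Sum>s<b'. of_nat (b' choose s) * l (XX ^ a' * YY ^ s * q2 i)) \<le> C * (2 / R * B k)"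
          by (rule tail[OF _ bdD[OF c(3)[OF i(1)] bl] Ci(3)[OF i(1)]]) (auto simp: k intro!: IH)
        moreover have "C * B (k - 1) \<le> C * (1 / R * B k)"
        proof (intro mult_left_mono C0)
          have "B (k - 1) * R \<le> B k"
          proof -
            have "B (k - 1) * R = K * fact (k - 1) * R ^ k" using k by (simp add: B_def)
            also have "\<dots> \<le> B k" unfolding B_def using K0 R by (intro mult_right_mono mult_left_mono fact_mono) auto
            finally show ?thesis .
          qed
          then show "B (k - 1) \<le> 1 / R * B k" using R by (simp add: field_simps)
        qed
        ultimately have "norm (l (XX ^ a * YY ^ b)) \<le> C * (1 / R * B k) + C * (2 / R * B k) + C * (2 / R * B k)"
          by (smt (verit) norm_triangle_ineq)
        also have "\<dots> = 5 * C / R * B k" by (simp add: field_simps)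
        also have "\<dots> \<le> B k" using mult_right_mono[OF R(2) B0[of k]] by simp
        finally show ?thesis by (simp add: k_def)
      qed
    qed
    then show ?thesis unfolding B_def by blast
  qed
  then show ?thesis using that[of R] R(1) by auto
qed

end

section \<open>Codimension of the sum of the two images\<close>

interpretation bp: vector_space "\<lambda>a w. cst a * w"
  by unfold_locales (simp_all add: algebra_simps)

definition mons :: "nat \<Rightarrow> complex poly poly set" where
  "mons m = (\<lambda>p. XX ^ fst p * YY ^ snd p) ` {(i, j). i + j < m}"

lemma inj_monom: "inj_on (\<lambda>p. XX ^ fst p * YY ^ snd p) S"
proof (rule inj_onI)
  fix p q :: "nat \<times> nat" assume "XX ^ fst p * YY ^ snd p = XX ^ fst q * YY ^ snd q"
  then have "coeff (coeff (cst 1 * (XX ^ fst p * YY ^ snd p)) (fst p)) (snd p)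
    = coeff (coeff (cst 1 * (XX ^ fst q * YY ^ snd q)) (fst p)) (snd p)" by simp
  then show "p = q" unfolding coeff_scaled_monom by (auto simp: prod_eq_iff split: if_splits)
qed

lemma finite_triangle: "finite {(i, j). i + j < (m::nat)}"
  by (rule finite_subset[of _ "{..m} \<times> {..m}"]) auto

lemma finite_mons [simp]: "finite (mons m)"
  using finite_triangle by (simp add: mons_def)

text \<open>Doubled, to keep the later dimension count free of division.\<close>

lemma card_mons: "2 * card (mons m) = m * (m + 1)"
proof -
  have "{(i, j). i + j < m} = (SIGMA i:{..<m}. {..<m - i})" by auto
  then have "card (mons m) = (\<Sum>i<m. m - i)" unfolding mons_def card_image[OF inj_monom] by simp
  moreover have "2 * (\<Sum>i<m. m - i) = m * (m + 1)"
    by (induction m) (simp_all add: sum.lessThan_Suc_shift del: sum.lessThan_Suc)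
  ultimately show ?thesis by simp
qed

lemma span_mons: "bp.span (mons m) = deg_lt m"
proof
  have "bp.subspace (deg_lt m)"
    by (rule bp.subspaceI) (auto intro: deg_lt_add deg_lt_cmult)
  moreover have "mons m \<subseteq> deg_lt m" by (auto simp: mons_def monom_in_deg_lt)
  ultimately show "bp.span (mons m) \<subseteq> deg_lt m" by (rule bp.span_minimal[rotated])
  show "deg_lt m \<subseteq> bp.span (mons m)"
  proof
    fix w assume "w \<in> deg_lt m"
    then show "w \<in> bp.span (mons m)"
    proof (induction rule: deg_lt_induct)
      case (monom i j)
      then show ?case by (intro bp.span_base) (force simp: mons_def)
    qed (auto intro: bp.span_zero bp.span_add bp.span_scale)
  qed
qed

lemma independent_mons: "bp.independent (mons m)"
proof (rule bp.independent_if_scalars_zero)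
  fix f x assume s: "(\<Sum>x\<in>mons m. cst (f x) * x) = 0" and x: "x \<in> mons m"
  let ?g = "\<lambda>p. XX ^ fst p * YY ^ snd p"
  obtain p where p: "p \<in> {(i, j). i + j < m}" "x = ?g p" using x by (auto simp: mons_def)
  have "(\<Sum>x\<in>mons m. cst (f x) * x) = (\<Sum>q\<in>{(i, j). i + j < m}. cst (f (?g q)) * ?g q)"
    unfolding mons_def by (subst sum.reindex[OF inj_monom]) simp
  then have "coeff (coeff (\<Sum>q\<in>{(i, j). i + j < m}. cst (f (?g q)) * ?g q) (fst p)) (snd p) = 0" using s by simp
  then have "(\<Sum>q\<in>{(i, j). i + j < m}. if q = p then f (?g q) else 0) = 0"
    unfolding coeff_sum coeff_scaled_monom by (simp add: prod_eq_iff cong: if_cong)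
  then show "f x = 0" using p finite_triangle[of m] by simp
qed simp

section \<open>Dimension count and dual basis\<close>

context syzygy_pair begin

lemma T_sum: "T1 (sum f I) = (\<Sum>i\<in>I. T1 (f i))" "T2 (sum f I) = (\<Sum>i\<in>I. T2 (f i))"
  by (induction I rule: infinite_finite_induct) (auto simp: T_linear)

text \<open>A basis of the part of im T1 + im T2 in degrees below d1 + d2 - 1: by
  \<open>reduce_relation\<close> that part already comes from arguments of degrees below e2 and
  e1.\<close>

definition low :: "complex poly poly set" where
  "low = T1 ` mons e2 \<union> T2 ` mons e1"

lemma mons_deg: "x \<in> mons m \<Longrightarrow> x \<in> deg_lt m"
  using span_mons bp.span_base by blast

lemma inj_T1: "inj_on T1 (mons e2)" and inj_T2: "inj_on T2 (mons e1)"
  and disjoint_T: "T1 ` mons e2 \<inter> T2 ` mons e1 = {}"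
proof -
  show "inj_on T1 (mons e2)"
  proof (rule inj_onI)
    fix x y assume "x \<in> mons e2" "y \<in> mons e2" "T1 x = T1 y"
    then show "x = y" using no_small_relation(1)[of "x - y" 0] by (simp add: T_linear deg_lt_diff mons_deg)
  qed
  show "inj_on T2 (mons e1)"
  proof (rule inj_onI)
    fix x y assume "x \<in> mons e1" "y \<in> mons e1" "T2 x = T2 y"
    then show "x = y" using no_small_relation(2)[of 0 "x - y"] by (simp add: T_linear deg_lt_diff mons_deg)
  qed
  have "False" if "x \<in> mons e2" "y \<in> mons e1" "T1 x = T2 y" for x y
  proof -
    have "x = 0" using no_small_relation(1)[of x "0 - y"] that by (simp only: T_linear deg_lt_diff mons_deg zero_in_deg_lt) simp
    then show False using that(1) independent_mons bp.dependent_zero by blast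
  qed
  then show "T1 ` mons e2 \<inter> T2 ` mons e1 = {}" by blast
qed

lemma low_sum: "(\<Sum>x\<in>low. cst (f x) * x)
  = T1 (\<Sum>x\<in>mons e2. cst (f (T1 x)) * x) + T2 (\<Sum>x\<in>mons e1. cst (f (T2 x)) * x)"
  unfolding low_def T_sum T_linear
  by (subst sum.union_disjoint) (auto simp: disjoint_T sum.reindex inj_T1 inj_T2)

lemma independent_low: "bp.independent low"
proof (rule bp.independent_if_scalars_zero)
  show "finite low" by (simp add: low_def)
  fix f x assume s: "(\<Sum>x\<in>low. cst (f x) * x) = 0" and x: "x \<in> low"
  define u where "u = (\<Sum>x\<in>mons e2. cst (f (T1 x)) * x)"
  define v where "v = (\<Sum>x\<in>mons e1. cst (f (T2 x)) * x)"
  have "(\<Sum>x\<in>low. cst (f x) * x) = T1 u + T2 v" unfolding low_sum u_def v_def ..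
  moreover have "u \<in> deg_lt e2" "v \<in> deg_lt e1"
    unfolding u_def v_def by (auto intro: deg_lt_sum deg_lt_cmult mons_deg)
  ultimately have "u = 0" "v = 0" using no_small_relation[of u v] s by auto
  then have "f (T1 y) = 0" if "y \<in> mons e2" for y
    using bp.independentD[OF independent_mons finite_mons subset_refl, where u = "\<lambda>x. f (T1 x)" and v = y] that by (simp add: u_def)
  moreover have "f (T2 y) = 0" if "y \<in> mons e1" for y
    using bp.independentD[OF independent_mons finite_mons subset_refl, where u = "\<lambda>x. f (T2 x)" and v = y] that \<open>v = 0\<close> by (simp add: v_def)
  ultimately show "f x = 0" using x by (auto simp: low_def)
qed

lemma span_low: "u \<in> deg_lt e2 \<Longrightarrow> v \<in> deg_lt e1 \<Longrightarrow> T1 u + T2 v \<in> bp.span low"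
proof -
  have "T1 u \<in> bp.span low" if "u \<in> deg_lt e2" for u
    using that
  proof (induction rule: deg_lt_induct)
    case (monom i j)
    then show ?case by (intro bp.span_base) (force simp: low_def mons_def)
  qed (auto simp: T_linear intro: bp.span_zero bp.span_add bp.span_scale)
  moreover have "T2 v \<in> bp.span low" if "v \<in> deg_lt e1" for v
    using that
  proof (induction rule: deg_lt_induct)
    case (monom i j)
    then show ?case by (intro bp.span_base) (force simp: low_def mons_def)
  qed (auto simp: T_linear intro: bp.span_zero bp.span_add bp.span_scale)
  ultimately show "u \<in> deg_lt e2 \<Longrightarrow> v \<in> deg_lt e1 \<Longrightarrow> T1 u + T2 v \<in> bp.span low"
    by (simp add: bp.span_add)
qed

lemma low_subset: "low \<subseteq> deg_lt (Suc (e1 + e2))"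
proof -
  have "T1 x \<in> deg_lt (Suc (e1 + e2))" if x: "x \<in> mons e2" for x
  proof (cases e2)
    case (Suc m)
    then show ?thesis using T1_deg(1)[of x m] mons_deg[OF x] by simp
  qed (use mons_deg[OF x] in \<open>simp add: T_linear\<close>)
  moreover have "T2 x \<in> deg_lt (Suc (e1 + e2))" if x: "x \<in> mons e1" for x
  proof (cases e1)
    case (Suc m)
    then show ?thesis using T2_deg(1)[of x m] mons_deg[OF x] by (simp add: add_ac)
  qed (use mons_deg[OF x] in \<open>simp add: T_linear\<close>)
  ultimately show ?thesis by (auto simp: low_def)
qed

text \<open>With D = e1 + e2 + 1 the count is D (D + 1) / 2 - e1 (e1 + 1) / 2 - e2 (e2 + 1) / 2 =
  (e1 + 1) (e2 + 1).\<close>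

lemma complement_exists:
  obtains C where "card C = Suc e1 * Suc e2" "finite C" "C \<inter> low = {}" "bp.independent (low \<union> C)"
    "bp.span (low \<union> C) = deg_lt (Suc (e1 + e2))"
proof -
  let ?D = "Suc (e1 + e2)"
  obtain B where B: "low \<subseteq> B" "B \<subseteq> deg_lt ?D" "bp.independent B" "deg_lt ?D \<subseteq> bp.span B"
    using bp.maximal_independent_subset_extend[OF low_subset independent_low] by blast
  have sp: "bp.span B = bp.span (mons ?D)"
    using B(2,4) bp.span_minimal[OF B(2)] bp.subspace_span[of "mons ?D"] unfolding span_mons by auto
  have "card B = card (mons ?D)"
    using bp.span_eq_dim[OF sp] B(3) independent_mons by (simp add: bp.dim_eq_card_independent)
  moreover have finB: "finite B"
    using bp.independent_span_bound[of "mons ?D" B] B(2,3) by (simp add: span_mons)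
  moreover have "card low = card (mons e2) + card (mons e1)"
    unfolding low_def using disjoint_T by (subst card_Un_disjoint) (auto simp: card_image inj_T1 inj_T2)
  ultimately have "card (B - low) + (card (mons e2) + card (mons e1)) = card (mons ?D)"
    using B(1) card_Diff_subset[of low B] card_mono[OF finB B(1)] finite_subset[OF B(1) finB] by simp
  then have "2 * card (B - low) + (e2 * (e2 + 1) + e1 * (e1 + 1)) = ?D * (?D + 1)"
    using card_mons[of e1] card_mons[of e2] card_mons[of ?D] by linarith
  then have "card (B - low) = Suc e1 * Suc e2" by (simp add: algebra_simps)
  moreover have "low \<union> (B - low) = B" using B(1) by blast
  ultimately show ?thesis using that[of "B - low"] finB B sp span_mons by auto
qed

text \<open>The complement of \<open>low\<close> represents the quotient by im T1 + im T2: it spans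
  by \<open>reduce_to_low_degree\<close>, and it stays independent because an element of the images
  of low degree lies in the span of \<open>low\<close>. The L i are the coordinate functionals of
  that quotient.\<close>

theorem annihilator_basis:
  obtains e :: "nat \<Rightarrow> complex poly poly" and L where
    "\<And>i. i < Suc e1 * Suc e2 \<Longrightarrow> L i \<in> annihilator"
    "\<And>i j. i < Suc e1 * Suc e2 \<Longrightarrow> j < Suc e1 * Suc e2 \<Longrightarrow> L i (e j) = (if i = j then 1 else 0)"
    "\<And>l w. l \<in> annihilator \<Longrightarrow> l w = (\<Sum>i<Suc e1 * Suc e2. l (e i) * L i w)"
proof -
  define N where "N = Suc e1 * Suc e2"
  obtain C where C: "card C = N" "finite C" "C \<inter> low = {}" "bp.independent (low \<union> C)"
    "bp.span (low \<union> C) = deg_lt (Suc (e1 + e2))" unfolding N_def by (rule complement_exists)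
  obtain e where e: "bij_betw e {..<N} C" using ex_bij_betw_nat_finite[OF C(2)] C(1) by (auto simp: atLeast0LessThan)
  have fin_low: "finite low" by (simp add: low_def)
  have reindex: "(\<Sum>i<N. cst (a i) * e i) = (\<Sum>c\<in>C. cst (a (inv_into {..<N} e c)) * c)" for a
    using e by (subst sum.reindex_bij_betw[OF e, symmetric]) (auto intro!: sum.cong simp: bij_betw_def)
  define rep where "rep w a \<longleftrightarrow> (\<exists>u v. w = T1 u + T2 v + (\<Sum>i<N. cst (a i) * e i))" for w a
  have ex: "\<exists>a. rep w a" for w
  proof -
    obtain u v where "w - T1 u - T2 v \<in> deg_lt (Suc (e1 + e2))" using reduce_to_low_degree by blast
    then obtain r where r: "w - T1 u - T2 v = (\<Sum>x\<in>low \<union> C. cst (r x) * x)"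
      unfolding C(5)[symmetric] using bp.span_finite[of "low \<union> C"] fin_low C(2) by auto
    define u' where "u' = (\<Sum>x\<in>mons e2. cst (r (T1 x)) * x)"
    define v' where "v' = (\<Sum>x\<in>mons e1. cst (r (T2 x)) * x)"
    have "(\<Sum>x\<in>low. cst (r x) * x) = T1 u' + T2 v'" unfolding low_sum u'_def v'_def ..
    moreover have "(\<Sum>x\<in>C. cst (r x) * x) = (\<Sum>i<N. cst (r (e i)) * e i)"
      using e by (subst sum.reindex_bij_betw[OF e, symmetric]) auto
    moreover have "(\<Sum>x\<in>low \<union> C. cst (r x) * x) = (\<Sum>x\<in>low. cst (r x) * x) + (\<Sum>x\<in>C. cst (r x) * x)"
      using C fin_low by (intro sum.union_disjoint) auto
    ultimately have "w = T1 (u + u') + T2 (v + v') + (\<Sum>i<N. cst (r (e i)) * e i)"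
      using r by (simp add: T_linear algebra_simps)
    then show ?thesis unfolding rep_def by (intro exI)
  qed
  have zero: "a i = 0" if "rep 0 a" "i < N" for a i
  proof -
    from that obtain u v where "0 = T1 u + T2 v + (\<Sum>i<N. cst (a i) * e i)" by (auto simp: rep_def)
    then have uv: "T1 u + T2 v = (\<Sum>i<N. cst (- a i) * e i)" by (simp add: eq_neg_iff_add_eq_0 sum_negf eq_commute[of 0])
    have "(\<Sum>i<N. cst (- a i) * e i) \<in> bp.span (low \<union> C)"
      using e by (intro bp.span_sum bp.span_scale bp.span_base) (auto simp: bij_betw_def)
    then have "T1 u + T2 v \<in> deg_lt (Suc (e1 + e2))" using uv C(5) by simp
    moreover obtain m1 m2 where "u \<in> deg_lt m1" "v \<in> deg_lt m2" using in_some_deg_lt by meson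
    then have "u \<in> deg_lt (e2 + (m1 + m2))" "v \<in> deg_lt (e1 + (m1 + m2))" by (auto elim: deg_lt_mono)
    ultimately obtain u' v' where "u' \<in> deg_lt e2" "v' \<in> deg_lt e1" "T1 u + T2 v = T1 u' + T2 v'"
      using reduce_relation by blast
    then have "T1 u + T2 v \<in> bp.span low" using span_low by simp
    then obtain r where r: "T1 u + T2 v = (\<Sum>x\<in>low. cst (r x) * x)"
      using bp.span_finite[OF fin_low] by auto
    \<comment> \<open>Joins the coefficients on \<open>low\<close> and on C into one relation, to
      which independence of the union applies.\<close>
    define f where "f x = (if x \<in> low then r x else a (inv_into {..<N} e x))" for x
    have "(\<Sum>x\<in>low \<union> C. cst (f x) * x) = (\<Sum>x\<in>low. cst (f x) * x) + (\<Sum>x\<in>C. cst (f x) * x)"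
      using C fin_low by (intro sum.union_disjoint) auto
    also have "(\<Sum>x\<in>low. cst (f x) * x) = T1 u + T2 v" unfolding r by (simp add: f_def)
    also have "(\<Sum>x\<in>C. cst (f x) * x) = (\<Sum>i<N. cst (a i) * e i)"
      unfolding reindex using C(3) by (intro sum.cong) (auto simp: f_def)
    also have "T1 u + T2 v + (\<Sum>i<N. cst (a i) * e i) = 0" unfolding uv by (simp add: sum_negf)
    finally have "f (e i) = 0"
      using bp.independentD[OF C(4) _ subset_refl] fin_low C(2) e that(2) by (auto simp: bij_betw_def)
    moreover have "e i \<in> C" "inv_into {..<N} e (e i) = i" using e that(2) by (auto simp: bij_betw_def)
    ultimately show ?thesis using C(3) by (auto simp: f_def split: if_splits)
  qed
  \<comment> \<open>The coordinates are chosen arbitrarily here; \<open>Leq\<close> shows that they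
    are unique, and linearity follows from that.\<close>
  define L where "L i w = (SOME a. rep w a) i" for i w
  have repL: "rep w (\<lambda>i. L i w)" for w unfolding L_def using someI_ex[OF ex] by simp
  have rep_add: "rep (w + w') (\<lambda>i. a i + a' i)" if rw: "rep w a" "rep w' a'" for w w' a a'
  proof -
    obtain u v u' v' where "w = T1 u + T2 v + (\<Sum>i<N. cst (a i) * e i)" "w' = T1 u' + T2 v' + (\<Sum>i<N. cst (a' i) * e i)"
      using rw by (auto simp: rep_def)
    then have "w + w' = T1 (u + u') + T2 (v + v') + (\<Sum>i<N. cst (a i + a' i) * e i)"
      by (simp add: T_linear sum.distrib algebra_simps)
    then show ?thesis unfolding rep_def by blast
  qed
  have rep_scale: "rep (cst c * w) (\<lambda>i. c * a i)" if rw: "rep w a" for w a c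
  proof -
    obtain u v where w: "w = T1 u + T2 v + (\<Sum>i<N. cst (a i) * e i)" using rw by (auto simp: rep_def)
    have "cst c * w = T1 (cst c * u) + T2 (cst c * v) + (\<Sum>i<N. cst (c * a i) * e i)"
      unfolding w T_linear distrib_left sum_distrib_left cst_simps mult.assoc ..
    then show ?thesis unfolding rep_def by blast
  qed
  have Leq: "L i w = a i" if "rep w a" "i < N" for i w a
  proof -
    have "rep (w + cst (-1) * w) (\<lambda>i. L i w + (-1) * a i)" by (intro rep_add rep_scale repL that(1))
    then have "rep 0 (\<lambda>i. L i w + (-1) * a i)" by simp
    from zero[OF this that(2)] show ?thesis by simp
  qed
  show ?thesis
  proof (rule that[of L e], unfold N_def[symmetric])
    fix i assume i: "i < N"
    have "bilin (L i)"
      unfolding bilin_def using Leq[OF rep_add[OF repL repL] i] Leq[OF rep_scale[OF repL] i] by auto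
    moreover have "L i (T1 u) = 0" for u
      by (rule Leq[OF _ i, of _ "\<lambda>_. 0"], unfold rep_def, rule exI[of _ u], rule exI[of _ 0]) (simp add: T_linear)
    moreover have "L i (T2 u) = 0" for u
      by (rule Leq[OF _ i, of _ "\<lambda>_. 0"], unfold rep_def, rule exI[of _ 0], rule exI[of _ u]) (simp add: T_linear)
    ultimately show "L i \<in> annihilator" by (simp add: annihilator_def)
    fix j assume j: "j < N"
    have "e j = T1 0 + T2 0 + (\<Sum>i<N. cst (if i = j then 1 else 0) * e i)"
      using j by (simp add: T_linear if_distrib[of cst] if_distrib[of "\<lambda>x. x * _"] cong: if_cong)
    then have "rep (e j) (\<lambda>i. if i = j then 1 else 0)" unfolding rep_def by blast
    then show "L i (e j) = (if i = j then 1 else 0)" by (rule Leq[OF _ i])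
  next
    fix l w assume l: "l \<in> annihilator"
    obtain u v where "w = T1 u + T2 v + (\<Sum>i<N. cst (L i w) * e i)" using repL[of w] unfolding rep_def by blast
    then have "l w = l (T1 u + T2 v + (\<Sum>i<N. cst (L i w) * e i))" by simp
    also have "\<dots> = (\<Sum>i<N. L i w * l (e i))"
      using l by (simp add: annihilator_def bilinD bilin_sum)
    finally show "l w = (\<Sum>i<N. l (e i) * L i w)" by (simp add: mult.commute)
  qed
qed

end

section \<open>Holomorphic functions of several variables\<close>

lemma upd_nth [simp]: "upd x j z $ i = (if i = j then z else x $ i)" by (simp add: upd_def)
lemma upd_same [simp]: "upd x j (x $ j) = x" by (simp add: vec_eq_iff)
lemma upd_upd [simp]: "upd (upd x j z) j w = upd x j w" by (simp add: vec_eq_iff)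
lemma upd_swap: "j \<noteq> k \<Longrightarrow> upd (upd x j z) k w = upd (upd x k w) j z" by (simp add: vec_eq_iff)

lemma dist_upd: "dist (upd x j z) (upd x j w) = dist z w"
proof -
  have "upd x j z - upd x j w = axis j (z - w)" by (simp add: vec_eq_iff axis_def)
  then show ?thesis by (simp add: dist_norm norm_eq_sqrt_inner inner_axis_axis)
qed

lemma dist_upd_self: "dist x (upd x j z) = dist (x $ j) z"
  using dist_upd[of x j "x $ j" z] by simp

lemma continuous_on_upd [continuous_intros]:
  fixes f :: "'a::topological_space \<Rightarrow> complex^'n"
  assumes "continuous_on S f" "continuous_on S g"
  shows "continuous_on S (\<lambda>t. upd (f t) j (g t))"
proof -
  have "continuous_on S (\<lambda>t. if i = j then g t else f t $ i)" for i
    using assms by (cases "i = j") (auto intro!: continuous_intros)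
  then show ?thesis unfolding upd_def by (intro continuous_on_vec_lambda)
qed

lemma hol_on_subset: "hol_on U f \<Longrightarrow> open V \<Longrightarrow> V \<subseteq> U \<Longrightarrow> hol_on V f"
  by (auto simp: hol_on_def intro: continuous_on_subset)

lemma hol_on_slice:
  assumes "hol_on U f" "\<And>z. z \<in> S \<Longrightarrow> upd x j z \<in> U"
  shows "z \<in> S \<Longrightarrow> ((\<lambda>z. f (upd x j z)) has_field_derivative pd j f (upd x j z)) (at z)"
    and "(\<lambda>z. f (upd x j z)) holomorphic_on S"
proof -
  show *: "((\<lambda>z. f (upd x j z)) has_field_derivative pd j f (upd x j z)) (at z)" if "z \<in> S" for z
  proof -
    have "(\<lambda>w. f (upd (upd x j z) j w)) field_differentiable (at (upd x j z $ j))"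
      using assms that unfolding hol_on_def by blast
    then show ?thesis by (simp add: pd_def field_differentiable_derivI)
  qed
  then show "(\<lambda>z. f (upd x j z)) holomorphic_on S"
    by (auto simp: holomorphic_on_def field_differentiable_def intro: has_field_derivative_at_within)
qed

lemma hol_on_has_pd:
  assumes "hol_on U f" "x \<in> U"
  shows "((\<lambda>z. f (upd x j z)) has_field_derivative pd j f x) (at (x $ j))"
  using hol_on_slice(1)[OF assms(1), of "{x $ j}" x j "x $ j"] assms(2) by simp

lemma pd_eqI: "((\<lambda>z. f (upd x j z)) has_field_derivative d) (at (x $ j)) \<Longrightarrow> pd j f x = d"
  by (simp add: pd_def DERIV_imp_deriv)

lemma eventually_upd_in:
  assumes "open U" "x \<in> U"
  shows "eventually (\<lambda>z. upd x j z \<in> U) (nhds (x $ j))"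
proof -
  obtain e where "e > 0" "ball x e \<subseteq> U" using assms openE by blast
  then show ?thesis unfolding eventually_nhds_metric
    by (intro exI[of _ e]) (auto simp: dist_upd_self dist_commute subset_iff)
qed

lemma pd_cong:
  assumes "open U" "x \<in> U" "\<And>y. y \<in> U \<Longrightarrow> f y = g y"
  shows "pd j f x = pd j g x"
  unfolding pd_def
  by (intro deriv_cong_ev refl) (rule eventually_mono[OF eventually_upd_in[OF assms(1,2)]], rule assms(3))

lemma hol_onI:
  assumes "open U" "continuous_on U f"
    "\<And>x j. x \<in> U \<Longrightarrow> ((\<lambda>z. f (upd x j z)) has_field_derivative d j x) (at (x $ j))"
  shows "hol_on U f"
  using assms by (auto simp: hol_on_def field_differentiable_def)

lemma hol_on_cong:
  assumes "hol_on U f" "\<And>y. y \<in> U \<Longrightarrow> f y = g y"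
  shows "hol_on U g"
proof (rule hol_onI)
  show U: "open U" using assms by (simp add: hol_on_def)
  show "continuous_on U g" using assms by (simp add: hol_on_def cong: continuous_on_cong)
  fix x j assume x: "x \<in> U"
  have "((\<lambda>z. f (upd x j z)) has_field_derivative pd j f x) (at (x $ j))" by (rule hol_on_has_pd[OF assms(1) x])
  moreover have "\<forall>\<^sub>F z in nhds (x $ j). f (upd x j z) = g (upd x j z)"
    by (rule eventually_mono[OF eventually_upd_in[OF U x]]) (rule assms(2))
  ultimately show "((\<lambda>z. g (upd x j z)) has_field_derivative pd j f x) (at (x $ j))"
    using DERIV_cong_ev by fast
qed

lemma hol_on_const: "open (U :: (complex^'b) set) \<Longrightarrow> hol_on U (\<lambda>x. a)"
  and hol_on_coord: "open U \<Longrightarrow> hol_on U (\<lambda>x. x $ j)"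
proof -
  assume U: "open U"
  show "hol_on U (\<lambda>x. a)" by (rule hol_onI[OF U, where d = "\<lambda>_ _. 0"]) auto
  show "hol_on U (\<lambda>x. x $ j)"
  proof (rule hol_onI[OF U, where d = "\<lambda>i _. if i = j then 1 else 0"])
    show "continuous_on U (\<lambda>x. x $ j)" by (intro continuous_intros)
    fix x :: "complex ^ 'b" and i
    show "((\<lambda>z. upd x i z $ j) has_field_derivative (if i = j then 1 else 0)) (at (x $ i))"
      by (cases "i = j") auto
  qed
qed

lemma hol_on_add: "hol_on U f \<Longrightarrow> hol_on U g \<Longrightarrow> hol_on U (\<lambda>x. f x + g x)"
  and hol_on_diff: "hol_on U f \<Longrightarrow> hol_on U g \<Longrightarrow> hol_on U (\<lambda>x. f x - g x)"
  and hol_on_mult: "hol_on U f \<Longrightarrow> hol_on U g \<Longrightarrow> hol_on U (\<lambda>x. f x * g x)"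
  unfolding hol_on_def
  by (auto intro!: continuous_intros field_differentiable_add field_differentiable_diff field_differentiable_mult)

lemma hol_on_cmult: "hol_on U f \<Longrightarrow> hol_on U (\<lambda>x. a * f x)"
  by (rule hol_on_mult[OF hol_on_const]) (auto simp: hol_on_def)

lemma hol_on_sum: "open U \<Longrightarrow> (\<And>i. i \<in> I \<Longrightarrow> hol_on U (f i)) \<Longrightarrow> hol_on U (\<lambda>x. \<Sum>i\<in>I. f i x)"
  by (induction I rule: infinite_finite_induct) (auto intro: hol_on_const hol_on_add)

lemma pd_const [simp]: "pd j (\<lambda>x. a) x = 0" by (simp add: pd_def)

lemma pd_add: "hol_on U f \<Longrightarrow> hol_on U g \<Longrightarrow> x \<in> U \<Longrightarrow> pd j (\<lambda>x. f x + g x) x = pd j f x + pd j g x"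
  and pd_diff: "hol_on U f \<Longrightarrow> hol_on U g \<Longrightarrow> x \<in> U \<Longrightarrow> pd j (\<lambda>x. f x - g x) x = pd j f x - pd j g x"
  and pd_mult: "hol_on U f \<Longrightarrow> hol_on U g \<Longrightarrow> x \<in> U \<Longrightarrow> pd j (\<lambda>x. f x * g x) x = f x * pd j g x + pd j f x * g x"
  using hol_on_has_pd[of U f x j] hol_on_has_pd[of U g x j]
  by (auto intro!: pd_eqI derivative_eq_intros)

lemma pd_cmult: "hol_on U f \<Longrightarrow> x \<in> U \<Longrightarrow> pd j (\<lambda>x. a * f x) x = a * pd j f x"
  using hol_on_has_pd[of U f x j] by (auto intro!: pd_eqI derivative_eq_intros)

lemma pd_sum: "finite I \<Longrightarrow> open U \<Longrightarrow> (\<And>i. i \<in> I \<Longrightarrow> hol_on U (f i)) \<Longrightarrow> x \<in> U \<Longrightarrow> pd j (\<lambda>x. \<Sum>i\<in>I. f i x) x = (\<Sum>i\<in>I. pd j (f i) x)"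
proof (induction I rule: finite_induct)
  case (insert i I)
  then show ?case using pd_add[of U "f i" "\<lambda>x. \<Sum>i\<in>I. f i x" x j] by (simp add: hol_on_sum)
qed simp

text \<open>Uniform convergence of the difference quotients is what transfers holomorphy to the partial
  derivative, and it also gives the symmetry of second derivatives.\<close>
lemma difference_quotient_bound:
  assumes "hol_on U f" "cball x0 (3 * e) \<subseteq> U" "e > 0"
  obtains C where "\<And>x h. x \<in> ball x0 e \<Longrightarrow> h \<noteq> 0 \<Longrightarrow> norm h < e \<Longrightarrow>
    norm ((f (upd x j (x $ j + h)) - f x) / h - pd j f x) \<le> C * norm h"
proof -
  have "compact (f ` cball x0 (3 * e))"
    using assms by (intro compact_continuous_image) (auto simp: hol_on_def intro: continuous_on_subset)
  then have "bounded (f ` cball x0 (3 * e))" by (rule compact_imp_bounded)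
  then obtain M where M: "\<And>y. y \<in> cball x0 (3 * e) \<Longrightarrow> norm (f y) \<le> M"
    unfolding bounded_iff by (metis imageI)
  show thesis
  proof (rule that)
    fix x and h :: complex assume x: "x \<in> ball x0 e" and h: "h \<noteq> 0" "norm h < e"
    define g where "g = (\<lambda>z. f (upd x j z))"
    \<comment> \<open>The disc of radius 2e about x_j stays in the ball of radius 3e about x0, and
      it contains the circles of radius e about all points within e of x_j on which Cauchy's
      inequality is used.\<close>
    have sub: "upd x j z \<in> cball x0 (3 * e)" if "z \<in> cball (x $ j) (2 * e)" for z
      using that x dist_triangle[of x0 "upd x j z" x] dist_upd_self[of x j z] by (simp add: dist_commute)
    then have g: "g holomorphic_on cball (x $ j) (2 * e)"
      unfolding g_def by (intro hol_on_slice(2)[OF assms(1)]) (use assms(2) in blast)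
    have gM: "norm (g z) \<le> M" if "z \<in> cball (x $ j) (2 * e)" for z using M sub that by (simp add: g_def)
    define G where "G i = (deriv ^^ i) g" for i
    have g': "g holomorphic_on ball (x $ j) (2 * e)" using g holomorphic_on_subset ball_subset_cball by blast
    have "norm (G 0 (x $ j + h) - (\<Sum>i\<le>1. G i (x $ j) * ((x $ j + h) - x $ j) ^ i / fact i))
      \<le> (2 * M / e^2) * norm ((x $ j + h) - x $ j) ^ Suc 1 / fact 1"
    proof (rule complex_Taylor)
      show "convex (ball (x $ j) e)" by simp
      show "x $ j \<in> ball (x $ j) e" "x $ j + h \<in> ball (x $ j) e" using assms h by (auto simp: dist_norm)
      fix i :: nat and z assume z: "z \<in> ball (x $ j) e"
      have "G i holomorphic_on ball (x $ j) (2 * e)" unfolding G_def by (intro holomorphic_higher_deriv g') auto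
      then show "(G i has_field_derivative G (Suc i) z) (at z within ball (x $ j) e)"
        using z assms(3) by (auto simp: G_def intro!: has_field_derivative_at_within[OF holomorphic_derivI[of _ "ball (x $ j) (2*e)"]])
    next
      fix z assume z: "z \<in> ball (x $ j) e"
      have s: "cball z e \<subseteq> cball (x $ j) (2 * e)"
        using z by (auto simp: subset_iff) (smt (verit) dist_triangle dist_commute)
      have "norm ((deriv ^^ 2) g z) \<le> fact 2 * M / e ^ 2"
      proof (rule Cauchy_inequality)
        show "g holomorphic_on ball z e" "continuous_on (cball z e) g"
          using g s ball_subset_cball[of z e] holomorphic_on_imp_continuous_on
          by (blast intro: holomorphic_on_subset continuous_on_subset)+
        show "norm (g w) \<le> M" if "norm (z - w) = e" for w
          using that s by (intro gM) (auto simp: dist_norm)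
      qed (rule assms)
      then show "norm (G (Suc 1) z) \<le> 2 * M / e^2" by (simp add: G_def numeral_2_eq_2)
    qed
    moreover have "G 0 (x $ j + h) = f (upd x j (x $ j + h))" "G 0 (x $ j) = f x" "G 1 (x $ j) = pd j f x"
      by (simp_all add: G_def g_def pd_def)
    ultimately have "norm (f (upd x j (x $ j + h)) - f x - pd j f x * h) \<le> (2 * M / e^2) * norm h ^ 2"
      by (simp add: numeral_2_eq_2 algebra_simps)
    moreover have "(f (upd x j (x $ j + h)) - f x) / h - pd j f x = (f (upd x j (x $ j + h)) - f x - pd j f x * h) / h"
      using h by (simp add: field_simps)
    ultimately show "norm ((f (upd x j (x $ j + h)) - f x) / h - pd j f x) \<le> (2 * M / e^2) * norm h"
      using h by (simp add: norm_divide divide_le_eq power2_eq_square mult.assoc)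
  qed
qed

text \<open>The difference quotients are holomorphic and converge uniformly to
  \<open>pd j f\<close>, so Weierstrass' theorem on each coordinate line makes the limit
  holomorphic. It also gives the limit of their k-th partials, which are difference quotients of
  \<open>pd k f\<close>; this is the last conclusion, kept for the symmetry of second
  derivatives.\<close>

lemma pd_local:
  assumes f: "hol_on U f" and x0: "x0 \<in> U"
  obtains e h where "e > 0" "ball x0 e \<subseteq> U" "hol_on (ball x0 e) (pd j f)"
    "h \<longlonglongrightarrow> 0" "\<And>n. h n \<noteq> 0"
    "\<And>k. (\<lambda>n. (pd k f (upd x0 j (x0 $ j + h n)) - pd k f x0) / h n) \<longlonglongrightarrow> pd k (pd j f) x0"
proof -
  have U: "open U" using f by (simp add: hol_on_def)
  obtain d where d: "d > 0" "cball x0 d \<subseteq> U" using U x0 open_contains_cball by blast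
  define e where "e = d / 3"
  have e: "e > 0" "cball x0 (3 * e) \<subseteq> U" using d by (auto simp: e_def)
  obtain C where C: "\<And>x h. x \<in> ball x0 e \<Longrightarrow> h \<noteq> 0 \<Longrightarrow> norm h < e \<Longrightarrow>
    norm ((f (upd x j (x $ j + h)) - f x) / h - pd j f x) \<le> C * norm h"
    using difference_quotient_bound[OF f e(2,1)] by blast
  \<comment> \<open>The offset 2 keeps every increment strictly below e in norm, including the one
    for n = 0.\<close>
  define h where "h n = complex_of_real (e / (real n + 2))" for n
  have h: "h n \<noteq> 0" "norm (h n) < e" for n
    using e(1) by (auto simp: h_def norm_divide divide_less_eq simp flip: of_real_add of_real_divide)
  have h0: "h \<longlonglongrightarrow> 0"
  proof -
    have "(\<lambda>n. e / (real n + 2)) \<longlonglongrightarrow> 0" by real_asymp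
    from tendsto_of_real[OF this, where 'a = complex] show ?thesis unfolding h_def by simp
  qed
  define q where "q n x = (f (upd x j (x $ j + h n)) - f x) / h n" for n x
  have inU: "upd x j (x $ j + h n) \<in> U" if "x \<in> ball x0 e" for x n
  proof -
    have "dist x0 (upd x j (x $ j + h n)) \<le> 3 * e"
      using that h(2)[of n] dist_triangle[of x0 "upd x j (x $ j + h n)" x] dist_upd_self[of x j "x $ j + h n"]
      by (simp add: dist_norm norm_minus_commute) (use e(1) in linarith)
    then show ?thesis using e(2) by auto
  qed
  have sub: "ball x0 e \<subseteq> U" using e(1) by (intro subset_trans[OF _ e(2)]) auto
  have lineD: "((\<lambda>z. f (upd (upd x k z) j (upd x k z $ j + h n))) has_field_derivative pd k f (upd x j (x $ j + h n))) (at (x $ k))"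
    if x: "x \<in> ball x0 e" for x k n
  proof -
    let ?y = "upd x j (x $ j + h n)"
    have D: "((\<lambda>z. f (upd ?y k z)) has_field_derivative pd k f ?y) (at (?y $ k))"
      by (rule hol_on_has_pd[OF f inU[OF x]])
    show "((\<lambda>z. f (upd (upd x k z) j (upd x k z $ j + h n))) has_field_derivative pd k f ?y) (at (x $ k))"
    proof (cases "k = j")
      case True
      then show ?thesis using D by (simp add: DERIV_shift)
    next
      case False
      then show ?thesis using D by (simp add: upd_swap[of j k])
    qed
  qed
  have q: "hol_on (ball x0 e) (q n)" for n
  proof -
    have "hol_on (ball x0 e) (\<lambda>x. f (upd x j (x $ j + h n)))"
    proof (rule hol_onI[where d = "\<lambda>k x. pd k f (upd x j (x $ j + h n))"])
      show "continuous_on (ball x0 e) (\<lambda>x. f (upd x j (x $ j + h n)))"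
      proof (rule continuous_on_compose2[of U f])
        show "continuous_on U f" using f by (simp add: hol_on_def)
        show "continuous_on (ball x0 e) (\<lambda>x. upd x j (x $ j + h n))"
          by (intro continuous_on_upd continuous_on_add continuous_on_component continuous_on_id continuous_on_const)
        show "(\<lambda>x. upd x j (x $ j + h n)) ` ball x0 e \<subseteq> U" using inU by blast
      qed
      show "((\<lambda>z. f (upd (upd x k z) j (upd x k z $ j + h n))) has_field_derivative pd k f (upd x j (x $ j + h n))) (at (x $ k))"
        if "x \<in> ball x0 e" for x k by (rule lineD[OF that])
    qed simp
    then have "hol_on (ball x0 e) (\<lambda>x. inverse (h n) * (f (upd x j (x $ j + h n)) - f x))"
      using hol_on_subset[OF f _ sub] by (intro hol_on_cmult hol_on_diff) auto
    then show ?thesis by (rule hol_on_cong) (simp add: q_def divide_inverse_commute)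
  qed
  have pdq: "pd k (q n) x0 = (pd k f (upd x0 j (x0 $ j + h n)) - pd k f x0) / h n" for k n
  proof -
    have x0e: "x0 \<in> ball x0 e" using e by simp
    from DERIV_cdivide[OF DERIV_diff[OF lineD[OF x0e] hol_on_has_pd[OF f x0, of k]], of n "h n"]
    show ?thesis by (intro pd_eqI) (simp add: q_def)
  qed
  have ul: "uniform_limit (ball x0 e) q (pd j f) sequentially"
  proof (rule uniform_limitI)
    fix \<epsilon> :: real assume "\<epsilon> > 0"
    have "(\<lambda>n. C * norm (h n)) \<longlonglongrightarrow> C * norm (0::complex)" by (intro tendsto_intros h0)
    then have "\<forall>\<^sub>F n in sequentially. C * norm (h n) < \<epsilon>" using \<open>\<epsilon> > 0\<close> by (simp add: order_tendstoD)
    then show "\<forall>\<^sub>F n in sequentially. \<forall>x\<in>ball x0 e. dist (q n x) (pd j f x) < \<epsilon>"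
    proof eventually_elim
      case (elim n)
      then show ?case using order.strict_trans1[OF C[OF _ h(1)[of n] h(2)[of n]]] by (simp add: q_def dist_norm)
    qed
  qed
  have slice: "\<exists>g'. \<forall>z\<in>{z. upd x k z \<in> ball x0 e}. ((\<lambda>z. pd j f (upd x k z)) has_field_derivative g' z) (at z) \<and>
      (\<lambda>n. pd k (q n) (upd x k z)) \<longlonglongrightarrow> g' z" for x k
  proof (rule has_complex_derivative_uniform_sequence)
    have "continuous_on UNIV (\<lambda>z. upd x k z)" by (intro continuous_intros)
    then have op: "open ((\<lambda>z. upd x k z) -` ball x0 e)" by (intro open_vimage) auto
    then show S: "open {z. upd x k z \<in> ball x0 e}" by (simp add: vimage_def)
    show "((\<lambda>z. q n (upd x k z)) has_field_derivative pd k (q n) (upd x k z)) (at z)"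
      if "z \<in> {z. upd x k z \<in> ball x0 e}" for n z
      by (rule hol_on_slice(1)[OF q _ that]) auto
    fix z assume "z \<in> {z. upd x k z \<in> ball x0 e}"
    then obtain d where d: "d > 0" "cball z d \<subseteq> {z. upd x k z \<in> ball x0 e}" using S open_contains_cball by blast
    have "uniform_limit (cball z d) (\<lambda>n w. q n (upd x k w)) (\<lambda>w. pd j f (upd x k w)) sequentially"
      by (rule uniform_limit_compose'[OF ul]) (use d in auto)
    with d show "\<exists>d>0. cball z d \<subseteq> {z. upd x k z \<in> ball x0 e} \<and>
      uniform_limit (cball z d) (\<lambda>n w. q n (upd x k w)) (\<lambda>w. pd j f (upd x k w)) sequentially" by blast
  qed
  have D: "((\<lambda>z. pd j f (upd x k z)) has_field_derivative pd k (pd j f) x) (at (x $ k)) \<and> (\<lambda>n. pd k (q n) x) \<longlonglongrightarrow> pd k (pd j f) x"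
    if x: "x \<in> ball x0 e" for x k
  proof -
    obtain g' where g': "\<forall>z\<in>{z. upd x k z \<in> ball x0 e}. ((\<lambda>z. pd j f (upd x k z)) has_field_derivative g' z) (at z) \<and>
      (\<lambda>n. pd k (q n) (upd x k z)) \<longlonglongrightarrow> g' z" using slice by blast
    from bspec[OF this, of "x $ k"] x have a: "((\<lambda>z. pd j f (upd x k z)) has_field_derivative g' (x $ k)) (at (x $ k))"
      "(\<lambda>n. pd k (q n) x) \<longlonglongrightarrow> g' (x $ k)" by auto
    then show ?thesis using pd_eqI[OF a(1)] by simp
  qed
  have "hol_on (ball x0 e) (pd j f)"
  proof (rule hol_onI)
    show "continuous_on (ball x0 e) (pd j f)"
      by (rule uniform_limit_theorem[OF _ ul]) (use q in \<open>auto simp: hol_on_def\<close>)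
  qed (use D in auto)
  moreover have "(\<lambda>n. (pd k f (upd x0 j (x0 $ j + h n)) - pd k f x0) / h n) \<longlonglongrightarrow> pd k (pd j f) x0" for k
    using D[of x0 k] e(1) by (simp add: pdq)
  ultimately show ?thesis using e(1) sub h0 h(1) that by blast
qed

lemma hol_on_pd: "hol_on U f \<Longrightarrow> hol_on U (pd j f)"
proof -
  assume f: "hol_on U f"
  then have U: "open U" by (simp add: hol_on_def)
  have loc: "\<exists>e>0. ball x e \<subseteq> U \<and> hol_on (ball x e) (pd j f)" if "x \<in> U" for x
    using pd_local[OF f that, of j] by metis
  show ?thesis
  proof (rule hol_onI[OF U])
    show "continuous_on U (pd j f)"
      unfolding continuous_on_eq_continuous_at[OF U]
    proof
      fix x assume "x \<in> U"
      then obtain e where "e > 0" "hol_on (ball x e) (pd j f)" using loc by blast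
      then show "isCont (pd j f) x" by (auto simp: hol_on_def continuous_on_eq_continuous_at)
    qed
    fix x k assume "x \<in> U"
    then obtain e where "e > 0" "hol_on (ball x e) (pd j f)" using loc by blast
    then show "((\<lambda>z. pd j f (upd x k z)) has_field_derivative pd k (pd j f) x) (at (x $ k))"
      by (intro hol_on_has_pd) auto
  qed
qed

text \<open>Both mixed derivatives are limits of the same sequence of difference quotients of
  \<open>pd k f\<close> in direction j.\<close>

lemma pd_commute:
  assumes f: "hol_on U f" and x: "x \<in> U"
  shows "pd k (pd j f) x = pd j (pd k f) x"
proof -
  obtain e h where "e > 0" "ball x e \<subseteq> U" "hol_on (ball x e) (pd j f)" and h: "h \<longlonglongrightarrow> 0" "\<And>n. h n \<noteq> 0"
    "\<And>k. (\<lambda>n. (pd k f (upd x j (x $ j + h n)) - pd k f x) / h n) \<longlonglongrightarrow> pd k (pd j f) x"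
    by (rule pd_local[OF f x, of j]) blast
  have "((\<lambda>z. pd k f (upd x j z)) has_field_derivative pd j (pd k f) x) (at (x $ j))"
    by (rule hol_on_has_pd[OF hol_on_pd[OF f] x])
  then have "((\<lambda>h. (pd k f (upd x j (x $ j + h)) - pd k f x) / h) \<longlongrightarrow> pd j (pd k f) x) (at 0)"
    by (simp add: DERIV_def)
  then have "(\<lambda>n. (pd k f (upd x j (x $ j + h n)) - pd k f x) / h n) \<longlonglongrightarrow> pd j (pd k f) x"
    by (rule filterlim_compose) (simp add: filterlim_at h)
  with h(3)[of k] show ?thesis by (rule LIMSEQ_unique)
qed

lemma hol_on_foldr_pd: "hol_on U f \<Longrightarrow> hol_on U (foldr pd js f)"
  by (induction js) (auto intro: hol_on_pd)

section \<open>The identity theorem in several variables\<close>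

lemma higher_deriv_slice:
  assumes f: "hol_on U f" and S: "open S" "\<And>z. z \<in> S \<Longrightarrow> upd x j z \<in> U" and z: "z \<in> S"
  shows "(deriv ^^ m) (\<lambda>z. f (upd x j z)) z = foldr pd (replicate m j) f (upd x j z)"
  using z
proof (induction m arbitrary: z)
  case (Suc m)
  have "(deriv ^^ Suc m) (\<lambda>z. f (upd x j z)) z = deriv ((deriv ^^ m) (\<lambda>z. f (upd x j z))) z" by simp
  also have "\<dots> = deriv (\<lambda>z. foldr pd (replicate m j) f (upd x j z)) z"
    by (intro deriv_cong_ev refl eventually_mono[OF eventually_nhds_in_open[OF S(1) Suc.prems]] Suc.IH)
  also have "\<dots> = pd j (foldr pd (replicate m j) f) (upd x j z)"
    by (intro DERIV_imp_deriv hol_on_slice(1)[OF hol_on_foldr_pd[OF f], of S] S(2) Suc.prems)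
  finally show ?case by simp
qed simp

text \<open>Coordinates are released one at a time: along the new one all derivatives at x_j vanish
  by the induction hypothesis, and the identity theorem in one variable applies. All iterated
  partials have to be treated together, since the next coordinate needs each of them.\<close>

lemma hol_on_zero_near:
  fixes f :: "complex^'n \<Rightarrow> complex"
  assumes f: "hol_on U f" and e: "e > 0" "ball x e \<subseteq> U" and z: "\<And>js. foldr pd js f x = 0"
  shows "\<exists>\<delta>>0. \<forall>y\<in>ball x \<delta>. \<forall>js. foldr pd js f y = 0"
proof -
  \<comment> \<open>The polydisc of this radius lies in the ball of radius e, by comparison with the
    sum norm.\<close>
  define \<delta> where "\<delta> = e / real CARD('n)"
  have \<delta>: "\<delta> > 0" using e by (simp add: \<delta>_def)
  have box: "y \<in> U" if "\<And>i. norm (x $ i - y $ i) < \<delta>" for y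
  proof -
    have "norm (x - y) \<le> (\<Sum>i\<in>UNIV. norm ((x - y) $ i))" unfolding norm_vec_def by (rule L2_set_le_sum) auto
    also have "\<dots> < (\<Sum>i\<in>(UNIV::'n set). \<delta>)" by (intro sum_strict_mono) (use that in auto)
    also have "\<dots> = e" by (simp add: \<delta>_def)
    finally show ?thesis using e(2) by (auto simp: dist_norm)
  qed
  have main: "foldr pd js f y = 0" if "finite J" "\<And>i. i \<notin> J \<Longrightarrow> y $ i = x $ i" "\<And>i. norm (x $ i - y $ i) < \<delta>" for J js y
    using that
  proof (induction J arbitrary: y js rule: finite_induct)
    case empty
    then have "y = x" by (simp add: vec_eq_iff)
    then show ?case using z by simp
  next
    case (insert j J)
    define y0 where "y0 = upd y j (x $ j)"
    have y0: "foldr pd js f y0 = 0" for js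
      using insert.IH[of y0 js] insert.prems \<delta> by (auto simp: y0_def)
    let ?F = "foldr pd js f"
    have inU: "upd y j w \<in> U" if "w \<in> ball (x $ j) \<delta>" for w
      using that insert.prems(2) by (intro box) (auto simp: dist_norm)
    have "(\<lambda>w. ?F (upd y j w)) (y $ j) = 0"
    proof (rule holomorphic_fun_eq_0_on_ball[of "\<lambda>w. ?F (upd y j w)" "x $ j" \<delta>])
      show "(\<lambda>w. ?F (upd y j w)) holomorphic_on ball (x $ j) \<delta>"
        by (intro hol_on_slice(2)[OF hol_on_foldr_pd[OF f]] inU)
      show "y $ j \<in> ball (x $ j) \<delta>" using insert.prems(2) by (simp add: dist_norm)
      fix m
      have "(deriv ^^ m) (\<lambda>w. ?F (upd y j w)) (x $ j) = foldr pd (replicate m j) ?F y0"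
        unfolding y0_def using inU \<delta> by (intro higher_deriv_slice[OF hol_on_foldr_pd[OF f], of "ball (x $ j) \<delta>"]) auto
      also have "\<dots> = 0" using y0[of "replicate m j @ js"] by simp
      finally show "(deriv ^^ m) (\<lambda>w. ?F (upd y j w)) (x $ j) = 0" .
    qed
    then show ?case by simp
  qed
  have "foldr pd js f y = 0" if "y \<in> ball x \<delta>" for y js
  proof (rule main[of UNIV])
    fix i
    show "norm (x $ i - y $ i) < \<delta>"
      using that Finite_Cartesian_Product.norm_nth_le[of "x - y" i] by (simp add: dist_norm)
  qed auto
  with \<delta> show ?thesis by blast
qed

text \<open>The points at which all iterated partials vanish form an open and closed subset of
  U.\<close>

theorem hol_on_identity:
  fixes f :: "complex^'n \<Rightarrow> complex"
  assumes f: "hol_on U f" and U: "connected U" "p \<in> U" "x \<in> U" and z: "\<And>js. foldr pd js f p = 0"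
  shows "f x = 0"
proof -
  have "open U" using f by (simp add: hol_on_def)
  define Z where "Z = {x \<in> U. \<forall>js. foldr pd js f x = 0}"
  have "open Z"
    unfolding open_contains_ball
  proof
    fix x assume x: "x \<in> Z"
    then obtain e where e: "e > 0" "ball x e \<subseteq> U" using \<open>open U\<close> openE by (auto simp: Z_def)
    obtain \<delta> where "\<delta> > 0" "\<forall>y\<in>ball x \<delta>. \<forall>js. foldr pd js f y = 0"
      using hol_on_zero_near[OF f e] x by (auto simp: Z_def)
    then show "\<exists>d>0. ball x d \<subseteq> Z"
      using e by (intro exI[of _ "min e \<delta>"]) (auto simp: Z_def subset_iff)
  qed
  then have "openin (top_of_set U) Z" by (intro open_subset) (auto simp: Z_def)
  moreover have "closedin (top_of_set U) Z"
  proof -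
    have "closedin (top_of_set U) (\<Inter>js. {x \<in> U. foldr pd js f x = 0})"
    proof (intro closedin_INT)
      show "closedin (top_of_set U) {x \<in> U. foldr pd js f x = 0}" for js
        using hol_on_foldr_pd[OF f, of js] by (intro continuous_closedin_preimage_constant) (simp add: hol_on_def)
    qed auto
    moreover have "(\<Inter>js. {x \<in> U. foldr pd js f x = 0}) = Z" by (auto simp: Z_def)
    ultimately show ?thesis by simp
  qed
  ultimately have "Z = {} \<or> Z = U" using U(1) connected_clopen by blast
  moreover have "p \<in> Z" using U z by (simp add: Z_def)
  ultimately have "x \<in> Z" using U by auto
  then have "foldr pd [] f x = 0" unfolding Z_def by blast
  then show ?thesis by simp
qed

section \<open>Exponential generating functions\<close>

text \<open>Divided powers: differentiation merely lowers the index.\<close>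

definition dpw :: "complex \<Rightarrow> nat \<Rightarrow> complex" where "dpw z n = z ^ n / fact n"

definition homog :: "(complex poly poly \<Rightarrow> complex) \<Rightarrow> complex poly poly \<Rightarrow> nat \<Rightarrow> complex \<times> complex \<Rightarrow> complex" where
  "homog l w k t = (\<Sum>a\<le>k. l (XX ^ a * YY ^ (k - a) * w) * (dpw (fst t) a * dpw (snd t) (k - a)))"

text \<open>Formally, l applied to w exp(t1 X + t2 Y).\<close>
definition egf :: "(complex poly poly \<Rightarrow> complex) \<Rightarrow> complex poly poly \<Rightarrow> complex \<times> complex \<Rightarrow> complex" where
  "egf l w t = (\<Sum>k. homog l w k t)"

text \<open>The bound is asked for every multiple w because differentiating \<open>egf\<close>
  multiplies w by X or Y; the offset m makes room for the degree of w.\<close>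

definition growth :: "real \<Rightarrow> (complex poly poly \<Rightarrow> complex) \<Rightarrow> bool" where
  "growth R l \<longleftrightarrow> bilin l \<and> (\<forall>w. \<exists>K m. \<forall>a b. norm (l (XX ^ a * YY ^ b * w)) \<le> K * fact (a + b + m) * R ^ (a + b))"

lemma growthI:
  assumes l: "bilin l" and R: "R \<ge> 1" and K: "\<And>a b. norm (l (XX ^ a * YY ^ b)) \<le> K * fact (a + b) * R ^ (a + b)"
  shows "growth R l"
  unfolding growth_def
proof (intro conjI allI l)
  fix w
  obtain m where "w \<in> deg_lt m" using in_some_deg_lt by blast
  then obtain C where C: "C \<ge> 0" "\<And>a b B. (\<And>i j. i + j < m \<Longrightarrow> norm (l (XX ^ (a + i) * YY ^ (b + j))) \<le> B)
    \<Longrightarrow> norm (l (XX ^ a * YY ^ b * w)) \<le> C * B" using bilin_monomial_multiple_bound l by metis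
  have K0: "K \<ge> 0" using order.trans[OF norm_ge_zero K[of 0 0]] by simp
  have "norm (l (XX ^ a * YY ^ b * w)) \<le> C * (K * fact (a + b + m) * R ^ (a + b + m))" for a b
  proof (rule C(2))
    fix i j :: nat assume "i + j < m"
    then have "K * fact (a + i + (b + j)) * R ^ (a + i + (b + j)) \<le> K * fact (a + b + m) * R ^ (a + b + m)"
      using K0 R by (intro mult_mono fact_mono power_increasing) auto
    with K[of "a + i" "b + j"] show "norm (l (XX ^ (a + i) * YY ^ (b + j))) \<le> K * fact (a + b + m) * R ^ (a + b + m)"
      by simp
  qed
  then show "\<exists>K m. \<forall>a b. norm (l (XX ^ a * YY ^ b * w)) \<le> K * fact (a + b + m) * R ^ (a + b)"
    by (intro exI[of _ "C * K * R ^ m"] exI[of _ m]) (simp add: power_add mult_ac)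
qed

text \<open>The radius 1 / (8 R) is what the crude estimates need: (k + m)! is at most m! k! 2^(k +
  m), the reciprocals of a! (k - a)! sum to 2^k / k!, and 2 * 2 / 8 = 1 / 2.\<close>

lemma homog_bound:
  assumes g: "growth R l" and R: "R \<ge> 1"
  obtains M where "\<And>k t. norm (fst t) \<le> 1 / (8 * R) \<Longrightarrow> norm (snd t) \<le> 1 / (8 * R) \<Longrightarrow> norm (homog l w k t) \<le> M * (1/2) ^ k"
proof -
  obtain K m where K: "\<And>a b. norm (l (XX ^ a * YY ^ b * w)) \<le> K * fact (a + b + m) * R ^ (a + b)"
    using g unfolding growth_def by blast
  have K0: "K \<ge> 0"
  proof (rule ccontr)
    assume "\<not> K \<ge> 0"
    then have "K * fact m < 0" by (intro mult_neg_pos) auto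
    then show False using order.trans[OF norm_ge_zero K[of 0 0]] by simp
  qed
  show thesis
  proof (rule that[of "K * fact m * 2 ^ m"])
    fix k and t :: "complex \<times> complex" assume t: "norm (fst t) \<le> 1 / (8 * R)" "norm (snd t) \<le> 1 / (8 * R)"
    let ?q = "1 / (8 * R)"
    have "norm (homog l w k t) \<le> (\<Sum>a\<le>k. K * fact (k + m) * R ^ k * (?q ^ k / (fact a * fact (k - a))))"
      unfolding homog_def
    proof (intro sum_norm_le)
      fix a assume a: "a \<in> {..k}"
      have "norm (dpw (fst t) a * dpw (snd t) (k - a)) = norm (fst t) ^ a * norm (snd t) ^ (k - a) / (fact a * fact (k - a))"
        by (simp add: dpw_def norm_mult norm_divide norm_power)
      also have "\<dots> \<le> ?q ^ a * ?q ^ (k - a) / (fact a * fact (k - a))"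
        using t R by (intro divide_right_mono mult_mono power_mono) auto
      also have "?q ^ a * ?q ^ (k - a) = ?q ^ k" using a by (simp flip: power_add)
      finally show "norm (l (XX ^ a * YY ^ (k - a) * w) * (dpw (fst t) a * dpw (snd t) (k - a)))
        \<le> K * fact (k + m) * R ^ k * (?q ^ k / (fact a * fact (k - a)))"
        using K[of a "k - a"] a K0 R unfolding norm_mult[of "l _"] by (intro mult_mono) auto
    qed
    also have "\<dots> = K * fact (k + m) * (R * ?q) ^ k * (\<Sum>a\<le>k. 1 / (fact a * fact (k - a)))"
      unfolding sum_distrib_left by (intro sum.cong refl) (simp add: power_mult_distrib power_divide)
    also have "(\<Sum>a\<le>k. 1 / (fact a * fact (k - a))) = (2::real) ^ k / fact k"
    proof -
      have "(\<Sum>a\<le>k. 1 / (fact a * fact (k - a))) = (\<Sum>a\<le>k. real (k choose a) / fact k)"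
        by (intro sum.cong refl) (simp add: binomial_fact)
      also have "\<dots> = 2 ^ k / fact k"
        by (simp flip: sum_divide_distrib of_nat_sum add: choose_row_sum)
      finally show ?thesis .
    qed
    also have "R * ?q = 1 / 8" using R by simp
    also have "K * fact (k + m) * (1/8) ^ k * (2 ^ k / fact k) \<le> K * (fact m * fact k * 2 ^ (k + m)) * (1/8) ^ k * (2 ^ k / fact k)"
    proof (intro mult_right_mono mult_left_mono K0)
      have "fact m * fact (k + m - m) * (k + m choose m) = (fact (k + m) :: nat)" by (rule binomial_fact_lemma) simp
      then have "fact (k + m) \<le> fact m * fact k * (2::nat) ^ (k + m)"
        using binomial_le_pow2[of "k + m" m] by (metis add_diff_cancel_right' mult_le_mono2)
      then have "real (fact (k + m)) \<le> real (fact m * fact k * 2 ^ (k + m))" by (rule of_nat_mono)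
      then show "fact (k + m) \<le> fact m * fact k * (2::real) ^ (k + m)" by simp
    qed auto
    also have "\<dots> = K * fact m * 2 ^ m * (2 * (1/8) * 2) ^ k"
      by (simp add: power_add power_mult_distrib[symmetric] field_simps)
    also have "\<dots> = K * fact m * 2 ^ m * (1/2) ^ k" by simp
    finally show "norm (homog l w k t) \<le> K * fact m * 2 ^ m * (1/2) ^ k" .
  qed
qed

lemma homog_summable:
  assumes "growth R l" "R \<ge> 1" "norm (fst t) \<le> 1 / (8 * R)" "norm (snd t) \<le> 1 / (8 * R)"
  shows "summable (\<lambda>k. homog l w k t)"
proof -
  obtain M where M: "\<And>k t. norm (fst t) \<le> 1 / (8 * R) \<Longrightarrow> norm (snd t) \<le> 1 / (8 * R) \<Longrightarrow> norm (homog l w k t) \<le> M * (1/2) ^ k"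
    using homog_bound[OF assms(1,2), where w = w] by metis
  have "summable (\<lambda>k. M * (1/2::real) ^ k)" by (intro summable_mult summable_geometric) simp
  then show ?thesis
    by (rule summable_comparison_test'[where N = 0]) (rule M[OF assms(3,4)])
qed

lemma dpw_has_derivative:
  "((\<lambda>t. dpw (fst t) (Suc n)) has_derivative (\<lambda>d. fst d * dpw (fst t) n)) (at t within S)"
  "((\<lambda>t. dpw (snd t) (Suc n)) has_derivative (\<lambda>d. snd d * dpw (snd t) n)) (at t within S)"
proof -
  have "((\<lambda>z. dpw z (Suc n)) has_field_derivative dpw z n) (at z)" for z
    unfolding dpw_def by (rule DERIV_cong[OF DERIV_cdivide[OF DERIV_power[OF DERIV_ident]]]) (simp del: of_nat_Suc)
  note der = this
  have D: "((\<lambda>z. dpw z (Suc n)) has_derivative (\<lambda>d. d * dpw z n)) (at z)" for z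
  proof -
    have "(*) (dpw z n) = (\<lambda>d. d * dpw z n)" by (simp add: fun_eq_iff)
    then show ?thesis using der[of z] by (simp add: has_field_derivative_def)
  qed
  show "((\<lambda>t. dpw (fst t) (Suc n)) has_derivative (\<lambda>d. fst d * dpw (fst t) n)) (at t within S)"
    by (rule has_derivative_compose[OF has_derivative_fst[OF has_derivative_ident] D])
  show "((\<lambda>t. dpw (snd t) (Suc n)) has_derivative (\<lambda>d. snd d * dpw (snd t) n)) (at t within S)"
    by (rule has_derivative_compose[OF has_derivative_snd[OF has_derivative_ident] D])
qed

lemma homog_Suc_has_derivative:
  "(homog l w (Suc k) has_derivative (\<lambda>d. fst d * homog l (XX * w) k t + snd d * homog l (YY * w) k t)) (at t within S)"
proof -
  define c where "c a = l (XX ^ a * YY ^ (Suc k - a) * w)" for a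
  define p where "p z n = (case n of 0 \<Rightarrow> 0 | Suc m \<Rightarrow> dpw z m)" for z n
  have 1: "((\<lambda>t. dpw (fst t) n) has_derivative (\<lambda>d. fst d * p (fst t) n)) (at t within S)" for n
    by (cases n) (auto simp: p_def dpw_has_derivative, simp add: dpw_def)
  have 2: "((\<lambda>t. dpw (snd t) n) has_derivative (\<lambda>d. snd d * p (snd t) n)) (at t within S)" for n
    by (cases n) (auto simp: p_def dpw_has_derivative, simp add: dpw_def)
  have "((\<lambda>t. \<Sum>a\<le>Suc k. c a * (dpw (fst t) a * dpw (snd t) (Suc k - a))) has_derivative
     (\<lambda>d. \<Sum>a\<le>Suc k. c a * (dpw (fst t) a * (snd d * p (snd t) (Suc k - a)) + fst d * p (fst t) a * dpw (snd t) (Suc k - a)))) (at t within S)"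
    by (intro has_derivative_sum has_derivative_mult_right has_derivative_mult 1 2)
  moreover have "(\<Sum>a\<le>Suc k. c a * (dpw (fst t) a * (snd d * p (snd t) (Suc k - a)) + fst d * p (fst t) a * dpw (snd t) (Suc k - a)))
    = fst d * homog l (XX * w) k t + snd d * homog l (YY * w) k t" for d
  proof -
    have "(\<Sum>a\<le>Suc k. c a * (p (fst t) a * dpw (snd t) (Suc k - a))) = homog l (XX * w) k t"
      unfolding homog_def
      by (subst sum.atMost_Suc_shift) (auto simp: p_def c_def mult_ac intro!: sum.cong)
    moreover have "(\<Sum>a\<le>Suc k. c a * (dpw (fst t) a * p (snd t) (Suc k - a))) = homog l (YY * w) k t"
      unfolding homog_def
      by (subst sum.atMost_Suc) (auto simp: p_def c_def mult_ac Suc_diff_le intro!: sum.cong)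
    moreover have "(\<Sum>a\<le>Suc k. c a * (dpw (fst t) a * (snd d * p (snd t) (Suc k - a)) + fst d * p (fst t) a * dpw (snd t) (Suc k - a)))
      = fst d * (\<Sum>a\<le>Suc k. c a * (p (fst t) a * dpw (snd t) (Suc k - a))) + snd d * (\<Sum>a\<le>Suc k. c a * (dpw (fst t) a * p (snd t) (Suc k - a)))"
      unfolding sum_distrib_left sum.distrib[symmetric] by (intro sum.cong refl) (simp add: algebra_simps)
    ultimately show ?thesis by simp
  qed
  moreover have "homog l w (Suc k) = (\<lambda>t. \<Sum>a\<le>Suc k. c a * (dpw (fst t) a * dpw (snd t) (Suc k - a)))"
    by (simp add: fun_eq_iff homog_def c_def del: sum.atMost_Suc)
  ultimately show ?thesis by (simp only:)
qed

text \<open>Termwise differentiation: the part of degree k + 1 differentiates to the parts of degree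
  k for X w and Y w, and these two series converge uniformly on a bidisc.\<close>

lemma egf_has_derivative:
  assumes g: "growth R l" and R: "R \<ge> 1" and t: "norm (fst t) < 1 / (8 * R)" "norm (snd t) < 1 / (8 * R)"
  shows "(egf l w has_derivative (\<lambda>d. fst d * egf l (XX * w) t + snd d * egf l (YY * w) t)) (at t)"
proof -
  define q where "q = 1 / (8 * R)"
  define S where "S = ball (0::complex) q \<times> ball (0::complex) q"
  have S: "convex S" "open S" "t \<in> S" using t by (auto simp: S_def q_def convex_Times open_Times mem_Times_iff)
  have inS: "norm (fst x) \<le> q" "norm (snd x) \<le> q" if "x \<in> S" for x using that by (auto simp: S_def)
  have sums: "(\<lambda>k. homog l w k x) sums egf l w x" if "x \<in> S" for w x
  proof -
    have "summable (\<lambda>k. homog l w k x)"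
      by (rule homog_summable[OF g R]) (use inS[OF that] in \<open>auto simp: q_def\<close>)
    then show ?thesis unfolding egf_def by (rule summable_sums)
  qed
  have unif: "uniform_limit S (\<lambda>n x. \<Sum>k<n. homog l w k x) (egf l w) sequentially" for w
  proof -
    obtain M where M: "\<And>k t. norm (fst t) \<le> q \<Longrightarrow> norm (snd t) \<le> q \<Longrightarrow> norm (homog l w k t) \<le> M * (1/2) ^ k"
      using homog_bound[OF g R, where w = w] unfolding q_def by metis
    have "uniform_limit S (\<lambda>n x. \<Sum>k<n. homog l w k x) (\<lambda>x. \<Sum>k. homog l w k x) sequentially"
      by (rule Weierstrass_m_test[where M = "\<lambda>k. M * (1/2) ^ k"]) (use inS in \<open>auto intro!: M summable_mult summable_geometric\<close>)
    then show ?thesis by (simp add: egf_def[abs_def])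
  qed
  \<comment> \<open>The constant term has derivative 0, so the partial sums of the derivatives lag
    by one; hence \<open>Suc n\<close> in the estimate below.\<close>
  define f' where "f' k x d = (case k of 0 \<Rightarrow> 0 | Suc k \<Rightarrow> fst d * homog l (XX * w) k x + snd d * homog l (YY * w) k x)" for k and x d :: "complex \<times> complex"
  have "\<exists>g. \<forall>x\<in>S. (\<lambda>k. homog l w k x) sums g x \<and> (g has_derivative (\<lambda>d. fst d * egf l (XX * w) x + snd d * egf l (YY * w) x)) (at x within S)"
  proof (rule has_derivative_series[where f = "homog l w" and f' = f' and x = t and l = "egf l w t"])
    show "convex S" "t \<in> S" "(\<lambda>k. homog l w k t) sums egf l w t" using S sums by auto
  next
    fix k x assume "x \<in> S"
    show "(homog l w k has_derivative f' k x) (at x within S)"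
    proof (cases k)
      case 0
      have "homog l w 0 = (\<lambda>t. l w)" by (simp add: homog_def dpw_def fun_eq_iff)
      moreover have "f' 0 x = (\<lambda>d. 0)" by (simp add: f'_def fun_eq_iff)
      ultimately show ?thesis by (simp add: 0)
    next
      case (Suc k)
      moreover have "f' (Suc k) x = (\<lambda>d. fst d * homog l (XX * w) k x + snd d * homog l (YY * w) k x)"
        by (simp add: f'_def fun_eq_iff)
      ultimately show ?thesis using homog_Suc_has_derivative[of l w k x S] by simp
    qed
  next
    fix e :: real assume e: "e > 0"
    have sf: "(\<Sum>i<Suc n. f' i x d) = fst d * (\<Sum>k<n. homog l (XX * w) k x) + snd d * (\<Sum>k<n. homog l (YY * w) k x)" for n x d
      by (subst sum.lessThan_Suc_shift) (simp add: f'_def sum.distrib sum_distrib_left)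
    have "\<forall>\<^sub>F n in sequentially. \<forall>x\<in>S. dist (\<Sum>k<n. homog l (XX * w) k x) (egf l (XX * w) x) < e / 2"
      "\<forall>\<^sub>F n in sequentially. \<forall>x\<in>S. dist (\<Sum>k<n. homog l (YY * w) k x) (egf l (YY * w) x) < e / 2"
      by (intro uniform_limitD unif half_gt_zero e)+
    then have "\<forall>\<^sub>F n in sequentially. \<forall>x\<in>S. \<forall>h. norm ((\<Sum>i<Suc n. f' i x h) - (fst h * egf l (XX * w) x + snd h * egf l (YY * w) x)) \<le> e * norm h"
    proof eventually_elim
      case (elim n)
      show ?case
      proof (intro ballI allI)
        fix x h assume x: "x \<in> S"
        let ?A = "(\<Sum>k<n. homog l (XX * w) k x) - egf l (XX * w) x" let ?B = "(\<Sum>k<n. homog l (YY * w) k x) - egf l (YY * w) x"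
        have "(\<Sum>i<Suc n. f' i x h) - (fst h * egf l (XX * w) x + snd h * egf l (YY * w) x) = fst h * ?A + snd h * ?B"
          unfolding sf by (simp add: algebra_simps)
        also have "norm \<dots> \<le> norm (fst h) * norm ?A + norm (snd h) * norm ?B"
          by (intro norm_triangle_le) (simp add: norm_mult)
        also have "\<dots> \<le> norm h * (e / 2) + norm h * (e / 2)"
          using elim x norm_fst_le[of "fst h" "snd h"] norm_snd_le[of "snd h" "fst h"]
          by (intro add_mono mult_mono) (auto simp: dist_norm less_imp_le)
        finally show "norm ((\<Sum>i<Suc n. f' i x h) - (fst h * egf l (XX * w) x + snd h * egf l (YY * w) x)) \<le> e * norm h" by simp
      qed
    qed
    then show "\<forall>\<^sub>F n in sequentially. \<forall>x\<in>S. \<forall>h. norm ((\<Sum>i<n. f' i x h) - (fst h * egf l (XX * w) x + snd h * egf l (YY * w) x)) \<le> e * norm h"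
      by (subst eventually_sequentially_Suc[symmetric])
  qed
  then obtain G where G: "\<And>x. x \<in> S \<Longrightarrow> (\<lambda>k. homog l w k x) sums G x"
    "\<And>x. x \<in> S \<Longrightarrow> (G has_derivative (\<lambda>d. fst d * egf l (XX * w) x + snd d * egf l (YY * w) x)) (at x within S)" by blast
  have "G x = egf l w x" if "x \<in> S" for x using sums_unique2[OF G(1) sums] that by blast
  then have "(egf l w has_derivative (\<lambda>d. fst d * egf l (XX * w) t + snd d * egf l (YY * w) t)) (at t within S)"
    by (intro has_derivative_transform[OF S(3) _ G(2)[OF S(3)]]) auto
  then show ?thesis by (simp add: at_within_open[OF S(3,2)])
qed

lemma egf_0: "egf l w 0 = l w"
proof -
  have "homog l w k 0 = (if k = 0 then l w else 0)" for k
    by (auto simp: homog_def dpw_def zero_prod_def power_0_left intro!: sum.neutral)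
  then have "egf l w 0 = (\<Sum>k. if k = 0 then l w else 0)" by (simp add: egf_def)
  also have "\<dots> = l w" using sums_single[of 0 "\<lambda>_. l w"] by (metis (no_types, lifting) sums_unique)
  finally show ?thesis .
qed

lemma egf_linear:
  assumes g: "growth R l" and R: "R \<ge> 1" and t: "norm (fst t) < 1 / (8 * R)" "norm (snd t) < 1 / (8 * R)"
  shows "egf l (u + v) t = egf l u t + egf l v t" "egf l (cst a * u) t = a * egf l u t"
proof -
  have bl: "bilin l" using g by (simp add: growth_def)
  have s: "summable (\<lambda>k. homog l w k t)" for w
    by (rule homog_summable[OF g R]) (use t in auto)
  have "homog l (u + v) k t = homog l u k t + homog l v k t" for k
    by (simp add: homog_def bilinD[OF bl] distrib_left distrib_right sum.distrib)
  then show "egf l (u + v) t = egf l u t + egf l v t" unfolding egf_def by (simp add: suminf_add s)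
  have "l (XX ^ i * YY ^ j * (cst a * u)) = a * l (XX ^ i * YY ^ j * u)" for i j
    using bilinD(2)[OF bl, of a "XX ^ i * YY ^ j * u"] by (simp add: mult_ac)
  then have "homog l (cst a * u) k t = a * homog l u k t" for k
    by (simp add: homog_def sum_distrib_left mult_ac)
  then show "egf l (cst a * u) t = a * egf l u t" unfolding egf_def by (simp add: suminf_mult s)
qed

section \<open>Functions indexed by polynomials\<close>

definition zmon :: "('n::finite \<Rightarrow> int) \<Rightarrow> complex^'n \<Rightarrow> complex" where
  "zmon b x = (\<Prod>i\<in>UNIV. (x $ i) powi b i)"

lemma zmon_0 [simp]: "zmon (\<lambda>_. 0) x = 1" by (simp add: zmon_def)

lemma zmon_add:
  fixes x :: "complex^'n"
  assumes "\<And>i. x $ i \<noteq> 0"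
  shows "zmon (\<lambda>i. a i + b i) x = zmon a x * zmon b x"
  by (simp add: zmon_def power_int_add assms prod.distrib)

lemma zmon_nz: fixes x :: "complex^'n" shows "(\<And>i. x $ i \<noteq> 0) \<Longrightarrow> zmon b x \<noteq> 0"
  by (simp add: zmon_def power_int_eq_0_iff)

lemma zmon_single: "zmon (\<lambda>i. if i = j then m else 0) x = (x $ j) powi m"
proof -
  have "zmon (\<lambda>i. if i = j then m else 0) x = (\<Prod>i\<in>UNIV. if i = j then (x $ j) powi m else 1)"
    unfolding zmon_def by (intro prod.cong) auto
  then show ?thesis by simp
qed

lemma zmon_upd:
  fixes x :: "complex^'n"
  assumes "\<And>i. x $ i \<noteq> 0"
  shows "zmon (b(j := b j - 1)) x = zmon b x / x $ j"
proof -
  have "b(j := b j - 1) = (\<lambda>i. b i + (if i = j then -1 else 0))" by (auto simp: fun_eq_iff)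
  then show ?thesis using zmon_add[OF assms, where a = b and b = "\<lambda>i. if i = j then -1 else 0"]
    by (simp add: zmon_single divide_inverse)
qed

lemma zmon_has_derivative:
  fixes x :: "complex^'n"
  assumes "\<And>i. x $ i \<noteq> 0"
  shows "((\<lambda>z. zmon b (upd x j z)) has_field_derivative of_int (b j) * zmon b x / x $ j) (at (x $ j))"
proof -
  define M where "M = (\<Prod>i\<in>UNIV - {j}. (x $ i) powi b i)"
  have eq: "zmon b (upd x j z) = z powi b j * M" for z
    unfolding zmon_def M_def by (subst prod.remove[of _ j]) (auto intro!: prod.cong)
  have "((\<lambda>z. z powi b j * M) has_field_derivative (of_int (b j) * (x $ j) powi (b j - 1) * 1) * M) (at (x $ j))"
    by (intro DERIV_cmult_right DERIV_power_int DERIV_ident) (simp add: assms)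
  moreover have "(x $ j) powi (b j - 1) = (x $ j) powi b j / x $ j"
    using assms[of j] by (simp add: power_int_diff)
  ultimately show ?thesis using eq[of "x $ j"] by (simp add: eq mult.assoc)
qed

lemma zmon_hol:
  fixes U :: "(complex^'n) set"
  assumes U: "open U" "\<And>x i. x \<in> U \<Longrightarrow> x $ i \<noteq> 0"
  shows "hol_on U (zmon b)"
proof (rule hol_onI[OF U(1)])
  show "continuous_on U (zmon b)" unfolding zmon_def
    by (intro continuous_on_prod continuous_on_power_int continuous_on_component continuous_on_id) (use U in auto)
  show "((\<lambda>z. zmon b (upd x j z)) has_field_derivative of_int (b j) * zmon b x / x $ j) (at (x $ j))" if "x \<in> U" for x j
    by (rule zmon_has_derivative) (use U that in auto)
qed

lemma pd_zmon_mult: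
  fixes U :: "(complex^'n) set"
  assumes U: "open U" "\<And>x i. x \<in> U \<Longrightarrow> x $ i \<noteq> 0" and f: "hol_on U f" and x: "x \<in> U"
  shows "x $ j * pd j (\<lambda>x. zmon b x * f x) x = zmon b x * (of_int (b j) * f x + x $ j * pd j f x)"
proof -
  have "pd j (zmon b) x = of_int (b j) * zmon b x / x $ j"
    by (rule pd_eqI[OF zmon_has_derivative]) (use U x in auto)
  then show ?thesis using pd_mult[OF zmon_hol[OF U] f x, of j b] U(2)[OF x, of j]
    by (simp add: field_simps)
qed

section \<open>Families closed under the Euler operators\<close>

text \<open>Falling factorials, as in x^n (d/dx)^n = u (u - 1) ... (u - n + 1) with u = x
  d/dx.\<close>

definition ffp :: "complex poly poly \<Rightarrow> nat \<Rightarrow> complex poly poly" where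
  "ffp u n = (\<Prod>r<n. u - of_nat r)"

text \<open>The vectors s1, s2 form a left inverse of the matrix with columns b1, b2; they recover
  D1 and D2 from the operators x_j d/dx_j - c_j.\<close>

locale horn_operators =
  fixes b1 b2 :: "('n::{finite,linorder}) \<Rightarrow> int" and c :: "complex^('n::{finite,linorder})" and s1 s2 :: "('n::{finite,linorder}) \<Rightarrow> complex"
  assumes dual: "(\<Sum>j\<in>UNIV. s1 j * of_int (b1 j)) = 1" "(\<Sum>j\<in>UNIV. s1 j * of_int (b2 j)) = 0"
      "(\<Sum>j\<in>UNIV. s2 j * of_int (b1 j)) = 0" "(\<Sum>j\<in>UNIV. s2 j * of_int (b2 j)) = 1"
begin

definition LL :: "'n \<Rightarrow> complex poly poly" where
  "LL j = cst (c $ j) + cst (of_int (b1 j)) * XX + cst (of_int (b2 j)) * YY"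

text \<open>The family h represents a function f = h 1 through h w = w(D1, D2) f, where the operators D1, D2
  are determined by x_j d/dx_j = c_j + b1_j D1 + b2_j D2 on f.\<close>
definition theta_family :: "(complex^('n::{finite,linorder})) set \<Rightarrow> (complex poly poly \<Rightarrow> complex^('n::{finite,linorder}) \<Rightarrow> complex) \<Rightarrow> bool" where
  "theta_family U h \<longleftrightarrow> open U \<and> (\<forall>x\<in>U. \<forall>j. x $ j \<noteq> 0) \<and> (\<forall>w. hol_on U (h w)) \<and>
     (\<forall>x\<in>U. bilin (\<lambda>w. h w x)) \<and> (\<forall>w. \<forall>x\<in>U. \<forall>j. x $ j * pd j (h w) x = h (LL j * w) x)"

lemma theta_familyD:
  fixes U :: "(complex^('n::{finite,linorder})) set"
  assumes "theta_family U h"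
  shows "open U" "x \<in> U \<Longrightarrow> x $ j \<noteq> 0" "hol_on U (h w)" "x \<in> U \<Longrightarrow> bilin (\<lambda>w. h w x)"
    "x \<in> U \<Longrightarrow> x $ j * pd j (h w) x = h (LL j * w) x"
  using assms unfolding theta_family_def by auto

lemma theta_family_pd_zmon:
  assumes h: "theta_family U h" and x: "x \<in> U"
  shows "x $ j * pd j (\<lambda>x. zmon b x * h w x) x = zmon b x * h ((LL j + cst (of_int (b j))) * w) x"
proof -
  have "x $ j * pd j (\<lambda>x. zmon b x * h w x) x = zmon b x * (of_int (b j) * h w x + h (LL j * w) x)"
    using pd_zmon_mult[OF theta_familyD(1)[OF h] theta_familyD(2)[OF h] theta_familyD(3)[OF h] x] theta_familyD(5)[OF h x] by simp
  then show ?thesis using bilinD(1,2)[OF theta_familyD(4)[OF h x]] by (simp add: distrib_right)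
qed

lemma theta_family_pd_zmon':
  assumes h: "theta_family U h" and x: "x \<in> U"
  shows "pd j (\<lambda>x. zmon b x * h w x) x = zmon (b(j := b j - 1)) x * h ((LL j + cst (of_int (b j))) * w) x"
proof -
  have "zmon (b(j := b j - 1)) x = zmon b x / x $ j" by (rule zmon_upd) (rule theta_familyD(2)[OF h x])
  moreover have "pd j (\<lambda>x. zmon b x * h w x) x = x $ j * pd j (\<lambda>x. zmon b x * h w x) x / x $ j"
    using theta_familyD(2)[OF h x, of j] by simp
  ultimately show ?thesis unfolding theta_family_pd_zmon[OF h x] by simp
qed

text \<open>Products of a Laurent monomial with a member of the family are closed under partial
  derivatives. So every Taylor coefficient of a member at p is a multiple of some value
  \<open>h w' p\<close>, and the functional at p determines the family.\<close>

lemma theta_family_foldr_pd: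
  assumes h: "theta_family U h"
  shows "\<exists>u w'. \<forall>x\<in>U. foldr pd js (h w) x = zmon u x * h w' x"
proof (induction js)
  case Nil
  show ?case by (intro exI[of _ "\<lambda>_. 0"] exI[of _ w]) simp
next
  case (Cons j js)
  then obtain u w' where uw: "\<And>x. x \<in> U \<Longrightarrow> foldr pd js (h w) x = zmon u x * h w' x" by blast
  have "foldr pd (j # js) (h w) x = zmon (u(j := u j - 1)) x * h ((LL j + cst (of_int (u j))) * w') x" if x: "x \<in> U" for x
    using pd_cong[OF theta_familyD(1)[OF h] x uw, where j = j] theta_family_pd_zmon'[OF h x, where j = j and b = u and w = w'] by simp
  then show ?case by blast
qed

lemma theta_family_zero:
  assumes h: "theta_family U h" and U: "connected U" "p \<in> U" "x \<in> U" and z: "\<And>w. h w p = 0"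
  shows "h w x = 0"
proof (rule hol_on_identity[OF theta_familyD(3)[OF h] U])
  fix js
  obtain u w' where "\<forall>x\<in>U. foldr pd js (h w) x = zmon u x * h w' x" using theta_family_foldr_pd[OF h] by blast
  then show "foldr pd js (h w) p = 0" using z U(2) by simp
qed

lemma LL_dual: "(\<Sum>j\<in>UNIV. cst (s1 j) * (LL j - cst (c $ j))) = XX" "(\<Sum>j\<in>UNIV. cst (s2 j) * (LL j - cst (c $ j))) = YY"
proof -
  have "(\<Sum>j\<in>UNIV. cst (s j) * (LL j - cst (c $ j))) = cst (\<Sum>j\<in>UNIV. s j * of_int (b1 j)) * XX + cst (\<Sum>j\<in>UNIV. s j * of_int (b2 j)) * YY" for s
  proof -
    have "LL j - cst (c $ j) = cst (of_int (b1 j)) * XX + cst (of_int (b2 j)) * YY" for j by (simp add: LL_def)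
    then show ?thesis by (simp only: cst_sum cst_simps sum_distrib_right distrib_left sum.distrib mult.assoc)
  qed
  then show "(\<Sum>j\<in>UNIV. cst (s1 j) * (LL j - cst (c $ j))) = XX" "(\<Sum>j\<in>UNIV. cst (s2 j) * (LL j - cst (c $ j))) = YY"
    using dual by simp_all
qed

text \<open>If \<open>h w\<close> vanishes on U, so do its partials and hence each
  \<open>h (LL j * w)\<close>; X and Y are linear combinations of the L_j - c_j.\<close>

lemma theta_family_mult_var:
  assumes h: "theta_family U h" and z: "\<And>x. x \<in> U \<Longrightarrow> h w x = 0" and x: "x \<in> U"
  shows "h (XX * w) x = 0" "h (YY * w) x = 0"
proof -
  have "pd j (h w) x = 0" for j
    using pd_cong[OF theta_familyD(1)[OF h] x, where f = "h w" and g = "\<lambda>_. 0" and j = j] z by simp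
  then have L: "h (LL j * w) x = 0" for j using theta_familyD(5)[OF h x, of j w] by simp
  note bl = theta_familyD(4)[OF h x]
  have "h ((\<Sum>j\<in>UNIV. cst (s j) * (LL j - cst (c $ j))) * w) x = 0" for s
  proof -
    have "(\<Sum>j\<in>UNIV. cst (s j) * (LL j - cst (c $ j))) * w = (\<Sum>j\<in>UNIV. cst (s j) * (LL j * w - cst (c $ j) * w))"
      by (simp add: sum_distrib_right left_diff_distrib mult.assoc)
    then show ?thesis using bilinD[OF bl] L z[OF x] by (simp add: bilin_sum[OF bl])
  qed
  then show "h (XX * w) x = 0" "h (YY * w) x = 0" using LL_dual by metis+
qed

text \<open>The companion of \<open>theta_family_zero\<close>: the function \<open>h 1\<close> on U
  determines the family just as the functional at p does.\<close>

lemma theta_family_zero_of_one: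
  assumes h: "theta_family U h" and z: "\<And>x. x \<in> U \<Longrightarrow> h 1 x = 0" and x: "x \<in> U"
  shows "h w x = 0"
proof -
  have Y: "\<forall>x\<in>U. h (YY ^ j) x = 0" for j
    by (induction j) (use z theta_family_mult_var(2)[OF h] in auto)
  have XY: "\<forall>x\<in>U. h (XX ^ i * YY ^ j) x = 0" for i j
    by (induction i) (use Y theta_family_mult_var(1)[OF h] in \<open>auto simp: mult.assoc\<close>)
  show ?thesis
    by (induction w rule: bipoly_induct) (use XY x bilinD[OF theta_familyD(4)[OF h x]] in auto)
qed

text \<open>Each coordinate is differentiated in one block. After m derivatives the accumulated
  factor is x_j^(-m), so the next one contributes L_j - m.\<close>

lemma theta_family_dpow:
  assumes h: "theta_family U h" and x: "x \<in> U"
  shows "dpow u (h w) x = zmon (\<lambda>i. - int (u i)) x * h ((\<Prod>j\<in>UNIV. ffp (LL j) (u j)) * w) x"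
proof -
  have "\<forall>x\<in>U. foldr (\<lambda>j g. (pd j ^^ u j) g) js (h w) x
     = zmon (\<lambda>i. if i \<in> set js then - int (u i) else 0) x * h ((\<Prod>j\<in>set js. ffp (LL j) (u j)) * w) x"
    if "distinct js" for js using that
  proof (induction js)
    case (Cons j js)
    define g where "g = foldr (\<lambda>j g. (pd j ^^ u j) g) js (h w)"
    define v where "v = (\<lambda>i. if i \<in> set js then - int (u i) else 0)"
    define W where "W = (\<Prod>j\<in>set js. ffp (LL j) (u j)) * w"
    have j: "j \<notin> set js" using Cons.prems by simp
    have "\<forall>x\<in>U. (pd j ^^ m) g x = zmon (v(j := - int m)) x * h (ffp (LL j) m * W) x" for m
    proof (induction m)
      case 0
      have "v(j := 0) = v" using j by (auto simp: v_def)
      then show ?case using Cons by (simp add: g_def v_def W_def ffp_def)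
    next
      case (Suc m)
      show ?case
      proof
        fix x assume x: "x \<in> U"
        have "(pd j ^^ Suc m) g x = pd j ((pd j ^^ m) g) x" by simp
        also have "\<dots> = pd j (\<lambda>x. zmon (v(j := - int m)) x * h (ffp (LL j) m * W) x) x"
          by (rule pd_cong[OF theta_familyD(1)[OF h] x]) (use Suc.IH in blast)
        also have "\<dots> = zmon (v(j := - int (Suc m))) x * h ((LL j + cst (- of_nat m)) * (ffp (LL j) m * W)) x"
        proof -
          have e: "(v(j := - int m)) j - 1 = - int (Suc m)" by simp
          show ?thesis
            using theta_family_pd_zmon'[OF h x, where j = j and b = "v(j := - int m)" and w = "ffp (LL j) m * W"]
            unfolding e by simp
        qed
        also have "(LL j + cst (- of_nat m)) * (ffp (LL j) m * W) = ffp (LL j) (Suc m) * W"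
        proof -
          have "ffp (LL j) (Suc m) = ffp (LL j) m * (LL j + cst (- of_nat m))"
            by (simp add: ffp_def of_nat_conv_cst)
          then show ?thesis by (simp only: mult_ac)
        qed
        finally show "(pd j ^^ Suc m) g x = zmon (v(j := - int (Suc m))) x * h (ffp (LL j) (Suc m) * W) x" .
      qed
    qed
    moreover have "v(j := - int (u j)) = (\<lambda>i. if i \<in> set (j # js) then - int (u i) else 0)" by (auto simp: v_def)
    moreover have "ffp (LL j) (u j) * W = (\<Prod>j\<in>set (j # js). ffp (LL j) (u j)) * w" using j by (simp add: W_def mult.assoc)
    ultimately show ?case by (simp add: g_def)
  qed simp
  from this[of "sorted_list_of_set UNIV"] x show ?thesis by (simp add: dpow_def)
qed

definition PP :: "('n \<Rightarrow> int) \<Rightarrow> complex poly poly" where "PP b = (\<Prod>j\<in>UNIV. ffp (LL j) (pospart b j))"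
definition QQ :: "('n \<Rightarrow> int) \<Rightarrow> complex poly poly" where "QQ b = (\<Prod>j\<in>UNIV. ffp (LL j) (negpart b j))"

text \<open>The common factor x^(-b_+) of the two sides cancels.\<close>

lemma theta_family_binomial:
  assumes h: "theta_family U h" and x: "x \<in> U"
  shows "dpow (pospart b) (h 1) x = dpow (negpart b) (h 1) x \<longleftrightarrow> h (PP b) x = zmon b x * h (QQ b) x"
proof -
  have nz: "x $ i \<noteq> 0" for i using theta_familyD(2)[OF h x] .
  have "zmon (\<lambda>i. - int (negpart b i)) x = zmon (\<lambda>i. - int (pospart b i) + b i) x"
    by (intro arg_cong[of _ _ "\<lambda>b. zmon b x"]) (auto simp: negpart_def pospart_def fun_eq_iff)
  then have "zmon (\<lambda>i. - int (negpart b i)) x = zmon (\<lambda>i. - int (pospart b i)) x * zmon b x"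
    using zmon_add[of x "\<lambda>i. - int (pospart b i)" b] nz by simp
  then show ?thesis
    using zmon_nz[of x "\<lambda>i. - int (pospart b i)"] nz
    by (simp add: theta_family_dpow[OF h x] PP_def QQ_def mult.assoc)
qed

lemma shift_LL: "shift 1 0 (LL j) = LL j + cst (of_int (b1 j))" "shift 0 1 (LL j) = LL j + cst (of_int (b2 j))"
  by (simp_all add: LL_def algebra_simps)

text \<open>The product rule on x^b adds b_j to L_j, and that is exactly how
  \<open>shift r s\<close> translates L_j. So the defect of a binomial equation is again such a
  family, and both uniqueness lemmas apply to it.\<close>

lemma theta_family_twist:
  assumes h: "theta_family U h" and sh: "\<And>j. shift r s (LL j) = LL j + cst (of_int (b j))"
  shows "theta_family U (\<lambda>w x. h (P * w) x - zmon b x * h (Q * shift r s w) x)"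
  unfolding theta_family_def
proof (intro conjI ballI allI)
  note D = theta_familyD[OF h]
  show "open U" by (rule D)
  show "x $ j \<noteq> 0" if "x \<in> U" for x j by (rule D(2)[OF that])
  show "hol_on U (\<lambda>x. h (P * w) x - zmon b x * h (Q * shift r s w) x)" for w
    by (intro hol_on_diff hol_on_mult zmon_hol D)
  show "bilin (\<lambda>w. h (P * w) x - zmon b x * h (Q * shift r s w) x)" if "x \<in> U" for x
    using bilinD(1,2)[OF D(4)[OF that]] unfolding bilin_def
    by (auto simp: distrib_left mult.left_commute[of _ "cst _"] right_diff_distrib)
  show "x $ j * pd j (\<lambda>x. h (P * w) x - zmon b x * h (Q * shift r s w) x) x
     = h (P * (LL j * w)) x - zmon b x * h (Q * shift r s (LL j * w)) x" if x: "x \<in> U" for w x j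
  proof -
    have "pd j (\<lambda>x. h (P * w) x - zmon b x * h (Q * shift r s w) x) x = pd j (h (P * w)) x - pd j (\<lambda>x. zmon b x * h (Q * shift r s w) x) x"
      by (rule pd_diff[OF D(3) _ x]) (intro hol_on_mult zmon_hol D)
    then show ?thesis
      using theta_family_pd_zmon[OF h x, where j = j and b = b and w = "Q * shift r s w"] D(5)[OF x, of j "P * w"]
      by (simp add: sh right_diff_distrib mult.left_commute)
  qed
qed

lemma theta_family_lincomb:
  fixes U :: "(complex^('n::{finite,linorder})) set"
  assumes h: "finite I" "open U" "\<And>x j. x \<in> U \<Longrightarrow> x $ j \<noteq> 0" "\<And>i. i \<in> I \<Longrightarrow> theta_family U (h i)"
  shows "theta_family U (\<lambda>w x. \<Sum>i\<in>I. a i * h i w x)"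
  unfolding theta_family_def
proof (intro conjI ballI allI)
  note D = theta_familyD[OF h(4)]
  show "open U" by (rule h)
  show "x $ j \<noteq> 0" if "x \<in> U" for x j by (rule h(3)[OF that])
  show "hol_on U (\<lambda>x. \<Sum>i\<in>I. a i * h i w x)" for w by (intro hol_on_sum hol_on_cmult h(2) D)
  show "bilin (\<lambda>w. \<Sum>i\<in>I. a i * h i w x)" if "x \<in> U" for x
    using bilinD(1,2)[OF D(4)[OF _ that]] unfolding bilin_def
    by (auto simp: distrib_left sum.distrib sum_distrib_left mult.left_commute intro!: sum.cong)
  show "x $ j * pd j (\<lambda>x. \<Sum>i\<in>I. a i * h i w x) x = (\<Sum>i\<in>I. a i * h i (LL j * w) x)" if x: "x \<in> U" for w x j
  proof -
    have "pd j (\<lambda>x. \<Sum>i\<in>I. a i * h i w x) x = (\<Sum>i\<in>I. a i * pd j (h i w) x)"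
      using pd_sum[OF h(1,2) hol_on_cmult[OF D(3)] x] pd_cmult[OF D(3) x] by simp
    then show ?thesis using D(5)[OF _ x] by (simp add: sum_distrib_left mult.left_commute)
  qed
qed

end

section \<open>Construction from functionals and from Euler solutions\<close>

text \<open>For a = b_i this is the coordinate t_i; for a = c its exponential is the branch of
  (x/p)^c with value 1 at p.\<close>

definition lsum :: "('n::finite \<Rightarrow> complex) \<Rightarrow> complex^'n \<Rightarrow> complex^'n \<Rightarrow> complex" where
  "lsum a p x = (\<Sum>i\<in>UNIV. a i * Ln (x $ i / p $ i))"

text \<open>A polydisc on which each x_i / p_i has positive real part, so that the principal
  logarithms are holomorphic.\<close>

definition slit_box :: "complex^'n \<Rightarrow> (complex^'n) set" where
  "slit_box p = {x. \<forall>i. norm (x $ i / p $ i - 1) < 1}"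

lemma slit_boxD:
  assumes "x \<in> slit_box p"
  shows "x $ i / p $ i \<notin> \<real>\<^sub>\<le>\<^sub>0" "x $ i \<noteq> 0" "p $ i \<noteq> 0"
proof -
  have n: "norm (x $ i / p $ i - 1) < 1" using assms by (simp add: slit_box_def)
  then have "Re (x $ i / p $ i) > 0"
    using abs_Re_le_cmod[of "x $ i / p $ i - 1"] by simp
  then show "x $ i / p $ i \<notin> \<real>\<^sub>\<le>\<^sub>0" by (auto simp: complex_nonpos_Reals_iff)
  then show "x $ i \<noteq> 0" "p $ i \<noteq> 0" by auto
qed

lemma lsum_self: "p \<in> slit_box p \<Longrightarrow> lsum a p p = 0"
  using slit_boxD(3)[of p p] by (simp add: lsum_def)

lemma continuous_on_lsum: "continuous_on (slit_box p) (lsum a p)"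
  unfolding lsum_def
  by (intro continuous_on_sum continuous_on_mult continuous_on_const continuous_on_Ln' continuous_on_divide
      continuous_on_component continuous_on_id) (auto dest: slit_boxD(1,3))

lemma lsum_has_derivative:
  assumes x: "x \<in> slit_box p"
  shows "((\<lambda>z. lsum a p (upd x j z)) has_field_derivative a j / x $ j) (at (x $ j))"
proof -
  define M where "M = (\<Sum>i\<in>UNIV - {j}. a i * Ln (x $ i / p $ i))"
  have eq: "lsum a p (upd x j z) = a j * Ln (z / p $ j) + M" for z
    unfolding lsum_def M_def by (subst sum.remove[of _ j]) (auto intro!: sum.cong)
  have "((\<lambda>z. a j * Ln (z / p $ j) + M) has_field_derivative a j / x $ j) (at (x $ j))"
    using slit_boxD[OF x, of j] by (auto intro!: derivative_eq_intros simp: field_simps)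
  then show ?thesis by (simp add: eq)
qed

lemma open_slit_box:
  fixes p :: "complex^'n"
  assumes "\<And>i. p $ i \<noteq> 0"
  shows "open (slit_box p)"
proof -
  have "open {x. norm (x $ i / p $ i - 1) < 1}" for i
    by (intro open_Collect_less continuous_intros) (use assms in auto)
  then have "open (\<Inter>i\<in>UNIV. {x. norm (x $ i / p $ i - 1) < 1})" by (intro open_INT) auto
  moreover have "(\<Inter>i\<in>UNIV. {x. norm (x $ i / p $ i - 1) < 1}) = slit_box p" by (auto simp: slit_box_def)
  ultimately show ?thesis by simp
qed

context horn_operators begin

definition tau1 where "tau1 p x = lsum (\<lambda>j. of_int (b1 j)) p x"
definition tau2 where "tau2 p x = lsum (\<lambda>j. of_int (b2 j)) p x"

definition series_family :: "(complex poly poly \<Rightarrow> complex) \<Rightarrow> complex^('n::{finite,linorder}) \<Rightarrow> complex poly poly \<Rightarrow> complex^('n::{finite,linorder}) \<Rightarrow> complex" where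
  "series_family l p w x = exp (lsum (\<lambda>j. c $ j) p x) * egf l w (tau1 p x, tau2 p x)"

lemma series_family_self: "p \<in> slit_box p \<Longrightarrow> series_family l p w p = l w"
  using egf_0[of l w] by (simp add: series_family_def tau1_def tau2_def lsum_self zero_prod_def)

text \<open>The operator x_j d/dx_j sends t_i to b_ij and multiplies the exponential factor by c_j;
  together with the derivative of \<open>egf\<close> this adds up to L_j.\<close>

lemma series_family_theta:
  assumes g: "growth R l" and R: "R \<ge> 1" and U: "open U" "U \<subseteq> slit_box p"
    and t: "\<And>x. x \<in> U \<Longrightarrow> norm (tau1 p x) < 1 / (8 * R) \<and> norm (tau2 p x) < 1 / (8 * R)"
  shows "theta_family U (series_family l p)"
proof -
  have der: "((\<lambda>z. series_family l p w (upd x j z)) has_field_derivative series_family l p (LL j * w) x / x $ j) (at (x $ j))"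
    if x: "x \<in> U" for x j w
  proof -
    have xs: "x \<in> slit_box p" using U x by auto
    let ?T = "\<lambda>z. (tau1 p (upd x j z), tau2 p (upd x j z))"
    let ?e = "\<lambda>w. egf l w (tau1 p x, tau2 p x)"
    have "((\<lambda>z. tau1 p (upd x j z)) has_derivative (\<lambda>d. of_int (b1 j) / x $ j * d)) (at (x $ j))"
      "((\<lambda>z. tau2 p (upd x j z)) has_derivative (\<lambda>d. of_int (b2 j) / x $ j * d)) (at (x $ j))"
      unfolding tau1_def tau2_def by (rule lsum_has_derivative[OF xs, unfolded has_field_derivative_def])+
    then have T: "(?T has_derivative (\<lambda>d. (of_int (b1 j) / x $ j * d, of_int (b2 j) / x $ j * d))) (at (x $ j))"
      by (rule has_derivative_Pair)
    have "(egf l w has_derivative (\<lambda>d. fst d * ?e (XX * w) + snd d * ?e (YY * w))) (at (?T (x $ j)))"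
      using egf_has_derivative[OF g R, of "(tau1 p x, tau2 p x)" w] t[OF x] by simp
    from has_derivative_compose[OF T this]
    have "((\<lambda>z. egf l w (?T z)) has_derivative (\<lambda>d. (of_int (b1 j) / x $ j * d) * ?e (XX * w) + (of_int (b2 j) / x $ j * d) * ?e (YY * w))) (at (x $ j))"
      by simp
    moreover have "(\<lambda>d. (of_int (b1 j) / x $ j * d) * ?e (XX * w) + (of_int (b2 j) / x $ j * d) * ?e (YY * w))
      = (*) (of_int (b1 j) / x $ j * ?e (XX * w) + of_int (b2 j) / x $ j * ?e (YY * w))"
      by (auto simp: fun_eq_iff algebra_simps)
    ultimately have D: "((\<lambda>z. egf l w (?T z)) has_field_derivative (of_int (b1 j) / x $ j * ?e (XX * w) + of_int (b2 j) / x $ j * ?e (YY * w))) (at (x $ j))"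
      by (simp add: has_field_derivative_def)
    have E: "((\<lambda>z. exp (lsum (\<lambda>j. c $ j) p (upd x j z))) has_field_derivative exp (lsum (\<lambda>j. c $ j) p x) * (c $ j / x $ j)) (at (x $ j))"
      using DERIV_chain'[OF lsum_has_derivative[OF xs, of "\<lambda>j. c $ j" j] DERIV_exp] by (simp add: mult.commute)
    have L: "?e (LL j * w) = c $ j * ?e w + of_int (b1 j) * ?e (XX * w) + of_int (b2 j) * ?e (YY * w)"
      using egf_linear[OF g R, of "(tau1 p x, tau2 p x)"] t[OF x] by (simp add: LL_def distrib_right mult.assoc)
    show ?thesis
      using DERIV_mult'[OF E D] slit_boxD(2)[OF xs, of j]
      unfolding series_family_def L by (simp add: field_simps)
  qed
  have tc: "continuous_on U (tau1 p)" "continuous_on U (tau2 p)" "continuous_on U (lsum (\<lambda>j. c $ j) p)"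
    unfolding tau1_def[abs_def] tau2_def[abs_def] by (rule continuous_on_subset[OF continuous_on_lsum U(2)])+
  have ec: "continuous_on {t. norm (fst t) < 1 / (8 * R) \<and> norm (snd t) < 1 / (8 * R)} (egf l w)" for w
    using egf_has_derivative[OF g R] by (intro continuous_at_imp_continuous_on ballI has_derivative_continuous) auto
  have hol: "hol_on U (series_family l p w)" for w
  proof (rule hol_onI[OF U(1) _ der])
    have "continuous_on U (\<lambda>x. egf l w (tau1 p x, tau2 p x))"
      by (rule continuous_on_compose2[OF ec continuous_on_Pair[OF tc(1,2)]]) (use t in auto)
    then show "continuous_on U (series_family l p w)"
      unfolding series_family_def[abs_def] by (intro continuous_on_mult continuous_on_exp tc)
  qed
  have pd: "x $ j * pd j (series_family l p w) x = series_family l p (LL j * w) x" if x: "x \<in> U" for x j w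
    using pd_eqI[OF der[OF x]] slit_boxD(2)[of x p j] U(2) x by auto
  have bl: "bilin (\<lambda>w. series_family l p w x)" if x: "x \<in> U" for x
    using egf_linear[OF g R, of "(tau1 p x, tau2 p x)"] t[OF x]
    by (simp add: bilin_def series_family_def distrib_left)
  have "x $ j \<noteq> 0" if "x \<in> U" for x j using slit_boxD(2)[of x p j] U(2) that by auto
  then show ?thesis unfolding theta_family_def by (intro conjI ballI allI U hol pd bl)
qed

text \<open>One ball serves all functionals of growth R, because the condition concerns only the
  sizes of \<open>tau1\<close> and \<open>tau2\<close>.\<close>

lemma series_family_radius:
  assumes p: "\<And>i. p $ i \<noteq> 0" and R: "R \<ge> 1"
  obtains \<epsilon> where "\<epsilon> > 0" "\<And>l. growth R l \<Longrightarrow> theta_family (ball p \<epsilon>) (series_family l p)"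
proof -
  have ps: "p \<in> slit_box p" using p by (simp add: slit_box_def)
  note op = open_slit_box[OF p]
  define S where "S b = {x \<in> slit_box p. lsum (\<lambda>j. of_int (b j)) p x \<in> ball 0 (1 / (8 * R))}" for b :: "'n \<Rightarrow> int"
  have S: "open (S b)" "p \<in> S b" for b
  proof -
    have "open (slit_box p \<inter> lsum (\<lambda>j. of_int (b j)) p -` ball 0 (1 / (8 * R)))"
      by (rule continuous_open_preimage[OF continuous_on_lsum op open_ball])
    moreover have "slit_box p \<inter> lsum (\<lambda>j. of_int (b j)) p -` ball 0 (1 / (8 * R)) = S b" by (auto simp: S_def)
    ultimately show "open (S b)" by simp
    show "p \<in> S b" using R ps by (simp add: S_def lsum_self[OF ps])
  qed
  have "open (S b1 \<inter> S b2)" "p \<in> S b1 \<inter> S b2" using S by auto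
  then obtain \<epsilon> where e: "\<epsilon> > 0" "ball p \<epsilon> \<subseteq> S b1 \<inter> S b2" using openE by metis
  have "theta_family (ball p \<epsilon>) (series_family l p)" if "growth R l" for l
    by (rule series_family_theta[OF that R]) (use e(2) in \<open>auto simp: S_def tau1_def tau2_def subset_iff\<close>)
  with e(1) show ?thesis using that by blast
qed

section \<open>Solutions of the Euler equations\<close>

definition EE :: "'n \<Rightarrow> (complex^('n::{finite,linorder}) \<Rightarrow> complex) \<Rightarrow> complex^('n::{finite,linorder}) \<Rightarrow> complex" where
  "EE j f x = x $ j * pd j f x - c $ j * f x"

definition DD :: "('n \<Rightarrow> complex) \<Rightarrow> (complex^('n::{finite,linorder}) \<Rightarrow> complex) \<Rightarrow> complex^('n::{finite,linorder}) \<Rightarrow> complex" where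
  "DD s f x = (\<Sum>j\<in>UNIV. s j * EE j f x)"

text \<open>The Euler equations in solved form: they put the vector with entries x_j d_j f - c_j f
  into the kernel of A, the span of b1 and b2, and pairing with s1 and s2 gives the two
  coefficients.\<close>

definition eulerian :: "(complex^('n::{finite,linorder})) set \<Rightarrow> (complex^('n::{finite,linorder}) \<Rightarrow> complex) \<Rightarrow> bool" where
  "eulerian U f \<longleftrightarrow> hol_on U f \<and> (\<forall>x\<in>U. \<forall>j. EE j f x = of_int (b1 j) * DD s1 f x + of_int (b2 j) * DD s2 f x)"

lemma hol_on_EE: "hol_on U f \<Longrightarrow> hol_on U (EE j f)"
  unfolding EE_def[abs_def]
  by (intro hol_on_diff hol_on_mult hol_on_coord hol_on_cmult hol_on_pd) (auto simp: hol_on_def)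

lemma hol_on_DD: "hol_on U f \<Longrightarrow> hol_on U (DD s f)"
  unfolding DD_def[abs_def]
  by (intro hol_on_sum hol_on_cmult hol_on_EE) (auto simp: hol_on_def)

lemma EE_cong: "open U \<Longrightarrow> x \<in> U \<Longrightarrow> (\<And>y. y \<in> U \<Longrightarrow> f y = g y) \<Longrightarrow> EE j f x = EE j g x"
  unfolding EE_def using pd_cong[of U x f g j] by simp

lemma DD_cong: "open U \<Longrightarrow> x \<in> U \<Longrightarrow> (\<And>y. y \<in> U \<Longrightarrow> f y = g y) \<Longrightarrow> DD s f x = DD s g x"
  unfolding DD_def using EE_cong[of U x f g] by simp

lemma EE_lincomb:
  assumes "hol_on U f" "hol_on U g" "x \<in> U"
  shows "EE j (\<lambda>x. a * f x + b * g x) x = a * EE j f x + b * EE j g x"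
  unfolding EE_def using pd_add[OF hol_on_cmult[OF assms(1)] hol_on_cmult[OF assms(2)] assms(3), of j a b]
    pd_cmult[OF assms(1,3)] pd_cmult[OF assms(2,3)]
  by (simp add: algebra_simps)

lemma EE_sum:
  assumes "\<And>i. hol_on U (f i)" "x \<in> U" "open U"
  shows "EE j (\<lambda>x. \<Sum>i\<in>(UNIV::'n set). a i * f i x) x = (\<Sum>i\<in>UNIV. a i * EE j (f i) x)"
  unfolding EE_def using pd_sum[of UNIV U "\<lambda>i x. a i * f i x" x j] pd_cmult[OF assms(1,2)] hol_on_cmult[OF assms(1)] assms
  by (simp add: sum_distrib_left right_diff_distrib sum_subtractf mult.left_commute)

lemma EE_commute:
  assumes f: "hol_on U f" and x: "x \<in> U"
  shows "EE i (EE j f) x = EE j (EE i f) x"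
proof (cases "i = j")
  case False
  have U: "open U" using f by (simp add: hol_on_def)
  have "EE i (EE j f) x = x $ i * (x $ j * pd i (pd j f) x - c $ j * pd i f x) - c $ i * (x $ j * pd j f x - c $ j * f x)" if "i \<noteq> j" for i j
  proof -
    have c: "pd i (\<lambda>x. x $ j) x = 0" using that by (simp add: pd_def)
    have "pd i (EE j f) x = pd i (\<lambda>x. x $ j * pd j f x) x - pd i (\<lambda>x. c $ j * f x) x"
      unfolding EE_def[abs_def] by (rule pd_diff[of U]) (intro hol_on_mult hol_on_coord hol_on_cmult hol_on_pd U f x)+
    also have "pd i (\<lambda>x. x $ j * pd j f x) x = x $ j * pd i (pd j f) x"
      using pd_mult[OF hol_on_coord[OF U] hol_on_pd[OF f] x, of i j j] c by simp
    also have "pd i (\<lambda>x. c $ j * f x) x = c $ j * pd i f x" by (rule pd_cmult[OF f x])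
    finally have q: "pd i (EE j f) x = x $ j * pd i (pd j f) x - c $ j * pd i f x" .
    show ?thesis unfolding EE_def[of i "EE j f" x] q EE_def[of j f x] ..
  qed
  note E = this
  show ?thesis
    unfolding E[OF False] E[OF False[symmetric]] using pd_commute[OF f x, of i j] by (simp add: algebra_simps)
qed simp

lemma EE_DD:
  assumes f: "hol_on U f" and x: "x \<in> U"
  shows "EE j (DD s f) x = DD s (EE j f) x"
proof -
  have U: "open U" using f by (simp add: hol_on_def)
  show ?thesis
    unfolding DD_def[abs_def] using EE_sum[where f = "\<lambda>i. EE i f" and a = s and j = j, OF hol_on_EE[OF f] x U] EE_commute[OF f x, of j] by simp
qed

lemma DD_commute:
  assumes f: "hol_on U f" and x: "x \<in> U"
  shows "DD s (DD t f) x = DD t (DD s f) x"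
proof -
  have U: "open U" using f by (simp add: hol_on_def)
  have "DD s (DD t f) x = (\<Sum>i\<in>UNIV. s i * DD t (EE i f) x)"
    unfolding DD_def[of s "DD t f"] using EE_DD[OF f x] by simp
  also have "\<dots> = (\<Sum>i\<in>UNIV. \<Sum>j\<in>UNIV. t j * (s i * EE j (EE i f) x))"
    by (simp add: DD_def sum_distrib_left mult.left_commute)
  also have "\<dots> = (\<Sum>j\<in>UNIV. t j * (\<Sum>i\<in>UNIV. s i * EE j (EE i f) x))"
    by (subst sum.swap) (simp add: sum_distrib_left)
  also have "\<dots> = DD t (DD s f) x"
  proof -
    have dd: "DD s f = (\<lambda>x. \<Sum>i\<in>UNIV. s i * EE i f x)" by (simp add: fun_eq_iff DD_def)
    have "EE j (DD s f) x = (\<Sum>i\<in>UNIV. s i * EE j (EE i f) x)" for j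
      unfolding dd by (rule EE_sum[where f = "\<lambda>i. EE i f", OF hol_on_EE[OF f] x U])
    then show ?thesis by (simp add: DD_def[of t])
  qed
  finally show ?thesis .
qed

text \<open>The operators involved commute, so the equations pass from f to its images; this is what
  allows D1 and D2 to be iterated.\<close>

lemma eulerian_EE:
  assumes f: "eulerian U f"
  shows "eulerian U (EE k f)"
  unfolding eulerian_def
proof (intro conjI ballI allI)
  have hf: "hol_on U f" using f by (simp add: eulerian_def)
  have U: "open U" using hf by (simp add: hol_on_def)
  show "hol_on U (EE k f)" by (rule hol_on_EE[OF hf])
  fix x j assume x: "x \<in> U"
  have "EE j (EE k f) x = EE k (EE j f) x" by (rule EE_commute[OF hf x])
  also have "\<dots> = EE k (\<lambda>x. of_int (b1 j) * DD s1 f x + of_int (b2 j) * DD s2 f x) x"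
    by (rule EE_cong[OF U x]) (use f in \<open>auto simp: eulerian_def\<close>)
  also have "\<dots> = of_int (b1 j) * DD s1 (EE k f) x + of_int (b2 j) * DD s2 (EE k f) x"
    unfolding EE_lincomb[OF hol_on_DD[OF hf] hol_on_DD[OF hf] x] EE_DD[OF hf x] ..
  finally show "EE j (EE k f) x = of_int (b1 j) * DD s1 (EE k f) x + of_int (b2 j) * DD s2 (EE k f) x" .
qed

lemma eulerian_DD:
  assumes f: "eulerian U f"
  shows "eulerian U (DD s f)"
  unfolding eulerian_def
proof (intro conjI ballI allI)
  have hf: "hol_on U f" using f by (simp add: eulerian_def)
  show "hol_on U (DD s f)" by (rule hol_on_DD[OF hf])
  fix x j assume x: "x \<in> U"
  have q: "(\<Sum>i\<in>UNIV. s i * DD t (EE i f) x) = DD t (DD s f) x" for t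
    unfolding DD_commute[OF hf x, of t s] DD_def[of s "DD t f"] EE_DD[OF hf x] ..
  have "EE j (DD s f) x = (\<Sum>i\<in>UNIV. s i * EE j (EE i f) x)" unfolding EE_DD[OF hf x] DD_def[of s] using EE_commute[OF hf x, of j] by simp
  also have "\<dots> = (\<Sum>i\<in>UNIV. s i * (of_int (b1 j) * DD s1 (EE i f) x + of_int (b2 j) * DD s2 (EE i f) x))"
    using eulerian_EE[OF f] x by (simp add: eulerian_def)
  also have "\<dots> = of_int (b1 j) * (\<Sum>i\<in>UNIV. s i * DD s1 (EE i f) x) + of_int (b2 j) * (\<Sum>i\<in>UNIV. s i * DD s2 (EE i f) x)"
    by (simp add: distrib_left sum.distrib sum_distrib_left mult.left_commute)
  finally show "EE j (DD s f) x = of_int (b1 j) * DD s1 (DD s f) x + of_int (b2 j) * DD s2 (DD s f) x"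
    unfolding q .
qed

text \<open>w(D1, D2) f with the powers of D1 on the left. The summation range depends on w only
  formally: \<open>jet_family_eq\<close> allows any larger degree bound.\<close>

definition jet_family :: "(complex^('n::{finite,linorder}) \<Rightarrow> complex) \<Rightarrow> complex poly poly \<Rightarrow> complex^('n::{finite,linorder}) \<Rightarrow> complex" where
  "jet_family f w x = (\<Sum>q\<in>{(i, j). i + j < Suc (degree (grad w))}. coeff (coeff w (fst q)) (snd q) * (DD s1 ^^ fst q) ((DD s2 ^^ snd q) f) x)"

lemma jet_family_eq:
  assumes "w \<in> deg_lt m"
  shows "jet_family f w x = (\<Sum>q\<in>{(i, j). i + j < m}. coeff (coeff w (fst q)) (snd q) * (DD s1 ^^ fst q) ((DD s2 ^^ snd q) f) x)"
proof -
  let ?d = "Suc (degree (grad w))"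
  let ?S = "\<lambda>m. (\<Sum>q\<in>{(i, j). i + j < m}. coeff (coeff w (fst q)) (snd q) * (DD s1 ^^ fst q) ((DD s2 ^^ snd q) f) x)"
  have d: "w \<in> deg_lt ?d" by (simp add: degree_grad)
  have "?S k = ?S (max ?d m)" if "w \<in> deg_lt k" "k \<le> max ?d m" for k
    by (intro sum.mono_neutral_left finite_triangle) (use that in \<open>auto simp: deg_lt_iff not_less\<close>)
  from this[OF d] this[OF assms] show ?thesis by (simp add: jet_family_def)
qed

lemma jet_family_linear: "jet_family f (u + v) x = jet_family f u x + jet_family f v x"
  "jet_family f (cst a * u) x = a * jet_family f u x"
proof -
  obtain m1 m2 where "u \<in> deg_lt m1" "v \<in> deg_lt m2" using in_some_deg_lt by meson
  then have uv: "u \<in> deg_lt (m1 + m2)" "v \<in> deg_lt (m1 + m2)" by (auto elim: deg_lt_mono)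
  show "jet_family f (u + v) x = jet_family f u x + jet_family f v x"
    unfolding jet_family_eq[OF uv(1)] jet_family_eq[OF uv(2)] jet_family_eq[OF deg_lt_add[OF uv]]
    by (simp add: distrib_right sum.distrib)
  show "jet_family f (cst a * u) x = a * jet_family f u x"
    unfolding jet_family_eq[OF uv(1)] jet_family_eq[OF deg_lt_cmult[OF uv(1)]]
    by (simp add: sum_distrib_left cst_def mult.assoc)
qed

lemma jet_family_monom: "jet_family f (XX ^ i * YY ^ j) x = (DD s1 ^^ i) ((DD s2 ^^ j) f) x"
proof -
  have m: "XX ^ i * YY ^ j \<in> deg_lt (Suc (i + j))" by (simp add: monom_in_deg_lt)
  have "jet_family f (XX ^ i * YY ^ j) x = (\<Sum>q\<in>{(a, b). a + b < Suc (i + j)}. if q = (i, j) then (DD s1 ^^ i) ((DD s2 ^^ j) f) x else 0)"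
    unfolding jet_family_eq[OF m]
  proof (intro sum.cong refl)
    fix q
    show "coeff (coeff (XX ^ i * YY ^ j) (fst q)) (snd q) * (DD s1 ^^ fst q) ((DD s2 ^^ snd q) f) x = (if q = (i, j) then (DD s1 ^^ i) ((DD s2 ^^ j) f) x else 0)"
      using coeff_scaled_monom[of 1 i j "fst q" "snd q"] by (auto simp: prod_eq_iff)
  qed
  also have "\<dots> = (DD s1 ^^ i) ((DD s2 ^^ j) f) x" using finite_triangle[of "Suc (i + j)"] by simp
  finally show ?thesis .
qed

lemma jet_family_1: "jet_family f 1 x = f x"
  using jet_family_monom[of f 0 0 x] by simp

lemma jet_family_theta:
  assumes f: "eulerian U f" and nz: "\<And>x j. x \<in> U \<Longrightarrow> x $ j \<noteq> 0"
  shows "theta_family U (jet_family f)"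
proof -
  have hf: "hol_on U f" using f by (simp add: eulerian_def)
  have U: "open U" using hf by (simp add: hol_on_def)
  have e: "eulerian U ((DD s1 ^^ i) ((DD s2 ^^ j) f))" for i j
  proof -
    have "eulerian U ((DD s2 ^^ j) f)" by (induction j) (auto intro: f eulerian_DD)
    then show ?thesis by (induction i) (auto intro: eulerian_DD)
  qed
  then have h: "hol_on U ((DD s1 ^^ i) ((DD s2 ^^ j) f))" for i j by (simp add: eulerian_def)
  have hol: "hol_on U (jet_family f w)" for w
    unfolding jet_family_def[abs_def] by (intro hol_on_sum hol_on_cmult h U)
  \<comment> \<open>Multiplication by Y puts D2 in front of the powers of D1, and it has to be moved
    past them to reach the normal form.\<close>
  have c2: "DD s2 ((DD s1 ^^ i) ((DD s2 ^^ j) f)) x = (DD s1 ^^ i) ((DD s2 ^^ Suc j) f) x" if "x \<in> U" for i j x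
    using that
  proof (induction i arbitrary: x)
    case (Suc i)
    have "DD s2 ((DD s1 ^^ Suc i) ((DD s2 ^^ j) f)) x = DD s1 (DD s2 ((DD s1 ^^ i) ((DD s2 ^^ j) f))) x"
      using DD_commute[OF h Suc.prems] by simp
    also have "\<dots> = DD s1 ((DD s1 ^^ i) ((DD s2 ^^ Suc j) f)) x" by (rule DD_cong[OF U Suc.prems]) (rule Suc.IH)
    finally show ?case by simp
  qed simp
  have pd: "x $ j * pd j (jet_family f w) x = jet_family f (LL j * w) x" if x: "x \<in> U" for x j w
  proof (induction w rule: bipoly_induct)
    case (add u v)
    have "jet_family f (u + v) = (\<lambda>x. jet_family f u x + jet_family f v x)" by (simp add: fun_eq_iff jet_family_linear)
    then show ?case using add pd_add[OF hol hol x, of j u v] by (simp add: distrib_left jet_family_linear)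
  next
    case (scale a u)
    have "jet_family f (cst a * u) = (\<lambda>x. a * jet_family f u x)" by (simp add: fun_eq_iff jet_family_linear)
    then show ?case using scale pd_cmult[OF hol x, of j a u]
      by (simp add: mult.left_commute[of _ "cst a"] mult.left_commute[of _ a] jet_family_linear)
  next
    case (monom a b)
    let ?g = "(DD s1 ^^ a) ((DD s2 ^^ b) f)"
    have "jet_family f (XX ^ a * YY ^ b) = ?g" by (simp add: fun_eq_iff jet_family_monom)
    moreover have "LL j * (XX ^ a * YY ^ b) = cst (c $ j) * (XX ^ a * YY ^ b) + cst (of_int (b1 j)) * (XX ^ Suc a * YY ^ b) + cst (of_int (b2 j)) * (XX ^ a * YY ^ Suc b)"
      by (simp add: LL_def algebra_simps)
    moreover have "EE j ?g x = of_int (b1 j) * DD s1 ?g x + of_int (b2 j) * DD s2 ?g x"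
      using e x by (simp add: eulerian_def)
    ultimately show ?case using c2[OF x, of a b]
      by (simp only: jet_family_linear jet_family_monom) (simp add: EE_def algebra_simps)
  qed
  show ?thesis unfolding theta_family_def bilin_def
    by (intro conjI ballI allI U nz hol pd jet_family_linear)
qed

end

section \<open>The local rank\<close>

lemma ffp_add: "ffp u (m + n) = ffp u m * ffp (u - of_nat m) n"
proof (induction n)
  case (Suc n)
  have "ffp u (m + Suc n) = ffp u (m + n) * (u - of_nat m - of_nat n)" by (simp add: ffp_def algebra_simps)
  also have "\<dots> = ffp u m * ffp (u - of_nat m) (Suc n)" unfolding Suc by (simp add: ffp_def mult.assoc)
  finally show ?case .
qed (simp add: ffp_def)

lemma shift_of_nat [simp]: "shift r s (of_nat n) = of_nat n"
  unfolding of_nat_conv_cst by simp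

lemma shift_prod: "shift r s (prod f I) = (\<Prod>i\<in>I. shift r s (f i))"
  by (simp add: shift_def ev_prod)

lemma shift_ffp: "shift r s (ffp u n) = ffp (shift r s u) n"
  by (simp add: ffp_def shift_prod)

lemma pos_minus_neg: "int (pospart b j) - int (negpart b j) = b j"
  by (simp add: pospart_def negpart_def)

context horn_operators begin

text \<open>The first argument m records the derivatives already applied: moving a monomial derivative of
  multi-order m past the operators replaces the symbol of x_j d/dx_j by itself minus m_j.\<close>
definition PR :: "('n \<Rightarrow> nat) \<Rightarrow> ('n \<Rightarrow> nat) \<Rightarrow> complex poly poly" where
  "PR m u = (\<Prod>j\<in>UNIV. ffp (LL j - of_nat (m j)) (u j))"

lemma PP_conv_PR: "PP b = PR (\<lambda>_. 0) (pospart b)" and QQ_conv_PR: "QQ b = PR (\<lambda>_. 0) (negpart b)"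
  by (simp_all add: PP_def QQ_def PR_def)

lemma PR_mult: "PR (\<lambda>_. 0) m * PR m u = PR (\<lambda>_. 0) (\<lambda>j. m j + u j)"
  by (simp add: PR_def ffp_add prod.distrib)

text \<open>Since b = b_+ - b_-, adding b_j to L_j turns L_j minus the positive part into L_j minus
  the negative part.\<close>

lemma shift_PR: "shift 1 0 (PR (pospart b1) u) = PR (negpart b1) u" "shift 0 1 (PR (pospart b2) u) = PR (negpart b2) u"
proof -
  have "cst (of_int (b j)) = of_nat (pospart b j) - of_nat (negpart b j)" for b :: "'n \<Rightarrow> int" and j
  proof -
    have "of_int (b j) = (of_nat (pospart b j) - of_nat (negpart b j) :: complex)"
      using arg_cong[OF pos_minus_neg[of b j], of "of_int :: int \<Rightarrow> complex"] by simp
    then show ?thesis unfolding of_nat_conv_cst by simp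
  qed
  then have key: "LL j + cst (of_int (b j)) - of_nat (pospart b j) = LL j - of_nat (negpart b j)" for b :: "'n \<Rightarrow> int" and j
    by simp
  show "shift 1 0 (PR (pospart b1) u) = PR (negpart b1) u" "shift 0 1 (PR (pospart b2) u) = PR (negpart b2) u"
    unfolding PR_def shift_prod shift_ffp shift_simps(3) shift_of_nat shift_LL key by (rule refl)+
qed

definition lform :: "'n \<Rightarrow> complex poly" where "lform j = [:of_int (b2 j), of_int (b1 j):]"

lemma PR_form: "PR m u \<in> deg_lt (Suc (\<Sum>j\<in>UNIV. u j)) \<and> form (\<Sum>j\<in>UNIV. u j) (PR m u) = (\<Prod>j\<in>UNIV. lform j ^ u j)"
proof -
  have lin: "LL j - of_nat k \<in> deg_lt (Suc 1) \<and> form 1 (LL j - of_nat k) = lform j" for j k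
  proof
    have X: "XX \<in> deg_lt (Suc 1)" "YY \<in> deg_lt (Suc 1)" "cst a \<in> deg_lt (Suc 1)" for a
      using monom_in_deg_lt[of 1 0 "Suc 1"] monom_in_deg_lt[of 0 1 "Suc 1"] deg_lt_mono[OF cst_in_deg_lt[of a], of "Suc 1"] by auto
    show "LL j - of_nat k \<in> deg_lt (Suc 1)"
      unfolding LL_def of_nat_conv_cst by (intro deg_lt_diff deg_lt_add deg_lt_cmult X)
    have "form 1 XX = [:0, 1:]" "form 1 YY = 1"
      using grad_monom[of 1 0] grad_monom[of 0 1] by (auto simp: monom_altdef)
    then show "form 1 (LL j - of_nat k) = lform j"
      unfolding LL_def of_nat_conv_cst grad_simps(1,3) coeff_add coeff_diff form_cmult form_cst by (simp add: lform_def)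
  qed
  have ff: "ffp (LL j - of_nat k) n \<in> deg_lt (Suc n) \<and> form n (ffp (LL j - of_nat k) n) = lform j ^ n" for j k n
  proof -
    have e: "ffp (LL j - of_nat k) n = (\<Prod>r<n. LL j - of_nat (k + r))" by (simp add: ffp_def algebra_simps)
    have "(\<Prod>r<n. LL j - of_nat (k + r)) \<in> deg_lt (Suc (\<Sum>r<n. 1)) \<and>
      form (\<Sum>r<n. 1) (\<Prod>r<n. LL j - of_nat (k + r)) = (\<Prod>r<n. form 1 (LL j - of_nat (k + r)))"
      by (rule form_prod, simp, rule conjunct1[OF lin])
    then show ?thesis unfolding e conjunct2[OF lin] by simp
  qed
  show ?thesis
    unfolding PR_def using form_prod[of UNIV "\<lambda>j. ffp (LL j - of_nat (m j)) (u j)" u] ff by simp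
qed

text \<open>The dehomogenised leading form of the operator of b, with y standing for the value of
  x^b.\<close>

definition symb :: "('n \<Rightarrow> int) \<Rightarrow> complex \<Rightarrow> complex poly" where
  "symb b y = (\<Prod>j\<in>UNIV. lform j ^ pospart b j) - smult y (\<Prod>j\<in>UNIV. lform j ^ negpart b j)"

text \<open>The four relations express that monomial derivatives commute: \<open>shift_PR\<close>
  and \<open>PR_mult\<close> turn each side into the product of falling factorials for the sum of
  the two multi-orders.\<close>

lemma syzygy_pair_horn:
  assumes d: "(\<Sum>j\<in>UNIV. pospart b1 j) = Suc e1" "(\<Sum>j\<in>UNIV. negpart b1 j) = Suc e1"
      "(\<Sum>j\<in>UNIV. pospart b2 j) = Suc e2" "(\<Sum>j\<in>UNIV. negpart b2 j) = Suc e2"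
    and cop: "coprime (symb b1 y1) (symb b2 y2)" and deg: "degree (symb b1 y1) = Suc e1"
  shows "syzygy_pair (PP b1) (QQ b1) (PP b2) (QQ b2) (PR (pospart b2) (pospart b1)) (PR (pospart b2) (negpart b1))
    (PR (pospart b1) (pospart b2)) (PR (pospart b1) (negpart b2)) y1 y2 e1 e2 (symb b1 y1) (symb b2 y2)"
proof
  note F1 = PR_form[of _ "pospart b1", unfolded d] PR_form[of _ "negpart b1", unfolded d]
  note F2 = PR_form[of _ "pospart b2", unfolded d] PR_form[of _ "negpart b2", unfolded d]
  show "PP b1 \<in> deg_lt (Suc (Suc e1))" "QQ b1 \<in> deg_lt (Suc (Suc e1))"
    "PR (pospart b2) (pospart b1) \<in> deg_lt (Suc (Suc e1))" "PR (pospart b2) (negpart b1) \<in> deg_lt (Suc (Suc e1))"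
    "form (Suc e1) (PP b1) - smult y1 (form (Suc e1) (QQ b1)) = symb b1 y1"
    "form (Suc e1) (PR (pospart b2) (pospart b1)) - smult y1 (form (Suc e1) (PR (pospart b2) (negpart b1))) = symb b1 y1"
    unfolding PP_conv_PR QQ_conv_PR using F1 by (auto simp: symb_def)
  show "PP b2 \<in> deg_lt (Suc (Suc e2))" "QQ b2 \<in> deg_lt (Suc (Suc e2))"
    "PR (pospart b1) (pospart b2) \<in> deg_lt (Suc (Suc e2))" "PR (pospart b1) (negpart b2) \<in> deg_lt (Suc (Suc e2))"
    "form (Suc e2) (PP b2) - smult y2 (form (Suc e2) (QQ b2)) = symb b2 y2"
    "form (Suc e2) (PR (pospart b1) (pospart b2)) - smult y2 (form (Suc e2) (PR (pospart b1) (negpart b2))) = symb b2 y2"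
    unfolding PP_conv_PR QQ_conv_PR using F2 by (auto simp: symb_def)
  show "PP b1 * PR (pospart b1) (pospart b2) = PP b2 * PR (pospart b2) (pospart b1)"
    "PP b1 * PR (pospart b1) (negpart b2) = QQ b2 * shift 0 1 (PR (pospart b2) (pospart b1))"
    "QQ b1 * shift 1 0 (PR (pospart b1) (pospart b2)) = PP b2 * PR (pospart b2) (negpart b1)"
    "QQ b1 * shift 1 0 (PR (pospart b1) (negpart b2)) = QQ b2 * shift 0 1 (PR (pospart b2) (negpart b1))"
    unfolding shift_PR PP_conv_PR QQ_conv_PR PR_mult by (simp_all add: add.commute)
qed (rule cop deg)+

text \<open>The defect is a twisted family. It vanishes at w = 1 on all of U iff it vanishes at p
  for all w, which trades a differential equation for linear conditions at one point.\<close>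

lemma binomial_equation_iff:
  assumes h: "theta_family U h" and U: "connected U" "p \<in> U" and sh: "\<And>j. shift r s (LL j) = LL j + cst (of_int (b j))"
  shows "(\<forall>x\<in>U. dpow (pospart b) (h 1) x = dpow (negpart b) (h 1) x)
    \<longleftrightarrow> (\<forall>w. h (PP b * w - cst (zmon b p) * QQ b * shift r s w) p = 0)"
proof -
  let ?g = "\<lambda>w x. h (PP b * w) x - zmon b x * h (QQ b * shift r s w) x"
  note g = theta_family_twist[OF h sh, where P = "PP b" and Q = "QQ b"]
  have "(\<forall>x\<in>U. dpow (pospart b) (h 1) x = dpow (negpart b) (h 1) x) \<longleftrightarrow> (\<forall>x\<in>U. ?g 1 x = 0)"
    by (intro ball_cong refl) (simp add: theta_family_binomial[OF h])
  also have "\<dots> \<longleftrightarrow> (\<forall>w. ?g w p = 0)"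
  proof
    assume "\<forall>x\<in>U. ?g 1 x = 0"
    then show "\<forall>w. ?g w p = 0" using theta_family_zero_of_one[OF g _ U(2)] by blast
  next
    assume "\<forall>w. ?g w p = 0"
    then show "\<forall>x\<in>U. ?g 1 x = 0" using theta_family_zero[OF g U] by blast
  qed
  also have "\<dots> \<longleftrightarrow> (\<forall>w. h (PP b * w - cst (zmon b p) * QQ b * shift r s w) p = 0)"
    using bilinD(2,4)[OF theta_familyD(4)[OF h U(2)]] by (simp add: mult.assoc)
  finally show ?thesis .
qed

lemma theta_family_subset:
  fixes U V :: "(complex^('n::{finite,linorder})) set"
  shows "theta_family U h \<Longrightarrow> open V \<Longrightarrow> V \<subseteq> U \<Longrightarrow> theta_family V h"
  unfolding theta_family_def by (auto intro: hol_on_subset)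

text \<open>Solutions on a small ball correspond to annihilating functionals:
  \<open>series_family\<close> makes a solution from a functional, and \<open>jet_family\<close>
  makes a functional from a solution.\<close>

theorem local_rank:
  fixes A :: "nat \<Rightarrow> 'n \<Rightarrow> int"
  assumes d: "(\<Sum>j\<in>UNIV. pospart b1 j) = Suc e1" "(\<Sum>j\<in>UNIV. negpart b1 j) = Suc e1"
      "(\<Sum>j\<in>UNIV. pospart b2 j) = Suc e2" "(\<Sum>j\<in>UNIV. negpart b2 j) = Suc e2"
    and AB: "\<And>k. k < CARD('n) - 2 \<Longrightarrow> (\<Sum>j\<in>UNIV. A k j * b1 j) = 0 \<and> (\<Sum>j\<in>UNIV. A k j * b2 j) = 0"
    and ker: "\<And>v :: 'n \<Rightarrow> complex. (\<And>k. k < CARD('n) - 2 \<Longrightarrow> (\<Sum>j\<in>UNIV. of_int (A k j) * v j) = 0)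
       \<Longrightarrow> \<exists>m1 m2. \<forall>j. v j = m1 * of_int (b1 j) + m2 * of_int (b2 j)"
    and p: "\<And>j. p $ j \<noteq> 0"
    and cop: "coprime (symb b1 (zmon b1 p)) (symb b2 (zmon b2 p))" and deg: "degree (symb b1 (zmon b1 p)) = Suc e1"
  shows "\<exists>\<epsilon>>0. \<forall>r. 0 < r \<and> r < \<epsilon> \<longrightarrow> sol_dim_on (ball p r) (hsol b1 b2 A c (ball p r)) (Suc e1 * Suc e2)"
proof -
  interpret S: syzygy_pair "PP b1" "QQ b1" "PP b2" "QQ b2" "PR (pospart b2) (pospart b1)" "PR (pospart b2) (negpart b1)"
    "PR (pospart b1) (pospart b2)" "PR (pospart b1) (negpart b2)" "zmon b1 p" "zmon b2 p" e1 e2 "symb b1 (zmon b1 p)" "symb b2 (zmon b2 p)"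
    by (rule syzygy_pair_horn[OF d cop deg])
  define N where "N = Suc e1 * Suc e2"
  obtain R where R: "R \<ge> 1" "\<And>l. l \<in> S.annihilator \<Longrightarrow> \<exists>K. \<forall>a b. norm (l (XX ^ a * YY ^ b)) \<le> K * fact (a + b) * R ^ (a + b)"
    by (rule S.annihilator_growth) blast
  have gr: "growth R l" if "l \<in> S.annihilator" for l
    using R(2)[OF that] growthI[OF _ R(1)] that unfolding S.annihilator_def by blast
  obtain e L where L: "\<And>i. i < N \<Longrightarrow> L i \<in> S.annihilator"
    "\<And>i j. i < N \<Longrightarrow> j < N \<Longrightarrow> L i (e j) = (if i = j then 1 else 0)"
    "\<And>l w. l \<in> S.annihilator \<Longrightarrow> l w = (\<Sum>i<N. l (e i) * L i w)"
    unfolding N_def by (rule S.annihilator_basis) blast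
  obtain \<epsilon> where \<epsilon>: "\<epsilon> > 0" "\<And>l. growth R l \<Longrightarrow> theta_family (ball p \<epsilon>) (series_family l p)"
    by (rule series_family_radius[OF p R(1)]) blast
  have ps: "p \<in> slit_box p" using p by (simp add: slit_box_def)
  have "sol_dim_on (ball p r) (hsol b1 b2 A c (ball p r)) N" if r: "0 < r" "r < \<epsilon>" for r
  proof -
    define U where "U = ball p r"
    have U: "open U" "connected U" "p \<in> U" "U \<subseteq> ball p \<epsilon>" using r by (auto simp: U_def)
    define h where "h i = series_family (L i) p" for i
    have h: "theta_family U (h i)" if "i < N" for i
      using theta_family_subset[OF \<epsilon>(2)[OF gr[OF L(1)[OF that]]] U(1,4)] by (simp add: h_def)
    have hp: "h i w p = L i w" for i w by (simp add: h_def series_family_self[OF ps])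
    have nz: "x $ j \<noteq> 0" if "x \<in> U" for x j
    proof -
      \<comment> \<open>The zero functional has the required growth, and its family brings the
        nonvanishing of the coordinates on the ball.\<close>
      have "growth R (\<lambda>_. 0)" unfolding growth_def bilin_def by (auto intro!: exI[of _ 0])
      from theta_familyD(2)[OF \<epsilon>(2)[OF this]] show ?thesis using that U(4) by blast
    qed
    have ann: "(\<lambda>w. f w p) \<in> S.annihilator \<longleftrightarrow> (\<forall>x\<in>U. dpow (pospart b1) (f 1) x = dpow (negpart b1) (f 1) x) \<and>
       (\<forall>x\<in>U. dpow (pospart b2) (f 1) x = dpow (negpart b2) (f 1) x)" if f: "theta_family U f" for f
      using theta_familyD(4)[OF f U(3)]
      unfolding binomial_equation_iff[OF f U(2,3) shift_LL(1)] binomial_equation_iff[OF f U(2,3) shift_LL(2)]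
      by (simp add: S.annihilator_def S.T1_def S.T2_def)
    have sol: "h i 1 \<in> hsol b1 b2 A c U" if i: "i < N" for i
    proof -
      note hi = h[OF i]
      have "(\<Sum>j\<in>UNIV. of_int (A k j) * x $ j * pd j (h i 1) x) - (\<Sum>j\<in>UNIV. of_int (A k j) * c $ j) * h i 1 x = 0"
        if k: "k < CARD('n) - 2" and x: "x \<in> U" for k x
      proof -
        note bl = theta_familyD(4)[OF hi x]
        have E: "x $ j * pd j (h i 1) x = c $ j * h i 1 x + of_int (b1 j) * h i XX x + of_int (b2 j) * h i YY x" for j
          using theta_familyD(5)[OF hi x, of j 1] bilinD(1,2)[OF bl] bilinD(2)[OF bl, of _ 1] by (simp add: LL_def)
        have z: "(\<Sum>j\<in>UNIV. of_int (A k j) * of_int (b j)) = (0::complex)" if "(\<Sum>j\<in>UNIV. A k j * b j) = 0" for b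
          using arg_cong[OF that, of "of_int :: int \<Rightarrow> complex"] by simp
        have "(\<Sum>j\<in>UNIV. of_int (A k j) * x $ j * pd j (h i 1) x) - (\<Sum>j\<in>UNIV. of_int (A k j) * c $ j) * h i 1 x
          = (\<Sum>j\<in>UNIV. of_int (A k j) * of_int (b1 j)) * h i XX x + (\<Sum>j\<in>UNIV. of_int (A k j) * of_int (b2 j)) * h i YY x"
          unfolding mult.assoc E by (simp add: distrib_left sum.distrib sum_distrib_right mult.assoc)
        then show ?thesis using z AB[OF k] by simp
      qed
      then show ?thesis
        using theta_familyD(3)[OF hi] ann[OF hi] L(1)[OF i] by (simp add: hsol_def hp)
    qed
    have ind: "a i = 0" if z: "\<forall>x\<in>U. (\<Sum>i<N. a i * h i 1 x) = 0" and i: "i < N" for a i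
    proof -
      have "theta_family U (\<lambda>w x. \<Sum>i<N. a i * h i w x)"
        by (rule theta_family_lincomb) (use U nz h in auto)
      from theta_family_zero_of_one[OF this _ U(3), of "e i"] z have "(\<Sum>k<N. a k * L k (e i)) = 0" by (simp add: hp)
      also have "(\<Sum>k<N. a k * L k (e i)) = (\<Sum>k<N. if k = i then a i else 0)"
        by (intro sum.cong refl) (use L(2)[OF _ i] in auto)
      finally show ?thesis using i by simp
    qed
    have span: "\<exists>a. \<forall>x\<in>U. f x = (\<Sum>i<N. a i * h i 1 x)" if f: "f \<in> hsol b1 b2 A c U" for f
    proof -
      have hf: "hol_on U f" using f by (simp add: hsol_def)
      have eu: "eulerian U f"
        unfolding eulerian_def
      proof (intro conjI ballI allI hf)
        fix x j assume x: "x \<in> U"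
        have "\<exists>m1 m2. \<forall>j. EE j f x = m1 * of_int (b1 j) + m2 * of_int (b2 j)"
        proof (rule ker)
          fix k assume k: "k < CARD('n) - 2"
          have "(\<Sum>j\<in>UNIV. of_int (A k j) * x $ j * pd j f x) - (\<Sum>j\<in>UNIV. of_int (A k j) * c $ j) * f x = 0"
            using f k x by (simp add: hsol_def)
          then show "(\<Sum>j\<in>UNIV. of_int (A k j) * EE j f x) = 0" by (simp add: EE_def right_diff_distrib sum_subtractf sum_distrib_right mult.assoc)
        qed
        then obtain m1 m2 where m: "\<And>j. EE j f x = m1 * of_int (b1 j) + m2 * of_int (b2 j)" by blast
        have "DD s f x = m1 * (\<Sum>j\<in>UNIV. s j * of_int (b1 j)) + m2 * (\<Sum>j\<in>UNIV. s j * of_int (b2 j))" for s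
          by (simp add: DD_def m distrib_left sum.distrib sum_distrib_left mult.left_commute)
        then have "DD s1 f x = m1" "DD s2 f x = m2" using dual by simp_all
        then show "EE j f x = of_int (b1 j) * DD s1 f x + of_int (b2 j) * DD s2 f x" using m by simp
      qed
      have jf: "theta_family U (jet_family f)" by (rule jet_family_theta[OF eu nz])
      have j1: "jet_family f 1 = f" by (simp add: fun_eq_iff jet_family_1)
      have la: "(\<lambda>w. jet_family f w p) \<in> S.annihilator"
        unfolding ann[OF jf] j1 using f by (simp add: hsol_def)
      define a where "a i = jet_family f (e i) p" for i
      \<comment> \<open>Index N carries \<open>jet_family f\<close> itself, so that the difference
        becomes a single linear combination.\<close>
      have "theta_family U (\<lambda>w x. \<Sum>i\<in>{..N}. (if i < N then - a i else 1) * (if i < N then h i w x else jet_family f w x))"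
      proof (rule theta_family_lincomb)
        show "theta_family U (\<lambda>w x. if i < N then h i w x else jet_family f w x)" for i
          using h jf by (cases "i < N") auto
      qed (use U nz in auto)
      moreover have "(\<Sum>i\<in>{..N}. (if i < N then - a i else 1) * (if i < N then h i w x else jet_family f w x))
        = jet_family f w x - (\<Sum>i<N. a i * h i w x)" for w x
      proof -
        have "(\<Sum>i<N. (if i < N then - a i else 1) * (if i < N then h i w x else jet_family f w x)) = (\<Sum>i<N. - (a i * h i w x))"
          by (intro sum.cong) auto
        then show ?thesis unfolding lessThan_Suc_atMost[symmetric] sum.lessThan_Suc by (simp add: sum_negf)
      qed
      ultimately have d: "theta_family U (\<lambda>w x. jet_family f w x - (\<Sum>i<N. a i * h i w x))"
        by (simp only:)
      have "f x = (\<Sum>i<N. a i * h i 1 x)" if x: "x \<in> U" for x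
      proof -
        have "jet_family f w p - (\<Sum>i<N. a i * h i w p) = 0" for w
          using L(3)[OF la, of w] by (simp only: hp a_def diff_self)
        from theta_family_zero[OF d U(2,3) x this, of 1] show ?thesis unfolding j1 by simp
      qed
      then show ?thesis by blast
    qed
    show ?thesis
      unfolding sol_dim_on_def U_def[symmetric]
    proof (intro exI[of _ "\<lambda>i. h i 1"] conjI allI impI ballI)
      show "h i 1 \<in> hsol b1 b2 A c U" if "i < N" for i by (rule sol[OF that])
      show "a i = 0" if "\<forall>x\<in>U. (\<Sum>i<N. a i * h i 1 x) = 0" "i < N" for a i by (rule ind[OF that])
      show "\<exists>a. \<forall>x\<in>U. f x = (\<Sum>i<N. a i * h i 1 x)" if "f \<in> hsol b1 b2 A c U" for f by (rule span[OF that])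
    qed
  qed
  with \<epsilon>(1) show ?thesis unfolding N_def by blast
qed

end

section \<open>The generic locus\<close>

text \<open>The orthogonal complement of the row space of A has dimension n - (n - 2) = 2 and
  contains the independent columns b1 and b2.\<close>

lemma real_kernel_in_span:
  fixes b1 b2 :: "'n::finite \<Rightarrow> int" and A :: "nat \<Rightarrow> 'n \<Rightarrow> int" and v :: "'n \<Rightarrow> real"
  assumes n: "CARD('n) > 2"
    and B_rank: "\<forall>s t :: real. (\<forall>j. s * of_int (b1 j) + t * of_int (b2 j) = 0) \<longrightarrow> s = 0 \<and> t = 0"
    and A_rank: "\<forall>s :: nat \<Rightarrow> real. (\<forall>j. (\<Sum>k<CARD('n) - 2. s k * of_int (A k j)) = 0) \<longrightarrow> (\<forall>k<CARD('n) - 2. s k = 0)"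
    and AB: "\<forall>k<CARD('n) - 2. (\<Sum>j\<in>UNIV. A k j * b1 j) = 0 \<and> (\<Sum>j\<in>UNIV. A k j * b2 j) = 0"
    and v: "\<And>k. k < CARD('n) - 2 \<Longrightarrow> (\<Sum>j\<in>UNIV. of_int (A k j) * v j) = 0"
  shows "\<exists>m1 m2. \<forall>j. v j = m1 * of_int (b1 j) + m2 * of_int (b2 j)"
proof -
  let ?m = "CARD('n) - 2"
  define a where "a k = (\<chi> j. real_of_int (A k j))" for k
  define B1 B2 :: "real^'n" where "B1 = (\<chi> j. real_of_int (b1 j))" and "B2 = (\<chi> j. real_of_int (b2 j))"
  have A0: "s k = 0" if "(\<Sum>k<?m. s k *\<^sub>R a k) = 0" "k < ?m" for s k
  proof -
    have "(\<Sum>k<?m. s k * of_int (A k j)) = 0" for j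
      using arg_cong[OF that(1), of "\<lambda>x. x $ j"] by (simp add: a_def)
    with A_rank that(2) show ?thesis by blast
  qed
  have inj: "inj_on a {..<?m}"
  proof (rule inj_onI, rule ccontr)
    fix i k assume ik: "i \<in> {..<?m}" "k \<in> {..<?m}" "a i = a k" "i \<noteq> k"
    let ?s = "\<lambda>l. (if l = i then 1 else 0) - (if l = k then 1 else 0) :: real"
    have "(\<Sum>l<?m. ?s l *\<^sub>R a l) = (\<Sum>l<?m. (if l = i then a i else 0)) - (\<Sum>l<?m. (if l = k then a k else 0))"
      unfolding sum_subtractf[symmetric] by (intro sum.cong) (auto simp: ik)
    also have "\<dots> = 0" using ik by simp
    finally have "?s i = 0" using A0[of ?s i] ik by blast
    then show False using ik by simp
  qed
  have indA: "independent (a ` {..<?m})"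
  proof (rule independent_if_scalars_zero)
    fix f x assume s: "(\<Sum>x\<in>a ` {..<?m}. f x *\<^sub>R x) = 0" and "x \<in> a ` {..<?m}"
    then obtain k where k: "x = a k" "k < ?m" by auto
    have "(\<Sum>k<?m. f (a k) *\<^sub>R a k) = 0" using s by (simp add: sum.reindex[OF inj])
    from A0[OF this k(2)] show "f x = 0" by (simp add: k)
  qed simp
  define S where "S = span (a ` {..<?m})"
  define T where "T = {y. \<forall>x\<in>S. orthogonal x y}"
  have dimS: "dim S = ?m"
    using indA card_image[OF inj] by (simp add: S_def dim_span_eq_card_independent del: dim_span)
  have "dim T + dim S = CARD('n)"
    using dim_subspace_orthogonal_to_vectors[of S "UNIV :: (real^'n) set"] by (simp add: S_def T_def)
  then have dimT: "dim T = 2" using dimS n by simp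
  have inT: "y \<in> T" if y: "\<And>k. k < ?m \<Longrightarrow> (\<Sum>j\<in>UNIV. of_int (A k j) * y $ j) = 0" for y
  proof -
    have "orthogonal y x" if "x \<in> S" for x
      using that unfolding S_def
      by (rule orthogonal_to_span) (use y in \<open>auto simp: orthogonal_def inner_vec_def a_def mult.commute\<close>)
    then show ?thesis by (simp add: T_def orthogonal_commute)
  qed
  have "(\<Sum>j\<in>UNIV. real_of_int (A k j) * real_of_int (b j)) = 0" if "(\<Sum>j\<in>UNIV. A k j * b j) = 0" for k and b :: "'n \<Rightarrow> int"
    using arg_cong[OF that, of real_of_int] by simp
  then have BT: "B1 \<in> T" "B2 \<in> T" using AB by (auto simp: B1_def B2_def intro!: inT)
  have B0: "s = 0 \<and> t = 0" if "s *\<^sub>R B1 + t *\<^sub>R B2 = 0" for s t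
  proof -
    have "s * of_int (b1 j) + t * of_int (b2 j) = 0" for j
      using arg_cong[OF that, of "\<lambda>x. x $ j"] by (simp add: B1_def B2_def)
    with B_rank show ?thesis by blast
  qed
  have ne: "B1 \<noteq> B2" using B0[of 1 "-1"] by auto
  have indB: "independent {B1, B2}"
  proof (rule independent_if_scalars_zero)
    fix f x assume "(\<Sum>x\<in>{B1, B2}. f x *\<^sub>R x) = 0" "x \<in> {B1, B2}"
    then show "f x = 0" using B0[of "f B1" "f B2"] ne by auto
  qed simp
  have "dim (span {B1, B2}) = 2" using indB ne by (simp add: dim_span_eq_card_independent del: dim_span)
  moreover have "subspace T" unfolding T_def by (auto simp: subspace_def orthogonal_clauses)
  moreover have "span {B1, B2} \<subseteq> T" using BT by (intro span_minimal \<open>subspace T\<close>) auto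
  ultimately have T: "span {B1, B2} = T" using dimT by (intro subspace_dim_equal) auto
  have "(\<chi> j. v j) \<in> T" using v by (intro inT) simp
  then obtain k where "(\<chi> j. v j) - k *\<^sub>R B1 \<in> span {B2}"
    unfolding T[symmetric] span_insert[of B1] by blast
  then obtain l where "(\<chi> j. v j) - k *\<^sub>R B1 = l *\<^sub>R B2" by (auto simp: span_singleton)
  then have "(\<chi> j. v j) = k *\<^sub>R B1 + l *\<^sub>R B2" by (simp add: algebra_simps)
  then have "v j = k * of_int (b1 j) + l * of_int (b2 j)" for j
    by (simp add: vec_eq_iff B1_def B2_def)
  then show ?thesis by blast
qed

lemma complex_kernel_in_span:
  fixes b1 b2 :: "'n::finite \<Rightarrow> int" and A :: "nat \<Rightarrow> 'n \<Rightarrow> int" and v :: "'n \<Rightarrow> complex"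
  assumes real: "CARD('n) > 2"
    "\<forall>s t :: real. (\<forall>j. s * of_int (b1 j) + t * of_int (b2 j) = 0) \<longrightarrow> s = 0 \<and> t = 0"
    "\<forall>s :: nat \<Rightarrow> real. (\<forall>j. (\<Sum>k<CARD('n) - 2. s k * of_int (A k j)) = 0) \<longrightarrow> (\<forall>k<CARD('n) - 2. s k = 0)"
    "\<forall>k<CARD('n) - 2. (\<Sum>j\<in>UNIV. A k j * b1 j) = 0 \<and> (\<Sum>j\<in>UNIV. A k j * b2 j) = 0"
    and v: "\<And>k. k < CARD('n) - 2 \<Longrightarrow> (\<Sum>j\<in>UNIV. of_int (A k j) * v j) = 0"
  shows "\<exists>m1 m2. \<forall>j. v j = m1 * of_int (b1 j) + m2 * of_int (b2 j)"
proof -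
  have re: "(\<Sum>j\<in>UNIV. of_int (A k j) * Re (v j)) = 0" and im: "(\<Sum>j\<in>UNIV. of_int (A k j) * Im (v j)) = 0"
    if "k < CARD('n) - 2" for k
    using arg_cong[OF v[OF that], of Re] arg_cong[OF v[OF that], of Im] by simp_all
  from real_kernel_in_span[OF real re] obtain m1 m2 where "\<And>j. Re (v j) = m1 * of_int (b1 j) + m2 * of_int (b2 j)" by blast
  moreover from real_kernel_in_span[OF real im] obtain n1 n2 where "\<And>j. Im (v j) = n1 * of_int (b1 j) + n2 * of_int (b2 j)" by blast
  ultimately have "v j = Complex m1 n1 * of_int (b1 j) + Complex m2 n2 * of_int (b2 j)" for j
    by (simp add: complex_eq_iff)
  then show ?thesis by blast
qed

text \<open>Cramer's rule on a nonzero 2 by 2 minor.\<close>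

lemma dual_pair_exists:
  fixes b1 b2 :: "'n::finite \<Rightarrow> int"
  assumes B_rank: "\<forall>s t :: real. (\<forall>j. s * of_int (b1 j) + t * of_int (b2 j) = 0) \<longrightarrow> s = 0 \<and> t = 0"
  obtains s1 s2 :: "'n \<Rightarrow> complex" where
    "(\<Sum>j\<in>UNIV. s1 j * of_int (b1 j)) = 1" "(\<Sum>j\<in>UNIV. s1 j * of_int (b2 j)) = 0"
    "(\<Sum>j\<in>UNIV. s2 j * of_int (b1 j)) = 0" "(\<Sum>j\<in>UNIV. s2 j * of_int (b2 j)) = 1"
proof -
  have "\<exists>j k. b1 j * b2 k \<noteq> b1 k * b2 j"
  proof (rule ccontr)
    assume "\<nexists>j k. b1 j * b2 k \<noteq> b1 k * b2 j"
    then have m: "b1 j * b2 k = b1 k * b2 j" for j k by blast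
    obtain j where j: "b1 j \<noteq> 0" using B_rank[rule_format, of 1 0] by auto
    have "real_of_int (b2 j) * of_int (b1 k) + - real_of_int (b1 j) * of_int (b2 k) = 0" for k
      using arg_cong[OF m[of j k], of real_of_int] by simp
    then have "- real_of_int (b1 j) = 0" using B_rank by blast
    with j show False by simp
  qed
  then obtain j k where jk: "b1 j * b2 k \<noteq> b1 k * b2 j" by blast
  then have "j \<noteq> k" by auto
  define D where "D = (of_int (b1 j * b2 k - b1 k * b2 j) :: complex)"
  have D: "D \<noteq> 0" using jk unfolding D_def of_int_eq_0_iff by simp
  define s where "s \<alpha> \<beta> i = (if i = j then \<alpha> / D else if i = k then \<beta> / D else 0)" for \<alpha> \<beta> i
  have S: "(\<Sum>i\<in>UNIV. s \<alpha> \<beta> i * of_int (b i)) = (\<alpha> * of_int (b j) + \<beta> * of_int (b k)) / D" for \<alpha> \<beta> b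
  proof -
    have "(\<Sum>i\<in>UNIV. s \<alpha> \<beta> i * of_int (b i)) = (\<Sum>i\<in>UNIV. (if i = j then \<alpha> * of_int (b j) / D else 0) + (if i = k then \<beta> * of_int (b k) / D else 0))"
      using \<open>j \<noteq> k\<close> by (intro sum.cong) (auto simp: s_def)
    then show ?thesis by (simp add: sum.distrib add_divide_distrib)
  qed
  show ?thesis
    by (rule that[of "s (of_int (b2 k)) (- of_int (b2 j))" "s (- of_int (b1 k)) (of_int (b1 j))"])
      (unfold S, use D in \<open>simp_all add: D_def algebra_simps\<close>)
qed

section \<open>Small perturbations in the torus\<close>

text \<open>A real parameter suffices: the exponential is injective on it and so takes infinitely
  many values.\<close>

lemma finite_avoid_exp:
  fixes F :: "complex set"
  assumes "finite F" "y \<noteq> 0" "\<delta> > 0"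
  obtains u where "norm u < \<delta>" "y * exp u \<notin> F"
proof -
  let ?f = "\<lambda>t::real. y * exp (complex_of_real t)"
  have "inj_on ?f {0<..<\<delta>}"
    using assms(2) by (auto simp: inj_on_def exp_of_real)
  then have "infinite (?f ` {0<..<\<delta>})" using assms(3) by (simp add: finite_image_iff infinite_Ioo)
  then obtain t where "t \<in> {0<..<\<delta>}" "?f t \<notin> F" using assms(1) by (meson finite_subset image_subsetI)
  then show ?thesis using that[of "complex_of_real t"] by simp
qed

text \<open>Moving along the flow of a dual vector changes one of the two coordinates zmon b1, zmon b2 and
  keeps the other fixed.\<close>
definition flow :: "('n::finite \<Rightarrow> complex) \<Rightarrow> complex^'n \<Rightarrow> complex \<Rightarrow> complex^'n" where
  "flow v p u = (\<chi> j. p $ j * exp (u * v j))"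

lemma flow_zmon: "zmon b (flow v p u) = zmon b p * exp (u * (\<Sum>j\<in>UNIV. v j * of_int (b j)))"
proof -
  have "(exp z :: complex) powi n = exp (z * of_int n)" for z n
    by (cases "n \<ge> 0") (simp_all add: power_int_def exp_of_nat2_mult[symmetric] exp_minus power_inverse)
  then show ?thesis
    by (simp add: zmon_def flow_def power_int_mult_distrib prod.distrib sum_distrib_left exp_sum mult.assoc)
qed

lemma flow_near:
  assumes "e > 0"
  obtains \<delta> where "\<delta> > 0" "\<And>u. norm u < \<delta> \<Longrightarrow> dist (flow v p u) p < e"
proof -
  have "continuous_on UNIV (flow v p)"
    unfolding flow_def[abs_def] by (intro continuous_on_vec_lambda continuous_intros)
  then have "isCont (flow v p) 0" by (simp add: continuous_on_eq_continuous_at)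
  moreover have "flow v p 0 = p" by (simp add: flow_def)
  ultimately obtain \<delta> where "\<delta> > 0" "\<And>u. dist u 0 < \<delta> \<Longrightarrow> dist (flow v p u) p < e"
    using assms unfolding continuous_at_eps_delta by metis
  then show ?thesis using that by simp
qed

context horn_operators begin

text \<open>The leading form of the operator of b at x as a form in (s, t), cleared of denominators; being
  homogeneous, its zeros can be sought on the compact unit sphere.\<close>
definition hform :: "('n \<Rightarrow> int) \<Rightarrow> complex \<times> complex \<Rightarrow> complex^('n::{finite,linorder}) \<Rightarrow> complex" where
  "hform b q x = (\<Prod>j\<in>UNIV. (fst q * of_int (b1 j) + snd q * of_int (b2 j)) ^ pospart b j) * (\<Prod>j\<in>UNIV. (x $ j) ^ negpart b j)
     - (\<Prod>j\<in>UNIV. (fst q * of_int (b1 j) + snd q * of_int (b2 j)) ^ negpart b j) * (\<Prod>j\<in>UNIV. (x $ j) ^ pospart b j)"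

lemma hform_scale:
  assumes "(\<Sum>j\<in>UNIV. pospart b j) = d" "(\<Sum>j\<in>UNIV. negpart b j) = d"
  shows "hform b (t * fst q, t * snd q) x = t ^ d * hform b q x"
proof -
  have "(\<Prod>j\<in>UNIV. (t * fst q * of_int (b1 j) + t * snd q * of_int (b2 j)) ^ u j)
     = t ^ (\<Sum>j\<in>UNIV. u j) * (\<Prod>j\<in>UNIV. (fst q * of_int (b1 j) + snd q * of_int (b2 j)) ^ u j)" for u :: "'n \<Rightarrow> nat"
    unfolding power_sum prod.distrib[symmetric] by (intro prod.cong refl) (simp add: power_mult_distrib[symmetric] algebra_simps)
  then show ?thesis unfolding hform_def by (simp add: assms algebra_simps)
qed

lemma zmon_quotient:
  assumes "\<And>j. x $ j \<noteq> 0"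
  shows "zmon b x * (\<Prod>j\<in>UNIV. (x $ j) ^ negpart b j) = (\<Prod>j\<in>UNIV. (x $ j) ^ pospart b j)"
proof -
  have "(x $ j) powi b j * (x $ j) ^ negpart b j = (x $ j) ^ pospart b j" for j
    using assms[of j] by (cases "b j \<ge> 0") (auto simp: pospart_def negpart_def power_int_def power_inverse)
  then show ?thesis by (simp add: zmon_def prod.distrib[symmetric])
qed

lemma hform_symb:
  assumes "\<And>j. x $ j \<noteq> 0"
  shows "hform b (z, 1) x = (\<Prod>j\<in>UNIV. (x $ j) ^ negpart b j) * poly (symb b (zmon b x)) z"
  unfolding hform_def symb_def zmon_quotient[OF assms, symmetric]
  by (simp add: poly_prod lform_def algebra_simps)

lemma coeff_lform_prod: "coeff (\<Prod>j\<in>UNIV. lform j ^ u j) (\<Sum>j\<in>UNIV. u j) = (\<Prod>j\<in>UNIV. of_int (b1 j) ^ u j)"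
  and degree_lform_prod: "degree (\<Prod>j\<in>UNIV. lform j ^ u j) \<le> (\<Sum>j\<in>UNIV. u j)"
proof -
  have d: "degree (lform j ^ n) \<le> n" "coeff (lform j ^ n) n = of_int (b1 j) ^ n" for j n
  proof -
    have l: "degree (lform j) \<le> 1" "coeff (lform j) 1 = of_int (b1 j)" by (auto simp: lform_def)
    show 1: "degree (lform j ^ n) \<le> n" for n
      using degree_power_le[of "lform j" n] l(1) by (metis mult.left_neutral mult_le_mono1 order.trans)
    show "coeff (lform j ^ n) n = of_int (b1 j) ^ n"
    proof (induction n)
      case (Suc n)
      have "coeff (lform j * lform j ^ n) (1 + n) = coeff (lform j) 1 * coeff (lform j ^ n) n"
        using l(1) 1 by (rule coeff_mult_degree_le)
      then show ?case using Suc l(2) by simp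
    qed simp
  qed
  have "degree (\<Prod>j\<in>J. lform j ^ u j) \<le> (\<Sum>j\<in>J. u j) \<and> coeff (\<Prod>j\<in>J. lform j ^ u j) (\<Sum>j\<in>J. u j) = (\<Prod>j\<in>J. of_int (b1 j) ^ u j)" if "finite J" for J
    using that
  proof (induction J rule: finite_induct)
    case (insert i J)
    have "degree (lform i ^ u i * (\<Prod>j\<in>J. lform j ^ u j)) \<le> u i + (\<Sum>j\<in>J. u j)"
      using degree_mult_le d(1)[of i "u i"] insert.IH by (meson add_mono order.trans)
    moreover have "coeff (lform i ^ u i * (\<Prod>j\<in>J. lform j ^ u j)) (u i + (\<Sum>j\<in>J. u j)) = of_int (b1 i) ^ u i * (\<Prod>j\<in>J. of_int (b1 j) ^ u j)"
      using coeff_mult_degree_le[OF d(1)] d(2) insert.IH by metis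
    ultimately show ?case using insert.hyps by simp
  qed simp
  then show "coeff (\<Prod>j\<in>UNIV. lform j ^ u j) (\<Sum>j\<in>UNIV. u j) = (\<Prod>j\<in>UNIV. of_int (b1 j) ^ u j)"
    "degree (\<Prod>j\<in>UNIV. lform j ^ u j) \<le> (\<Sum>j\<in>UNIV. u j)" by auto
qed

lemma lform_prod_root: "poly (\<Prod>j\<in>UNIV. lform j ^ u j) z = 0 \<longleftrightarrow> (\<exists>j. u j > 0 \<and> z * of_int (b1 j) + of_int (b2 j) = 0)"
  by (auto simp: poly_prod lform_def add.commute)

text \<open>Nonvanishing at (1, 0), the point at infinity of the chart (z, 1), means that \<sigma>1
  has exact degree d1; the condition on the sphere excludes common zeros on the projective
  line.\<close>

definition generic :: "(complex^('n::{finite,linorder})) set" where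
  "generic = {x. (\<forall>j. x $ j \<noteq> 0) \<and> hform b1 (1, 0) x \<noteq> 0 \<and> (\<forall>q\<in>sphere 0 1. hform b1 q x \<noteq> 0 \<or> hform b2 q x \<noteq> 0)}"

text \<open>The pairs (q, x) with a common zero q form a closed set, and its projection along the
  compact sphere is closed.\<close>

lemma open_generic: "open generic"
proof -
  have c: "continuous_on UNIV (\<lambda>y. hform b (fst y) (snd y))" for b
    unfolding hform_def by (intro continuous_intros)
  have "closed {x. \<exists>q. q \<in> sphere 0 1 \<and> (q, x) \<in> {y. hform b1 (fst y) (snd y) = 0 \<and> hform b2 (fst y) (snd y) = 0}}"
    by (intro closed_compact_projection closed_Collect_conj closed_Collect_eq c) auto
  then have 1: "open (- {x. \<exists>q. q \<in> sphere 0 1 \<and> (q, x) \<in> {y. hform b1 (fst y) (snd y) = 0 \<and> hform b2 (fst y) (snd y) = 0}})"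
    by (rule open_Compl)
  have 2: "open (\<Inter>j\<in>UNIV. {x :: complex^('n::{finite,linorder}). x $ j \<noteq> 0})"
    by (intro open_INT ballI open_Collect_neq continuous_intros) auto
  have "continuous_on UNIV (\<lambda>x. hform b1 (1, 0) x)" unfolding hform_def by (intro continuous_intros)
  then have 3: "open {x. hform b1 (1, 0) x \<noteq> 0}" by (intro open_Collect_neq continuous_intros)
  have "generic = (\<Inter>j\<in>UNIV. {x. x $ j \<noteq> 0}) \<inter> {x. hform b1 (1, 0) x \<noteq> 0} \<inter>
     - {x. \<exists>q. q \<in> sphere 0 1 \<and> (q, x) \<in> {y. hform b1 (fst y) (snd y) = 0 \<and> hform b2 (fst y) (snd y) = 0}}"
    by (auto simp: generic_def)
  then show ?thesis using 1 2 3 by (simp only: open_Int)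
qed

text \<open>As (1, 0) is not a zero of the first form, each common zero on the sphere rescales to
  the chart (z, 1), and conversely each (z, 1) rescales to the sphere.\<close>

lemma generic_iff:
  assumes d: "(\<Sum>j\<in>UNIV. pospart b1 j) = d1" "(\<Sum>j\<in>UNIV. negpart b1 j) = d1"
      "(\<Sum>j\<in>UNIV. pospart b2 j) = d2" "(\<Sum>j\<in>UNIV. negpart b2 j) = d2"
    and x: "\<And>j. x $ j \<noteq> 0"
  shows "x \<in> generic \<longleftrightarrow> coeff (symb b1 (zmon b1 x)) d1 \<noteq> 0 \<and>
    (\<forall>z. \<not> (poly (symb b1 (zmon b1 x)) z = 0 \<and> poly (symb b2 (zmon b2 x)) z = 0))"
proof -
  note sc = hform_scale[OF d(1,2)] hform_scale[OF d(3,4)]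
  have nz: "(\<Prod>j\<in>UNIV. (x $ j) ^ negpart b j) \<noteq> 0" for b using x by simp
  have ce: "coeff (symb b1 (zmon b1 x)) d1 = (\<Prod>j\<in>UNIV. of_int (b1 j) ^ pospart b1 j) - zmon b1 x * (\<Prod>j\<in>UNIV. of_int (b1 j) ^ negpart b1 j)"
    using coeff_lform_prod[of "pospart b1"] coeff_lform_prod[of "negpart b1"] by (simp add: symb_def d)
  have "hform b1 (1, 0) x = (\<Prod>j\<in>UNIV. (x $ j) ^ negpart b1 j) * coeff (symb b1 (zmon b1 x)) d1"
    unfolding hform_def ce zmon_quotient[OF x, of b1, symmetric] by (simp add: algebra_simps)
  then have 1: "hform b1 (1, 0) x \<noteq> 0 \<longleftrightarrow> coeff (symb b1 (zmon b1 x)) d1 \<noteq> 0" using nz[of b1] by simp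
  have root: "hform b (z, 1) x = 0 \<longleftrightarrow> poly (symb b (zmon b x)) z = 0" for b z
    unfolding hform_symb[OF x] mult_eq_0_iff using nz[of b] by blast
  have 2: "(\<exists>q\<in>sphere 0 1. hform b1 q x = 0 \<and> hform b2 q x = 0) \<longleftrightarrow> (\<exists>z. hform b1 (z, 1) x = 0 \<and> hform b2 (z, 1) x = 0)"
    if h: "hform b1 (1, 0) x \<noteq> 0"
  proof
    assume "\<exists>q\<in>sphere 0 1. hform b1 q x = 0 \<and> hform b2 q x = 0"
    then obtain q where q: "norm q = 1" "hform b1 q x = 0" "hform b2 q x = 0" by auto
    have "snd q \<noteq> 0"
    proof
      assume s: "snd q = 0"
      then have "q = (fst q * fst (1, 0), fst q * snd (1 :: complex, 0 :: complex))" by (simp add: prod_eq_iff)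
      then have "hform b1 q x = fst q ^ d1 * hform b1 (1, 0) x" using sc(1)[of "fst q" "(1, 0)" x] by simp
      moreover have "fst q \<noteq> 0" using q(1) s by (cases q) auto
      ultimately show False using q(2) h by simp
    qed
    then have e: "(fst q / snd q, 1) = (inverse (snd q) * fst q, inverse (snd q) * snd q)" by (simp add: field_simps)
    have "hform b1 (fst q / snd q, 1) x = 0" "hform b2 (fst q / snd q, 1) x = 0" unfolding e sc using q by simp_all
    then show "\<exists>z. hform b1 (z, 1) x = 0 \<and> hform b2 (z, 1) x = 0" by blast
  next
    assume "\<exists>z. hform b1 (z, 1) x = 0 \<and> hform b2 (z, 1) x = 0"
    then obtain z where z: "hform b1 (z, 1) x = 0" "hform b2 (z, 1) x = 0" by blast
    define N where "N = norm (z, 1 :: complex)"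
    have N: "N > 0" by (simp add: N_def zero_prod_def)
    define q where "q = (z, 1 :: complex)"
    let ?t = "complex_of_real (inverse N)"
    have "(?t * fst q, ?t * snd q) = inverse N *\<^sub>R q" by (cases q) (simp add: scaleR_conv_of_real)
    moreover have "norm (inverse N *\<^sub>R q) = 1"
    proof -
      have "norm q = N" by (simp add: q_def N_def)
      then show ?thesis unfolding norm_scaleR using N by simp
    qed
    ultimately have "(?t * fst q, ?t * snd q) \<in> sphere 0 1" by simp
    moreover have "hform b1 (?t * fst q, ?t * snd q) x = 0" "hform b2 (?t * fst q, ?t * snd q) x = 0"
      unfolding sc using z by (simp_all add: q_def)
    ultimately show "\<exists>q\<in>sphere 0 1. hform b1 q x = 0 \<and> hform b2 q x = 0" by blast
  qed
  show ?thesis using 1 2 x root unfolding generic_def by blast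
qed

end

context horn_operators begin

section \<open>Density of the generic locus\<close>

text \<open>The first two products provide rows with b1 > 0 and b1 < 0 on the line b2 = - z b1; the
  third provides a row on it with b2 > 0, so z is nonzero. The first two rows then lie in opposite
  open quadrants.\<close>

lemma no_common_zero:
  assumes no_opp: "\<not> (\<exists>j k. b1 j * b2 k = b2 j * b1 k \<and> b1 j \<noteq> 0 \<and> b2 j \<noteq> 0 \<and>
                    sgn (b1 k) = - sgn (b1 j) \<and> sgn (b2 k) = - sgn (b2 j))"
    and z: "poly (\<Prod>j\<in>UNIV. lform j ^ pospart b1 j) z = 0" "poly (\<Prod>j\<in>UNIV. lform j ^ negpart b1 j) z = 0"
      "poly (\<Prod>j\<in>UNIV. lform j ^ pospart b2 j) z = 0"
  shows False
proof -
  obtain j where j: "b1 j > 0" "z * of_int (b1 j) + of_int (b2 j) = 0"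
    using z(1) unfolding lform_prod_root by (auto simp: pospart_def)
  obtain k where k: "b1 k < 0" "z * of_int (b1 k) + of_int (b2 k) = 0"
    using z(2) unfolding lform_prod_root by (auto simp: negpart_def)
  obtain l where l: "b2 l > 0" "z * of_int (b1 l) + of_int (b2 l) = 0"
    using z(3) unfolding lform_prod_root by (auto simp: pospart_def)
  have jz: "of_int (b2 j) = - z * of_int (b1 j)" and kz: "of_int (b2 k) = - z * of_int (b1 k)"
    using j(2) k(2) by (simp_all add: eq_neg_iff_add_eq_0 add.commute)
  have "z \<noteq> 0" using l by auto
  then have b2j: "b2 j \<noteq> 0" using jz j(1) by auto
  have "complex_of_int (b1 j * b2 k) = of_int (b2 j * b1 k)" by (simp add: jz kz)
  then have e: "b1 j * b2 k = b2 j * b1 k" by (simp only: of_int_eq_iff)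
  have "sgn (b1 j) * sgn (b2 k) = sgn (b2 j) * sgn (b1 k)" using arg_cong[OF e, of sgn] by (simp add: sgn_mult)
  then have "sgn (b2 k) = - sgn (b2 j)" using j(1) k(1) by simp
  moreover have "sgn (b1 k) = - sgn (b1 j)" using j(1) k(1) by simp
  ultimately show False using no_opp e j(1) b2j by (metis less_irrefl)
qed

lemma lform_prod_nz: "(\<And>j. u j > 0 \<Longrightarrow> b1 j \<noteq> 0 \<or> b2 j \<noteq> 0) \<Longrightarrow> (\<Prod>j\<in>UNIV. lform j ^ u j) \<noteq> 0"
  by (auto simp: lform_def)

text \<open>The excluded pairs (y1, y2) lie on the curve y_i = p_i(z) / q_i(z), up to finitely many y1.\<close>
lemma generic_values:
  assumes no_opp: "\<not> (\<exists>j k. b1 j * b2 k = b2 j * b1 k \<and> b1 j \<noteq> 0 \<and> b2 j \<noteq> 0 \<and>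
                    sgn (b1 k) = - sgn (b1 j) \<and> sgn (b2 k) = - sgn (b2 j))"
    and d: "(\<Sum>j\<in>UNIV. pospart b1 j) = d1" "(\<Sum>j\<in>UNIV. negpart b1 j) = d1"
  obtains F1 F2 where "finite F1"
    "\<And>y1. y1 \<notin> F1 \<Longrightarrow> coeff (symb b1 y1) d1 \<noteq> 0 \<and> finite (F2 y1)"
    "\<And>y1 y2 z. y1 \<notin> F1 \<Longrightarrow> y2 \<notin> F2 y1 \<Longrightarrow> \<not> (poly (symb b1 y1) z = 0 \<and> poly (symb b2 y2) z = 0)"
proof -
  define p1 q1 p2 q2 where "p1 = (\<Prod>j\<in>UNIV. lform j ^ pospart b1 j)" and "q1 = (\<Prod>j\<in>UNIV. lform j ^ negpart b1 j)"
    and "p2 = (\<Prod>j\<in>UNIV. lform j ^ pospart b2 j)" and "q2 = (\<Prod>j\<in>UNIV. lform j ^ negpart b2 j)"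
  have s: "symb b1 y = p1 - smult y q1" "symb b2 y = p2 - smult y q2" for y
    by (simp_all add: symb_def p1_def q1_def p2_def q2_def)
  have "p2 \<noteq> 0" unfolding p2_def by (rule lform_prod_nz) (auto simp: pospart_def)
  then have fin2: "finite {z. poly p2 z = 0}" by (rule poly_roots_finite)
  have "coeff q1 d1 = (\<Prod>j\<in>UNIV. of_int (b1 j) ^ negpart b1 j)"
    using coeff_lform_prod[of "negpart b1"] by (simp add: q1_def d)
  then have cq: "coeff q1 d1 \<noteq> 0" by (auto simp: negpart_def)
  \<comment> \<open>The first value is the y1 at which the leading coefficient drops. The others
    include every y1 for which \<open>symb b1 y1\<close> vanishes at a root of p2 that is no root of
    q1; at roots of q1 the quotient is 0, which adds at most one harmless value.\<close>
  define F1 where "F1 = insert (coeff p1 d1 / coeff q1 d1) ((\<lambda>z. poly p1 z / poly q1 z) ` {z. poly p2 z = 0})"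
  define F2 where "F2 y = (\<lambda>z. poly p2 z / poly q2 z) ` {z. poly (symb b1 y) z = 0}" for y
  have c: "coeff (symb b1 y) d1 \<noteq> 0" if "y \<notin> F1" for y
    using that cq by (auto simp: F1_def s field_simps)
  show ?thesis
  proof (rule that[of F1 F2])
    show "finite F1" using fin2 by (simp add: F1_def)
    show "coeff (symb b1 y1) d1 \<noteq> 0 \<and> finite (F2 y1)" if "y1 \<notin> F1" for y1
    proof -
      have "symb b1 y1 \<noteq> 0" using c[OF that] by auto
      then show ?thesis using c[OF that] poly_roots_finite by (auto simp: F2_def)
    qed
    show "\<not> (poly (symb b1 y1) z = 0 \<and> poly (symb b2 y2) z = 0)" if y: "y1 \<notin> F1" "y2 \<notin> F2 y1" for y1 y2 z
    proof
      assume r: "poly (symb b1 y1) z = 0 \<and> poly (symb b2 y2) z = 0"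
      then have e: "poly p1 z = y1 * poly q1 z" "poly p2 z = y2 * poly q2 z" by (simp_all add: s)
      \<comment> \<open>If q2 did not vanish at z, then y2 would lie in F2; so q2 and p2 vanish
        there. Since z is now a root of p2, the same argument with F1 makes q1 and p1 vanish,
        against \<open>no_common_zero\<close>.\<close>
      have "poly q2 z = 0"
      proof (rule ccontr)
        assume "poly q2 z \<noteq> 0"
        then have "y2 = poly p2 z / poly q2 z" using e by simp
        then show False using y(2) r by (auto simp: F2_def)
      qed
      then have p2z: "poly p2 z = 0" using e by simp
      have "poly q1 z = 0"
      proof (rule ccontr)
        assume "poly q1 z \<noteq> 0"
        then have "y1 = poly p1 z / poly q1 z" using e by simp
        then show False using y(1) p2z by (auto simp: F1_def)
      qed
      then show False using no_common_zero[OF no_opp, of z] e p2z by (simp add: p1_def q1_def p2_def)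
    qed
  qed
qed

lemma torus_dense:
  fixes p :: "complex^('n::{finite,linorder})"
  assumes "e > 0"
  obtains q where "dist q p < e" "\<And>j. q $ j \<noteq> 0"
proof -
  define \<delta> where "\<delta> = e / (2 * real CARD('n))"
  have \<delta>: "\<delta> > 0" using assms by (simp add: \<delta>_def)
  define q where "q = (\<chi> j. if p $ j = 0 then complex_of_real \<delta> else p $ j)"
  have "norm (q - p) \<le> (\<Sum>j\<in>UNIV. norm ((q - p) $ j))" unfolding norm_vec_def by (rule L2_set_le_sum) auto
  also have "\<dots> \<le> (\<Sum>j\<in>(UNIV :: 'n set). \<delta>)" using \<delta> by (intro sum_mono) (auto simp: q_def)
  also have "\<dots> < e" using assms by (simp add: \<delta>_def)
  finally have "dist q p < e" by (simp add: dist_norm)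
  moreover have "q $ j \<noteq> 0" for j using \<delta> by (simp add: q_def)
  ultimately show ?thesis using that by blast
qed

text \<open>Three moves, each shorter than e / 3: into the torus, along s1 until x^(b1) avoids F1,
  and along s2 until x^(b2) avoids a finite set. That set depends on the value of x^(b1), which the
  last move preserves.\<close>

lemma dense_generic:
  assumes no_opp: "\<not> (\<exists>j k. b1 j * b2 k = b2 j * b1 k \<and> b1 j \<noteq> 0 \<and> b2 j \<noteq> 0 \<and>
                    sgn (b1 k) = - sgn (b1 j) \<and> sgn (b2 k) = - sgn (b2 j))"
    and d: "(\<Sum>j\<in>UNIV. pospart b1 j) = d1" "(\<Sum>j\<in>UNIV. negpart b1 j) = d1"
      "(\<Sum>j\<in>UNIV. pospart b2 j) = d2" "(\<Sum>j\<in>UNIV. negpart b2 j) = d2"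
  shows "closure generic = UNIV"
proof -
  obtain F1 F2 where F: "finite F1"
    "\<And>y1. y1 \<notin> F1 \<Longrightarrow> coeff (symb b1 y1) d1 \<noteq> 0 \<and> finite (F2 y1)"
    "\<And>y1 y2 z. y1 \<notin> F1 \<Longrightarrow> y2 \<notin> F2 y1 \<Longrightarrow> \<not> (poly (symb b1 y1) z = 0 \<and> poly (symb b2 y2) z = 0)"
    using generic_values[OF no_opp d(1,2)] by metis
  have "\<exists>x\<in>generic. dist x p < e" if "e > 0" for p e
  proof -
    obtain p0 where p0: "dist p0 p < e / 3" "\<And>j. p0 $ j \<noteq> 0" using torus_dense[of "e / 3" p] \<open>e > 0\<close> by auto
    obtain \<delta>1 where \<delta>1: "\<delta>1 > 0" "\<And>u. norm u < \<delta>1 \<Longrightarrow> dist (flow s1 p0 u) p0 < e / 3"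
      using flow_near[of "e / 3" s1 p0] \<open>e > 0\<close> by auto
    obtain u where u: "norm u < \<delta>1" "zmon b1 p0 * exp u \<notin> F1"
      using finite_avoid_exp[OF F(1) zmon_nz \<delta>1(1)] p0(2) by metis
    define p1 where "p1 = flow s1 p0 u"
    have p1: "dist p1 p0 < e / 3" "\<And>j. p1 $ j \<noteq> 0" using \<delta>1(2)[OF u(1)] p0(2) by (auto simp: p1_def flow_def)
    have y1: "zmon b1 p1 \<notin> F1" using u(2) by (simp add: p1_def flow_zmon dual)
    obtain \<delta>2 where \<delta>2: "\<delta>2 > 0" "\<And>u. norm u < \<delta>2 \<Longrightarrow> dist (flow s2 p1 u) p1 < e / 3"
      using flow_near[of "e / 3" s2 p1] \<open>e > 0\<close> by auto
    have "finite (F2 (zmon b1 p1))" using F(2)[OF y1] by simp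
    then obtain v where v: "norm v < \<delta>2" "zmon b2 p1 * exp v \<notin> F2 (zmon b1 p1)"
      using finite_avoid_exp[OF _ zmon_nz \<delta>2(1)] p1(2) by metis
    define p2 where "p2 = flow s2 p1 v"
    have p2: "dist p2 p1 < e / 3" "\<And>j. p2 $ j \<noteq> 0" using \<delta>2(2)[OF v(1)] p1(2) by (auto simp: p2_def flow_def)
    have z: "zmon b1 p2 = zmon b1 p1" "zmon b2 p2 \<notin> F2 (zmon b1 p1)" using v(2) by (simp_all add: p2_def flow_zmon dual)
    have "p2 \<in> generic"
      unfolding generic_iff[OF d p2(2)] z(1) using F(2)[OF y1] F(3)[OF y1 z(2)] by blast
    moreover have "dist p2 p < e"
      using p0(1) p1(1) p2(1) dist_triangle[of p2 p p1] dist_triangle[of p1 p p0] by linarith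
    ultimately show ?thesis by blast
  qed
  then show ?thesis by (auto simp: closure_approachable)
qed

text \<open>A nonconstant common divisor would have a root.\<close>

lemma coprime_if_no_common_root:
  fixes f g :: "complex poly"
  assumes "f \<noteq> 0" "\<And>z. \<not> (poly f z = 0 \<and> poly g z = 0)"
  shows "coprime f g"
proof (rule coprimeI)
  fix r assume r: "r dvd f" "r dvd g"
  then have "r \<noteq> 0" using assms(1) by auto
  have "degree r = 0"
  proof (rule ccontr)
    assume "degree r \<noteq> 0"
    then have "\<not> constant (poly r)" by (simp add: constant_degree)
    then obtain z where "poly r z = 0" using fundamental_theorem_of_algebra by blast
    then show False using assms(2)[of z] r by (auto simp: dvd_def)
  qed
  then show "is_unit r" using \<open>r \<noteq> 0\<close> by (simp add: is_unit_iff_degree)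
qed

end

section \<open>Degrees of the columns and the rank formula\<close>

text \<open>The zero sum gives both terms of the binomial the same degree, and a nonzero entry makes
  it positive; hence the form e + 1 in which the degrees enter the operators.\<close>

lemma gdeg_conv:
  assumes "(\<Sum>j\<in>UNIV. b j) = 0" "b j0 \<noteq> (0 :: int)"
  obtains e where "gdeg b = int (Suc e)" "(\<Sum>j\<in>UNIV. pospart b j) = Suc e" "(\<Sum>j\<in>UNIV. negpart b j) = Suc e"
proof -
  have "int (\<Sum>j\<in>UNIV. pospart b j) = (\<Sum>j\<in>UNIV. if b j > 0 then b j else 0)"
    unfolding of_nat_sum by (intro sum.cong) (auto simp: pospart_def)
  also have "\<dots> = gdeg b" by (simp add: gdeg_def sum.If_cases)
  finally have g: "gdeg b = int (\<Sum>j\<in>UNIV. pospart b j)" ..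
  have "int (\<Sum>j\<in>UNIV. pospart b j) - int (\<Sum>j\<in>UNIV. negpart b j) = (\<Sum>j\<in>UNIV. b j)"
    by (simp add: sum_subtractf[symmetric] pos_minus_neg)
  then have n: "(\<Sum>j\<in>UNIV. negpart b j) = (\<Sum>j\<in>UNIV. pospart b j)" using assms(1) by linarith
  have "(\<Sum>j\<in>UNIV. pospart b j) \<noteq> 0"
  proof
    assume "(\<Sum>j\<in>UNIV. pospart b j) = 0"
    then have "pospart b j0 = 0" "negpart b j0 = 0" using n by simp_all
    then show False using assms(2) by (simp add: pospart_def negpart_def)
  qed
  then obtain e where "(\<Sum>j\<in>UNIV. pospart b j) = Suc e" using not0_implies_Suc by blast
  then show ?thesis using that[of e] g n by simp
qed

theorem theorem12p2:
  fixes b1 b2 :: "'n::{finite,linorder} \<Rightarrow> int"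
    and A :: "nat \<Rightarrow> 'n \<Rightarrow> int"
  assumes n_gt: "CARD('n) > 2"
    and B_rank: "\<forall>s t :: real. (\<forall>j. s * of_int (b1 j) + t * of_int (b2 j) = 0) \<longrightarrow> s = 0 \<and> t = 0"
    and rows_sum: "(\<Sum>j\<in>UNIV. b1 j) = 0 \<and> (\<Sum>j\<in>UNIV. b2 j) = 0"
    and A_rank: "\<forall>s :: nat \<Rightarrow> real. (\<forall>j. (\<Sum>k<CARD('n) - 2. s k * of_int (A k j)) = 0)
                   \<longrightarrow> (\<forall>k<CARD('n) - 2. s k = 0)"
    and A_first: "\<forall>j. A 0 j = 1"
    and AB: "\<forall>k<CARD('n) - 2. (\<Sum>j\<in>UNIV. A k j * b1 j) = 0 \<and> (\<Sum>j\<in>UNIV. A k j * b2 j) = 0"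
    and no_opp: "\<not> (\<exists>j k. b1 j * b2 k = b2 j * b1 k \<and>
                    b1 j \<noteq> 0 \<and> b2 j \<noteq> 0 \<and>
                    sgn (b1 k) = - sgn (b1 j) \<and> sgn (b2 k) = - sgn (b2 j))"
  shows "\<forall>c. has_rank b1 b2 A c (nat (gdeg b1 * gdeg b2))"
proof
  fix c
  obtain s1 s2 :: "'n \<Rightarrow> complex" where dual:
    "(\<Sum>j\<in>UNIV. s1 j * of_int (b1 j)) = 1" "(\<Sum>j\<in>UNIV. s1 j * of_int (b2 j)) = 0"
    "(\<Sum>j\<in>UNIV. s2 j * of_int (b1 j)) = 0" "(\<Sum>j\<in>UNIV. s2 j * of_int (b2 j)) = 1"
    by (rule dual_pair_exists[OF B_rank])
  interpret horn_operators b1 b2 c s1 s2 by unfold_locales (rule dual)+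
  obtain j1 where "b1 j1 \<noteq> 0" using B_rank[rule_format, of 1 0] by auto
  then obtain e1 where e1: "gdeg b1 = int (Suc e1)" "(\<Sum>j\<in>UNIV. pospart b1 j) = Suc e1" "(\<Sum>j\<in>UNIV. negpart b1 j) = Suc e1"
    using gdeg_conv[of b1 j1] rows_sum by blast
  obtain j2 where "b2 j2 \<noteq> 0" using B_rank[rule_format, of 0 1] by auto
  then obtain e2 where e2: "gdeg b2 = int (Suc e2)" "(\<Sum>j\<in>UNIV. pospart b2 j) = Suc e2" "(\<Sum>j\<in>UNIV. negpart b2 j) = Suc e2"
    using gdeg_conv[of b2 j2] rows_sum by blast
  note d = e1(2,3) e2(2,3)
  have N: "nat (gdeg b1 * gdeg b2) = Suc e1 * Suc e2"
    unfolding e1(1) e2(1) of_nat_mult[symmetric] by (rule nat_int)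
  have "\<exists>\<epsilon>>0. \<forall>r. 0 < r \<and> r < \<epsilon> \<longrightarrow> sol_dim_on (ball p r) (hsol b1 b2 A c (ball p r)) (Suc e1 * Suc e2)"
    if "p \<in> generic" for p
  proof -
    have nz: "p $ j \<noteq> 0" for j using that by (simp add: generic_def)
    have g: "coeff (symb b1 (zmon b1 p)) (Suc e1) \<noteq> 0"
      "\<not> (poly (symb b1 (zmon b1 p)) z = 0 \<and> poly (symb b2 (zmon b2 p)) z = 0)" for z
      using that unfolding generic_iff[OF d nz] by blast+
    have "degree (symb b1 (zmon b1 p)) \<le> Suc e1"
      unfolding symb_def using degree_lform_prod[of "pospart b1"] degree_lform_prod[of "negpart b1"]
      by (intro degree_diff_le order.trans[OF degree_smult_le]) (simp_all only: d)
    then have deg: "degree (symb b1 (zmon b1 p)) = Suc e1"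
      using le_degree[OF g(1)] by (rule order.antisym)
    have "coprime (symb b1 (zmon b1 p)) (symb b2 (zmon b2 p))"
      by (rule coprime_if_no_common_root) (use g in auto)
    then show ?thesis
      using AB complex_kernel_in_span[OF n_gt B_rank A_rank AB] by (intro local_rank[OF d _ _ nz _ deg]) blast+
  qed
  then show "has_rank b1 b2 A c (nat (gdeg b1 * gdeg b2))"
    unfolding has_rank_def N using open_generic dense_generic[OF no_opp d] by blast
qed

end
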